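(* Fix $m,k\in\mathbb{Z}$, $u\in\mathbb{C}$ with $\operatorname{Im}u\in(-1,0)$, $v\in\mathbb{R}$, $\rho\in\mathbb{R}\setminus\{0\}$ and $\sigma\in\mathbb{R}$ with $|\sigma|\le\frac12$. For $\delta>0$ with $1/\delta\in\mathbb{Z}_{>0}$ put $$\omega_1=\bar\omega_2=i+\delta,\quad g=i\sqrt{\omega_1\omega_2}\,(m+u\delta),\quad \lambda=i\sqrt{\omega_1\omega_2}\,(k+v\delta),\quad x=i\sqrt{\omega_1\omega_2}\,\bigl(K(\delta)+\sigma\bigr),\quad K(\delta)=\lfloor\rho/\delta\rfloor,$$ and let $$\mathcal{I}_c(z)=e^{\frac{2\pi i}{\omega_1\omega_2}\lambda z}\;\gamma^{(2)}\Bigl(\pm z+\tfrac{\omega_1+\omega_2}{2}-g\Bigr)\;\gamma^{(2)}\Bigl(\pm(z-x)+\tfrac{\omega_1+\omega_2}{2}-g\Bigr).$$ Let $$\mathcal{J}_c(\alpha,\beta)=e^{-2\pi i(\alpha v+\beta k)}\bigl(2\sinh\pi(\alpha+i\beta)\;2\sinh\pi(\alpha-\rho+i\beta-i\sigma)\bigr)^{-m-iu}\bigl(2\sinh\pi(\alpha-i\beta)\;2\sinh\pi(\alpha-\rho-i\beta+i\sigma)\bigr)^{m-iu}$$ for real $\alpha,\beta$ at which the hyperbolic sines do not vanish. Then, as $\delta\to0^+$ along the values with $1/\delta\in\mathbb{Z}_{>0}$, $$\lim_{\delta\to0^+}\ \delta\int_{i\mathbb{R}}\mathcal{I}_c(z)\,\frac{dz}{i\sqrt{\omega_1\omega_2}}=\int_{\mathbb{R}}d\alpha\int_{-1/2}^{1/2}\mathcal{J}_c(\alpha,\beta)\,d\beta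 .$$
   Context: Here $\sqrt{\omega_1\omega_2}=\sqrt{1+\delta^2}>0$, and $i\mathbb{R}$ is the imaginary axis oriented upwards. Hyperbolic gamma function: for $\operatorname{Im}(\omega_1/\omega_2)>0$, $\gamma^{(2)}(z)=\gamma^{(2)}(z;\omega_1,\omega_2)$ is the meromorphic function $$\gamma^{(2)}(z;\omega_1,\omega_2)=e^{-\frac{\pi i}{2}B_{2,2}(z;\omega_1,\omega_2)}\,\frac{(\tilde q\,e^{2\pi i z/\omega_1};\tilde q)_\infty}{(e^{2\pi i z/\omega_2};q)_\infty},\quad q=e^{2\pi i\omega_1/\omega_2},\ \tilde q=e^{-2\pi i\omega_2/\omega_1},$$ $$(x;q)_\infty=\prod_{j=0}^\infty(1-xq^j),\qquad B_{2,2}(z;\omega_1,\omega_2)=\frac{1}{\omega_1\omega_2}\Bigl(\bigl(z-\tfrac{\omega_1+\omega_2}{2}\bigr)^2-\tfrac{\omega_1^2+\omega_2^2}{12}\Bigr).$$ Notation: $\gamma^{(2)}(\pm a+b)=\gamma^{(2)}(a+b)\,\gamma^{(2)}(-a+b)$. Powers: a product $w^{a}\,\bar w^{\,a'}$ with $a,a'\in\mathbb{C}$, $a-a'\in\mathbb{Z}$, $w\in\mathbb{C}\setminus\{0\}$ means $|w|^{a+a'}e^{i(a-a')\arg w}$, which does not depend on the choice of $\arg w$. In $\mathcal{J}_c$ this is used with $w=2\sinh\pi(\alpha+i\beta)\cdot2\sinh\pi(\alpha-\rho+i\beta-i\sigma)$, $a=-m-iu$, $a'=m-iu$. *)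

theory Defs
  imports "HOL-Complex_Analysis.Complex_Analysis"
begin

definition qpoch_inf :: "complex \<Rightarrow> complex \<Rightarrow> complex" where
  "qpoch_inf x q = (\<Prod>j. 1 - x * q ^ j)"

definition B22 :: "complex \<Rightarrow> complex \<Rightarrow> complex \<Rightarrow> complex" where
  "B22 \<omega>1 \<omega>2 z =
     1 / (\<omega>1 * \<omega>2) * ((z - (\<omega>1 + \<omega>2) / 2)\<^sup>2 - (\<omega>1\<^sup>2 + \<omega>2\<^sup>2) / 12)"

(* Meant for Im (\<omega>1 / \<omega>2) > 0.  Numerator and denominator of the quotient have common
   zeros; remove_sings replaces the value of the quotient there by its limit, so that this is the
   meromorphic function (with value 0 at its poles, by the library's convention). *)
definition hyp_gamma :: "complex \<Rightarrow> complex \<Rightarrow> complex \<Rightarrow> complex" where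
  "hyp_gamma \<omega>1 \<omega>2 = remove_sings (\<lambda>z.
     exp (- (of_real pi * \<i> / 2) * B22 \<omega>1 \<omega>2 z) *
     (let q = exp (2 * of_real pi * \<i> * \<omega>1 / \<omega>2);
          q' = exp (- 2 * of_real pi * \<i> * \<omega>2 / \<omega>1)
      in qpoch_inf (q' * exp (2 * of_real pi * \<i> * z / \<omega>1)) q' /
         qpoch_inf (exp (2 * of_real pi * \<i> * z / \<omega>2)) q))"

(* \<gamma>(\<plusminus>a + b) = \<gamma>(a + b) \<gamma>(-a + b) *)
definition hyp_gamma_pm :: "complex \<Rightarrow> complex \<Rightarrow> complex \<Rightarrow> complex \<Rightarrow> complex" where
  "hyp_gamma_pm \<omega>1 \<omega>2 a b = hyp_gamma \<omega>1 \<omega>2 (a + b) * hyp_gamma \<omega>1 \<omega>2 (- a + b)"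

(* The power w^a * (cnj w)^a' for w \<noteq> 0 and a - a' an integer.  The base of powr is a positive
   real, so no branch is chosen there, and the exponential does not depend on the choice of the
   argument since a - a' is an integer. *)
definition bipow :: "complex \<Rightarrow> complex \<Rightarrow> complex \<Rightarrow> complex" where
  "bipow w a a' = of_real (norm w) powr (a + a') * exp (\<i> * (a - a') * of_real (Arg w))"

(* The integral over the imaginary axis oriented upwards, parametrised by z = i t. *)
definition imag_axis_integrable :: "(complex \<Rightarrow> complex) \<Rightarrow> bool" where
  "imag_axis_integrable f \<longleftrightarrow> integrable lborel (\<lambda>t::real. f (\<i> * of_real t) * \<i>)"

definition imag_axis_integral :: "(complex \<Rightarrow> complex) \<Rightarrow> complex" where
  "imag_axis_integral f = (LINT t|lborel. f (\<i> * of_real t) * \<i>)"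

definition omega1 :: "real \<Rightarrow> complex" where
  "omega1 \<delta> = \<i> + of_real \<delta>"

definition omega2 :: "real \<Rightarrow> complex" where
  "omega2 \<delta> = cnj (omega1 \<delta>)"

(* The positive root of omega1 \<delta> * omega2 \<delta> = 1 + \<delta>^2. *)
definition sqrt_omega :: "real \<Rightarrow> complex" where
  "sqrt_omega \<delta> = of_real (sqrt (1 + \<delta>\<^sup>2))"

definition g_param :: "int \<Rightarrow> complex \<Rightarrow> real \<Rightarrow> complex" where
  "g_param m u \<delta> = \<i> * sqrt_omega \<delta> * (of_int m + u * of_real \<delta>)"

definition lambda_param :: "int \<Rightarrow> real \<Rightarrow> real \<Rightarrow> complex" where
  "lambda_param k v \<delta> = \<i> * sqrt_omega \<delta> * (of_int k + of_real v * of_real \<delta>)"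

definition x_param :: "real \<Rightarrow> real \<Rightarrow> real \<Rightarrow> complex" where
  "x_param \<rho> \<sigma> \<delta> = \<i> * sqrt_omega \<delta> * (of_int \<lfloor>\<rho> / \<delta>\<rfloor> + of_real \<sigma>)"

definition I_c :: "complex \<Rightarrow> complex \<Rightarrow> complex \<Rightarrow> complex \<Rightarrow> complex \<Rightarrow> complex \<Rightarrow> complex" where
  "I_c \<omega>1 \<omega>2 g l x z =
     exp (2 * of_real pi * \<i> / (\<omega>1 * \<omega>2) * l * z) *
     hyp_gamma_pm \<omega>1 \<omega>2 z ((\<omega>1 + \<omega>2) / 2 - g) *
     hyp_gamma_pm \<omega>1 \<omega>2 (z - x) ((\<omega>1 + \<omega>2) / 2 - g)"

(* The bases of the two powers are complex conjugates of each other for real arguments. *)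
definition J_c ::
  "int \<Rightarrow> int \<Rightarrow> complex \<Rightarrow> real \<Rightarrow> real \<Rightarrow> real \<Rightarrow> real \<Rightarrow> real \<Rightarrow> complex" where
  "J_c m k u v \<rho> \<sigma> \<alpha> \<beta> =
     exp (- 2 * of_real pi * \<i> * (of_real \<alpha> * of_real v + of_real \<beta> * of_int k)) *
     bipow
       ((2 * sinh (of_real pi * (of_real \<alpha> + \<i> * of_real \<beta>))) *
        (2 * sinh (of_real pi * (of_real \<alpha> - of_real \<rho> + \<i> * of_real \<beta> - \<i> * of_real \<sigma>))))
       (- of_int m - \<i> * u) (of_int m - \<i> * u)"

end

theory Submission
  imports Defs
begin

text \<open>Put \<open>z = \<i> S y\<close> with \<open>S = sqrt (1 + \<delta>\<^sup>2)\<close> and \<open>y = n + \<beta>\<close>, where \<open>n\<close> is the integer next to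
  \<open>\<alpha> / \<delta>\<close> and \<open>\<bar>\<beta>\<bar> \<le> 1/2\<close>. Then \<open>\<delta> \<integral> dy\<close> becomes \<open>\<integral> d\<alpha> \<integral> d\<beta>\<close>, and the theorem follows by dominated
  convergence from a pointwise limit and a uniform bound for \<open>\<gamma>(\<plusminus>z + (\<omega>1 + \<omega>2)/2 - g)\<close>.

  By the reflection formula \<open>\<gamma>(z) \<gamma>(\<omega>1 + \<omega>2 - z) = 1\<close> this pair is a product of quotients
  \<open>(Y q^e; q) / (Y; q)\<close> and their complex conjugates, where \<open>Y\<close> is close to \<open>exp (-2 \<pi> (\<alpha> + \<i> \<beta>))\<close>; by
  evenness one may assume \<open>y \<ge> 0\<close>, so that \<open>\<bar>Y\<bar>\<close> is at most about 1. As \<open>q\<close> tends to 1 such a quotient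
  behaves like \<open>(1 - Y) powr (- e)\<close>, up to a bounded factor that tends to 1 when \<open>\<bar>Y\<bar>\<close> stays below 1.
  In the absolute value only real exponents \<open>e = - S Im u < 1\<close> remain, which makes the singularities
  at \<open>\<alpha> + \<i> \<beta> = 0\<close> and \<open>\<alpha> + \<i> \<beta> = \<rho> + \<i> \<sigma>\<close> (modulo \<open>\<i>\<close>) integrable.

  The reflection formula is the modular transformation of the theta function \<open>(x; q) (q / x; q)\<close>. The
  quotient of the two sides is an elliptic function without poles, hence a constant; its values at the
  three half periods show that it is a cube root of unity, and continuity in \<open>\<delta>\<close> gives 1.\<close>

section \<open>The infinite q-Pochhammer symbol\<close>

text \<open>The definition of the gamma function pairs symbols in two nomes that both tend to 1, so
  no single symbol has a useful limit. Only quotients in one and the same nome do, and their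
  expansion needs arguments of modulus at most about 1.

  Near \<open>\<alpha> = 0\<close> the arguments come within order \<delta> of the zeros of the
  factors, where no expansion in the nome is uniform. Hence a number of factors independent of
  \<delta> is split off and estimated one by one; the rest lies far enough inside the unit disc.

  With \<open>s = - Im u\<close>, a pair is singular like the power \<open>- 2 * s\<close> of the
  distance to its singularity. As \<open>2 * s < 2\<close> this is integrable in the plane, but
  possibly not along a line. The majorant is therefore a product of one-dimensional powers, half of
  the exponent being charged to \<alpha> and half to \<beta>. For finite \<delta> the exponent
  involves S and moves with \<delta>; \<open>r = (1 + s) / 2\<close> is a fixed number between
  \<open>S * s\<close> and 1. Finally \<open>\<rho> \<noteq> 0\<close> puts the singularities of the
  two pairs at different \<alpha>, so that one pair is bounded where the other is large.\<close>

lemma qpoch_convergent: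
  assumes "norm q < 1"
  shows "convergent_prod (\<lambda>j. 1 - x * q ^ j :: complex)"
proof -
  have "summable (\<lambda>j. norm (- (x * q ^ j)))"
    using assms by (simp add: norm_mult norm_power summable_mult summable_geometric)
  then have "abs_convergent_prod (\<lambda>j. 1 + - (x * q ^ j))"
    using summable_imp_abs_convergent_prod[of "\<lambda>j. 1 - x * q ^ j"] by simp
  then show ?thesis
    using abs_convergent_prod_imp_convergent_prod by fastforce
qed

lemma qpoch_LIMSEQ:
  assumes "norm q < 1"
  shows "(\<lambda>n. \<Prod>j<n. 1 - x * q ^ j) \<longlonglongrightarrow> qpoch_inf x q"
  using convergent_prod_LIMSEQ[OF qpoch_convergent[OF assms, of x]]
  by (simp add: qpoch_inf_def flip: LIMSEQ_lessThan_iff_atMost)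

lemma qpoch_eqI:
  assumes "norm q < 1" "(\<lambda>n. \<Prod>j<n. 1 - x * q ^ j) \<longlonglongrightarrow> L"
  shows "qpoch_inf x q = L"
  using LIMSEQ_unique[OF qpoch_LIMSEQ[OF assms(1)] assms(2)] .

lemma qpoch_nonzero:
  assumes "norm q < 1" "\<And>j. x * q ^ j \<noteq> 1"
  shows "qpoch_inf x q \<noteq> 0"
  unfolding qpoch_inf_def
  by (rule prodinf_nonzero[OF qpoch_convergent[OF assms(1)]]) (metis assms(2) right_minus_eq)

lemma qpoch_shift:
  assumes "norm q < 1"
  shows "qpoch_inf x q = (\<Prod>j<n. 1 - x * q ^ j) * qpoch_inf (x * q ^ n) q"
proof (rule qpoch_eqI[OF assms])
  have "(\<Prod>j<m + n. 1 - x * q ^ j) = (\<Prod>j<n. 1 - x * q ^ j) * (\<Prod>j<m. 1 - x * q ^ n * q ^ j)" for m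
  proof -
    have "{..<m + n} = {..<n} \<union> {n..<n + m}" "{..<n} \<inter> {n..<n + m} = {}" by auto
    then have "(\<Prod>j<m + n. 1 - x * q ^ j) = (\<Prod>j<n. 1 - x * q ^ j) * (\<Prod>j\<in>{n..<n + m}. 1 - x * q ^ j)"
      by (simp add: prod.union_disjoint)
    also have "(\<Prod>j\<in>{n..<n + m}. 1 - x * q ^ j) = (\<Prod>j<m. 1 - x * q ^ n * q ^ j)"
      by (rule prod.reindex_bij_witness[of _ "\<lambda>j. j + n" "\<lambda>j. j - n"]) (auto simp: mult.assoc simp flip: power_add)
    finally show ?thesis .
  qed
  moreover have "(\<lambda>m. (\<Prod>j<n. 1 - x * q ^ j) * (\<Prod>j<m. 1 - x * q ^ n * q ^ j)) \<longlonglongrightarrow>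
      (\<Prod>j<n. 1 - x * q ^ j) * qpoch_inf (x * q ^ n) q"
    by (intro tendsto_intros qpoch_LIMSEQ assms)
  ultimately show "(\<lambda>m. \<Prod>j<m. 1 - x * q ^ j) \<longlonglongrightarrow> (\<Prod>j<n. 1 - x * q ^ j) * qpoch_inf (x * q ^ n) q"
    using LIMSEQ_offset[of "\<lambda>m. \<Prod>j<m. 1 - x * q ^ j" n] by simp
qed

lemma qpoch_Suc:
  assumes "norm q < 1"
  shows "qpoch_inf x q = (1 - x) * qpoch_inf (x * q) q"
  using qpoch_shift[OF assms, of x 1] by simp

lemma qpoch_cnj:
  assumes "norm q < 1"
  shows "qpoch_inf (cnj x) (cnj q) = cnj (qpoch_inf x q)"
proof (rule qpoch_eqI)
  have "(\<lambda>n. cnj (\<Prod>j<n. 1 - x * q ^ j)) \<longlonglongrightarrow> cnj (qpoch_inf x q)"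
    by (intro tendsto_intros qpoch_LIMSEQ assms)
  then show "(\<lambda>n. \<Prod>j<n. 1 - cnj x * cnj q ^ j) \<longlonglongrightarrow> cnj (qpoch_inf x q)" by simp
qed (use assms in simp)

text \<open>On a small closed ball the factors differ from 1 by at most \<open>M * r ^ j\<close>
  with \<open>r < 1\<close>, so the M-test gives uniform convergence. The base may vary together
  with \<open>z\<close>; this later yields continuity in the nome.\<close>

lemma qpoch_holomorphic:
  assumes "open S" and f: "f holomorphic_on S" and g: "g holomorphic_on S"
    and lt: "\<And>z. z \<in> S \<Longrightarrow> norm (g z) < 1"
  shows "(\<lambda>z. qpoch_inf (f z) (g z)) holomorphic_on S"
proof (rule holomorphic_uniform_sequence[OF \<open>open S\<close>, where f = "\<lambda>n z. \<Prod>j<n. 1 - f z * g z ^ j"])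
  show "(\<lambda>z. \<Prod>j<n. 1 - f z * g z ^ j) holomorphic_on S" for n
    by (intro holomorphic_intros f g)
  fix x assume "x \<in> S"
  then obtain d where d: "d > 0" "cball x d \<subseteq> S"
    using \<open>open S\<close> open_contains_cball by blast
  define A where "A = cball x d"
  have A: "compact A" "A \<noteq> {}" using d by (auto simp: A_def)
  have cf: "continuous_on A f" "continuous_on A g"
    using d f g unfolding A_def by (meson holomorphic_on_imp_continuous_on holomorphic_on_subset)+
  obtain M where M: "\<And>z. z \<in> A \<Longrightarrow> norm (f z) \<le> M"
    using compact_imp_bounded[OF compact_continuous_image[OF cf(1) A(1)]] by (auto simp: bounded_iff)
  obtain z0 where z0: "z0 \<in> A" "\<And>z. z \<in> A \<Longrightarrow> norm (g z) \<le> norm (g z0)"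
    using continuous_attains_sup[OF A continuous_on_norm[OF cf(2)]] by blast
  define r where "r = norm (g z0)"
  have r: "0 \<le> r" "r < 1" "\<And>z. z \<in> A \<Longrightarrow> norm (g z) \<le> r"
    using z0 lt d by (auto simp: r_def A_def)
  have "uniformly_convergent_on A (\<lambda>n z. \<Prod>j<n. 1 - f z * g z ^ j)"
  proof (rule uniformly_convergent_on_prod')
    show "uniformly_convergent_on A (\<lambda>n z. \<Sum>j<n. norm (1 - f z * g z ^ j - 1))"
    proof (rule Weierstrass_m_test')
      show "norm (norm (1 - f z * g z ^ j - 1)) \<le> M * r ^ j" if "z \<in> A" for j z
      proof -
        have "norm (f z) * norm (g z) ^ j \<le> M * r ^ j"
          using M[OF that] r(3)[OF that] by (intro mult_mono power_mono order_trans[OF norm_ge_zero M[OF that]]) auto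
        then show ?thesis by (simp add: norm_mult norm_power)
      qed
      show "summable (\<lambda>j. M * r ^ j)" using r by (intro summable_mult summable_geometric) auto
    qed
  qed (intro continuous_intros cf A)+
  then obtain l where l: "uniform_limit A (\<lambda>n z. \<Prod>j<n. 1 - f z * g z ^ j) l sequentially"
    by (auto simp: uniformly_convergent_on_def)
  have eq: "l z = qpoch_inf (f z) (g z)" if "z \<in> A" for z
    using qpoch_eqI[OF _ tendsto_uniform_limitI[OF l that]] lt that d by (auto simp: A_def)
  then have "uniform_limit A (\<lambda>n z. \<Prod>j<n. 1 - f z * g z ^ j) (\<lambda>z. qpoch_inf (f z) (g z)) sequentially"
  proof -
    have "uniform_limit A (\<lambda>n z. \<Prod>j<n. 1 - f z * g z ^ j) l sequentially \<longleftrightarrow>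
        uniform_limit A (\<lambda>n z. \<Prod>j<n. 1 - f z * g z ^ j) (\<lambda>z. qpoch_inf (f z) (g z)) sequentially"
      by (rule uniform_limit_cong') (use eq in auto)
    with l show ?thesis by blast
  qed
  then show "\<exists>d>0. cball x d \<subseteq> S \<and>
      uniform_limit (cball x d) (\<lambda>n z. \<Prod>j<n. 1 - f z * g z ^ j) (\<lambda>z. qpoch_inf (f z) (g z)) sequentially"
    using d unfolding A_def by blast
qed

lemma qpoch_square:
  assumes "norm q < 1"
  shows "qpoch_inf (x\<^sup>2) (q\<^sup>2) = qpoch_inf x q * qpoch_inf (- x) q"
proof (rule qpoch_eqI)
  have "(\<lambda>n. (\<Prod>j<n. 1 - x * q ^ j) * (\<Prod>j<n. 1 - (- x) * q ^ j)) \<longlonglongrightarrow> qpoch_inf x q * qpoch_inf (- x) q"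
    by (intro tendsto_intros qpoch_LIMSEQ assms)
  moreover have "(\<Prod>j<n. 1 - x * q ^ j) * (\<Prod>j<n. 1 - (- x) * q ^ j) = (\<Prod>j<n. 1 - x\<^sup>2 * (q\<^sup>2) ^ j)" for n
  proof -
    have "(1 - x * q ^ j) * (1 - (- x) * q ^ j) = 1 - x\<^sup>2 * (q\<^sup>2) ^ j" for j
    proof -
      have "(q\<^sup>2) ^ j = (q ^ j)\<^sup>2" by (metis power_mult mult.commute)
      then show ?thesis by (simp add: algebra_simps power2_eq_square)
    qed
    then show ?thesis unfolding prod.distrib[symmetric] by simp
  qed
  ultimately show "(\<lambda>n. \<Prod>j<n. 1 - x\<^sup>2 * (q\<^sup>2) ^ j) \<longlonglongrightarrow> qpoch_inf x q * qpoch_inf (- x) q" by simp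
  show "norm (q\<^sup>2) < 1" using assms by (simp add: norm_power power_less_one_iff)
qed

lemma qpoch_even_odd:
  assumes "norm q < 1"
  shows "qpoch_inf x q = qpoch_inf x (q\<^sup>2) * qpoch_inf (x * q) (q\<^sup>2)"
proof (rule qpoch_eqI[OF assms])
  have q2: "norm (q\<^sup>2) < 1" using assms by (simp add: norm_power power_less_one_iff)
  have lim: "(\<lambda>n. (\<Prod>j<n. 1 - x * (q\<^sup>2) ^ j) * (\<Prod>j<n. 1 - x * q * (q\<^sup>2) ^ j)) \<longlonglongrightarrow>
    qpoch_inf x (q\<^sup>2) * qpoch_inf (x * q) (q\<^sup>2)"
    by (intro tendsto_intros qpoch_LIMSEQ q2)
  have "(\<Prod>j<n. 1 - x * (q\<^sup>2) ^ j) * (\<Prod>j<n. 1 - x * q * (q\<^sup>2) ^ j) = (\<Prod>j<2 * n. 1 - x * q ^ j)" for n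
  proof (induction n)
    case (Suc n)
    have *: "(\<Prod>j<2 * Suc n. 1 - x * q ^ j) = (\<Prod>j<2 * n. 1 - x * q ^ j) * (1 - x * q ^ (2 * n)) * (1 - x * q ^ Suc (2 * n))"
      by simp
    show ?case unfolding * Suc[symmetric]
      by (simp only: prod.lessThan_Suc power_mult[symmetric] power_Suc mult_ac)
  qed simp
  with lim have "(\<lambda>n. \<Prod>j<2 * n. 1 - x * q ^ j) \<longlonglongrightarrow> qpoch_inf x (q\<^sup>2) * qpoch_inf (x * q) (q\<^sup>2)"
    by simp
  moreover have "(\<lambda>n. \<Prod>j<2 * n. 1 - x * q ^ j) \<longlonglongrightarrow> qpoch_inf x q"
    using LIMSEQ_subseq_LIMSEQ[OF qpoch_LIMSEQ[OF assms], of "\<lambda>n. 2 * n" x]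
    by (simp add: o_def strict_mono_def)
  ultimately show "(\<lambda>n. \<Prod>j<n. 1 - x * q ^ j) \<longlonglongrightarrow> qpoch_inf x (q\<^sup>2) * qpoch_inf (x * q) (q\<^sup>2)"
    using qpoch_LIMSEQ[OF assms, of x] LIMSEQ_unique by metis
qed

text \<open>This is Euler's identity between the products for partitions into distinct and into odd
  parts, with the odd product factored over \<open>p\<close> and \<open>- p\<close>. Splitting
  \<open>qpoch_inf (p\<^sup>2) (p\<^sup>2)\<close> into even and odd factors reproduces the same
  symbol on the right, where it cancels because it is not zero.\<close>

lemma qpoch_euler:
  assumes "norm p < 1"
  shows "qpoch_inf (- (p\<^sup>2)) (p\<^sup>2) * qpoch_inf (- p) (p\<^sup>2) * qpoch_inf p (p\<^sup>2) = 1"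
proof -
  have p1: "norm (p\<^sup>2) < 1" using assms by (simp add: norm_power power_less_one_iff)
  have nz: "qpoch_inf (p\<^sup>2) (p\<^sup>2) \<noteq> 0"
  proof (rule qpoch_nonzero[OF p1])
    fix j
    have "norm (p\<^sup>2 * (p\<^sup>2) ^ j) < 1"
      using p1 power_less_one_iff[of "norm (p\<^sup>2)" "Suc j"] by (simp add: norm_mult norm_power flip: power_Suc)
    then show "p\<^sup>2 * (p\<^sup>2) ^ j \<noteq> 1" by auto
  qed
  have "qpoch_inf (p\<^sup>2) (p\<^sup>2) = qpoch_inf (p\<^sup>2) ((p\<^sup>2)\<^sup>2) * qpoch_inf ((p\<^sup>2)\<^sup>2) ((p\<^sup>2)\<^sup>2)"
    using qpoch_even_odd[OF p1, of "p\<^sup>2"] by (simp add: power2_eq_square)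
  also have "qpoch_inf ((p\<^sup>2)\<^sup>2) ((p\<^sup>2)\<^sup>2) = qpoch_inf (p\<^sup>2) (p\<^sup>2) * qpoch_inf (- (p\<^sup>2)) (p\<^sup>2)"
    by (rule qpoch_square[OF p1])
  also have "qpoch_inf (p\<^sup>2) ((p\<^sup>2)\<^sup>2) = qpoch_inf p (p\<^sup>2) * qpoch_inf (- p) (p\<^sup>2)"
    by (rule qpoch_square[OF p1])
  finally show ?thesis using nz by (simp add: field_simps)
qed

section \<open>The modular transformation of the theta function\<close>

lemma complex_lattice_coords:
  fixes w1 w2 z :: complex
  assumes "Im (w1 / w2) > 0"
  obtains a b :: real where "z = of_real a * w1 + of_real b * w2"
proof -
  have w2: "w2 \<noteq> 0" using assms by auto
  define a where "a = Im (z / w2) / Im (w1 / w2)"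
  define b where "b = Re (z / w2) - a * Re (w1 / w2)"
  define t where "t = w1 / w2"
  have "Re (z / w2) = a * Re t + b" "Im (z / w2) = a * Im t"
    using assms by (simp_all add: a_def b_def t_def)
  then have "z / w2 = of_real a * (w1 / w2) + of_real b"
    unfolding t_def[symmetric] by (intro complex_eqI) simp_all
  then have "z = of_real a * w1 + of_real b * w2"
    using w2 by (simp add: field_simps)
  then show ?thesis using that by blast
qed

lemma periodic_of_int:
  fixes f :: "complex \<Rightarrow> 'a"
  assumes "\<And>z. f (z + w) = f z"
  shows "f (z + of_int n * w) = f z"
proof (induction n arbitrary: z rule: int_induct[of _ 0])
  case (step1 i)
  have "f (z + of_int (i + 1) * w) = f (z + of_int i * w + w)" by (simp add: algebra_simps)
  also have "\<dots> = f (z + of_int i * w)" by (rule assms)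
  finally show ?case using step1 by simp
next
  case (step2 i)
  have "f (z + of_int (i - 1) * w) = f (z + of_int (i - 1) * w + w)" by (rule assms[symmetric])
  also have "\<dots> = f (z + of_int i * w)" by (simp add: algebra_simps)
  finally show ?case using step2 by simp
qed simp

text \<open>Reducing the lattice coordinates modulo 1 shows that every value is attained on the
  compact period parallelogram, so the function is bounded and Liouville's theorem applies.\<close>

lemma entire_doubly_periodic_constant:
  fixes f :: "complex \<Rightarrow> complex"
  assumes hol: "f holomorphic_on UNIV" and im: "Im (w1 / w2) > 0"
    and p1: "\<And>z. f (z + w1) = f z" and p2: "\<And>z. f (z + w2) = f z"
  shows "f constant_on UNIV"
proof (rule Liouville_theorem[OF hol])
  define K where "K = (\<lambda>(a, b). of_real a * w1 + of_real b * w2) ` ({0..1::real} \<times> {0..1::real})"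
  have "compact K" unfolding K_def
    by (intro compact_continuous_image compact_Times) (auto intro!: continuous_intros simp: case_prod_unfold)
  then have "bounded (f ` K)"
    using hol by (meson compact_continuous_image compact_imp_bounded holomorphic_on_imp_continuous_on
        holomorphic_on_subset subset_UNIV)
  moreover have "range f \<subseteq> f ` K"
  proof
    fix y assume "y \<in> range f"
    then obtain z where y: "y = f z" by auto
    obtain a b where z: "z = of_real a * w1 + of_real b * w2" using complex_lattice_coords[OF im] .
    have "f z = f (z + of_int (- \<lfloor>a\<rfloor>) * w1 + of_int (- \<lfloor>b\<rfloor>) * w2)"
      using periodic_of_int[of f w1, OF p1] periodic_of_int[of f w2, OF p2] by metis
    also have "z + of_int (- \<lfloor>a\<rfloor>) * w1 + of_int (- \<lfloor>b\<rfloor>) * w2 = of_real (frac a) * w1 + of_real (frac b) * w2"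
      by (simp add: z frac_def algebra_simps)
    finally have "y = f (of_real (frac a) * w1 + of_real (frac b) * w2)" using y by simp
    moreover have "of_real (frac a) * w1 + of_real (frac b) * w2 \<in> K" unfolding K_def
      by (rule image_eqI[of _ _ "(frac a, frac b)"]) (auto simp: frac_lt_1 less_imp_le)
    ultimately show "y \<in> f ` K" by blast
  qed
  ultimately show "bounded (range f)" using bounded_subset by blast
qed

text \<open>Only the behaviour at 0 has to be known: periodicity carries the finite limit there to
  all lattice points, and the denominator has no other zeros. All singularities are thus removable,
  and the repaired quotient is entire with two periods.\<close>

lemma elliptic_quotient_constant:
  fixes N D :: "complex \<Rightarrow> complex"
  assumes holN: "N holomorphic_on UNIV" and holD: "D holomorphic_on UNIV"
    and im: "Im (w1 / w2) > 0"
    and p1: "\<And>z. N (z + w1) / D (z + w1) = N z / D z"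
    and p2: "\<And>z. N (z + w2) / D (z + w2) = N z / D z"
    and zeros: "\<And>z. D z = 0 \<Longrightarrow> \<exists>a b::int. z = of_int a * w1 + of_int b * w2"
    and lim: "((\<lambda>z. N z / D z) \<longlongrightarrow> l) (at 0)" and nontriv: "D z0 \<noteq> 0"
  shows "\<exists>c. \<forall>z. N z = c * D z"
proof -
  define f where "f = (\<lambda>z. N z / D z)"
  have anaN: "N analytic_on A" and anaD: "D analytic_on A" for A
    using holN holD by (meson analytic_on_holomorphic open_UNIV subset_UNIV)+
  have mero: "f meromorphic_on UNIV" unfolding f_def
    by (intro meromorphic_on_divide analytic_on_imp_meromorphic_on anaN anaD)
  then have iso: "isolated_singularity_at f z" for z
    using meromorphic_at_iff meromorphic_on_subset by blast
  have per1: "f (z + w1) = f z" and per2: "f (z + w2) = f z" for z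
    using p1 p2 by (auto simp: f_def)
  have limex: "\<exists>c. (f \<longlongrightarrow> c) (at z)" for z
  proof (cases "D z = 0")
    case False
    then have "f analytic_on {z}" unfolding f_def by (intro analytic_intros anaN anaD) auto
    then show ?thesis using analytic_at_imp_isCont isCont_def by blast
  next
    case True
    then obtain a b :: int where z: "z = of_int a * w1 + of_int b * w2" using zeros by blast
    have "f (z + w) = f w" for w
      using periodic_of_int[of f w1, OF per1, of w a] periodic_of_int[of f w2, OF per2, of "w + of_int a * w1" b]
      by (simp add: z algebra_simps)
    moreover have "((\<lambda>w. f w) \<longlongrightarrow> l) (at 0)" using lim by (simp add: f_def)
    ultimately have "((\<lambda>w. f (z + w)) \<longlongrightarrow> l) (at 0)" by simp
    then have "(f \<longlongrightarrow> l) (at z)" by (subst LIM_offset_zero_iff) auto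
    then show ?thesis by blast
  qed
  have "remove_sings f analytic_on {z}" for z
    using remove_sings_analytic_at[OF iso] limex by blast
  then have hol: "remove_sings f holomorphic_on UNIV"
    by (meson analytic_imp_holomorphic analytic_on_analytic_at)
  have "remove_sings f (z + w) = remove_sings f z" if "\<And>z. f (z + w) = f z" for w z
  proof -
    have "f (z + w + v) = f (z + v)" for v
      using that[of "z + v"] by (simp add: algebra_simps)
    then show ?thesis
      using remove_sings_shift_0[of f "z + w"] remove_sings_shift_0[of f z] by simp
  qed
  with entire_doubly_periodic_constant[OF hol im] per1 per2
  have "remove_sings f constant_on UNIV" by blast
  then obtain c where c: "\<And>z. remove_sings f z = c" by (auto simp: constant_on_def)
  \<comment> \<open>At a zero of \<open>D\<close> the value of the quotient says nothing about
    \<open>N\<close>, so the identity is obtained as a limit; \<open>nontriv\<close> makes the zeros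
    of \<open>D\<close> isolated.\<close>
  have "N z = c * D z" for z
  proof -
    have limc: "(f \<longlongrightarrow> c) (at z)" using limex[of z] c[of z] remove_sings_eqI by metis
    have "isCont D z" "isCont N z" using anaN anaD analytic_at_imp_isCont by blast+
    then have lims: "(D \<longlongrightarrow> D z) (at z)" "(N \<longlongrightarrow> N z) (at z)" by (auto simp: isCont_def)
    have "eventually (\<lambda>w. D w \<noteq> 0) (at z)"
      using non_zero_neighbour_alt[OF holD open_UNIV connected_UNIV UNIV_I UNIV_I nontriv]
      by (auto elim: eventually_mono)
    then have "eventually (\<lambda>w. f w * D w = N w) (at z)"
      by eventually_elim (auto simp: f_def)
    with tendsto_mult[OF limc lims(1)] have "(N \<longlongrightarrow> c * D z) (at z)"
      by (simp add: tendsto_cong)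
    with lims(2) show ?thesis using LIM_unique by blast
  qed
  then show ?thesis by blast
qed

section \<open>The multiplicative theta function and its transformation\<close>

definition jtheta :: "complex \<Rightarrow> complex \<Rightarrow> complex" where
  "jtheta x q = qpoch_inf x q * qpoch_inf (q / x) q"

lemma jtheta_alt:
  assumes "norm q < 1"
  shows "jtheta x q = (1 - x) * (qpoch_inf (x * q) q * qpoch_inf (q / x) q)"
  unfolding jtheta_def using qpoch_Suc[OF assms, of x] by simp

lemma jtheta_shift:
  assumes "norm q < 1" "q \<noteq> 0" "x \<noteq> 0"
  shows "jtheta (x * q) q = - jtheta x q / x"
proof -
  have "jtheta (x * q) q = qpoch_inf (x * q) q * ((1 - 1 / x) * qpoch_inf (q / x) q)"
    unfolding jtheta_def using qpoch_Suc[OF assms(1), of "1 / x"] assms by simp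
  also have "\<dots> = - ((1 - x) * (qpoch_inf (x * q) q * qpoch_inf (q / x) q)) / x"
    using assms by (simp add: field_simps)
  finally show ?thesis using assms by (simp add: jtheta_alt)
qed

lemma B22_shift:
  assumes "w1 \<noteq> 0" "w2 \<noteq> 0"
  shows "B22 w1 w2 (z + w1) = B22 w1 w2 z + (2 * z / w2 - 1)"
    and "B22 w1 w2 (z + w2) = B22 w1 w2 z + (2 * z / w1 - 1)"
  using assms by (simp_all add: B22_def divide_simps) (simp_all add: algebra_simps power2_eq_square)

text \<open>The increments of \<open>B22\<close> under the periods are linear in \<open>z\<close>.
  Under \<open>w1\<close> its exponential cancels the multiplier of the theta function in the nome
  \<open>q\<close>, so both sides are invariant; under \<open>w2\<close> it supplies the multiplier
  of the theta function in \<open>q'\<close>, so both sides acquire the same factor. The zeros on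
  the right lie in the lattice, and the simple one at 0 is matched by a zero on the left.\<close>

lemma theta_transform:
  assumes im: "Im (w1 / w2) > 0"
  defines "q \<equiv> exp (2 * of_real pi * \<i> * w1 / w2)" and "q' \<equiv> exp (- 2 * of_real pi * \<i> * w2 / w1)"
  shows "\<exists>c. \<forall>z. jtheta (exp (- (2 * of_real pi * \<i> * z / w1))) q' =
     c * (exp (of_real pi * \<i> * B22 w1 w2 z) * jtheta (exp (2 * of_real pi * \<i> * z / w2)) q)"
proof -
  have w: "w1 \<noteq> 0" "w2 \<noteq> 0" using im by auto
  have "Im (w2 / w1) < 0" using im w by (simp add: Im_complex_div_gt_0 Im_complex_div_lt_0 field_simps)
  then have q: "norm q < 1" "norm q' < 1" "q \<noteq> 0" "q' \<noteq> 0"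
  proof -
    define t t' where "t = w1 / w2" and "t' = w2 / w1"
    have "q = exp (2 * of_real pi * \<i> * t)" "q' = exp (- 2 * of_real pi * \<i> * t')"
      by (simp_all add: q_def q'_def t_def t'_def)
    moreover have "Im t > 0" "Im t' < 0" using im \<open>Im (w2 / w1) < 0\<close> by (simp_all add: t_def t'_def)
    ultimately show "norm q < 1" "norm q' < 1"
      by (simp_all add: mult_pos_neg)
  qed (simp_all add: q_def q'_def)
  define N where "N = (\<lambda>z. jtheta (exp (- (2 * of_real pi * \<i> * z / w1))) q')"
  define D where "D = (\<lambda>z. exp (of_real pi * \<i> * B22 w1 w2 z) * jtheta (exp (2 * of_real pi * \<i> * z / w2)) q)"
  have hol: "(\<lambda>z. qpoch_inf (f z) p) holomorphic_on UNIV" if "f holomorphic_on UNIV" "norm p < 1" for f p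
    using that by (intro qpoch_holomorphic) auto
  have holN: "N holomorphic_on UNIV" unfolding N_def jtheta_def
    by (intro holomorphic_intros hol q) (use w in auto)
  have holD: "D holomorphic_on UNIV" unfolding D_def jtheta_def B22_def
    by (intro holomorphic_intros hol q) (use w in auto)
  have N1: "N (z + w1) = N z" for z
    using w by (simp add: N_def add_divide_distrib distrib_left exp_add exp_diff)
  have exp_add_one: "exp (of_real pi * \<i> * (2 * t - 1)) = - exp (2 * of_real pi * \<i> * t)" for t
    by (simp add: right_diff_distrib exp_diff mult_ac)
  have D1: "D (z + w1) = D z" for z
  proof -
    define x where "x = exp (2 * of_real pi * \<i> * z / w2)"
    have "exp (2 * of_real pi * \<i> * (z + w1) / w2) = x * q"
      by (simp add: x_def q_def add_divide_distrib distrib_left exp_add)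
    moreover have "exp (of_real pi * \<i> * B22 w1 w2 (z + w1)) = exp (of_real pi * \<i> * B22 w1 w2 z) * (- x)"
      using exp_add_one[of "z / w2"] by (simp add: B22_shift w distrib_left exp_add x_def)
    ultimately show ?thesis using q
      by (simp add: D_def x_def jtheta_shift)
  qed
  define fac where "fac = (\<lambda>z. - exp (2 * of_real pi * \<i> * z / w1))"
  have fac: "fac z \<noteq> 0" for z by (simp add: fac_def)
  have N2: "N (z + w2) = fac z * N z" for z
  proof -
    define x where "x = exp (- (2 * of_real pi * \<i> * z / w1))"
    have "exp (- (2 * of_real pi * \<i> * (z + w2) / w1)) = x * q'"
      by (simp add: x_def q'_def add_divide_distrib distrib_left exp_add exp_diff exp_minus field_simps)
    moreover have "fac z = - 1 / x" by (simp add: fac_def x_def exp_minus field_simps)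
    ultimately show ?thesis using q
      by (simp add: N_def x_def jtheta_shift)
  qed
  have D2: "D (z + w2) = fac z * D z" for z
  proof -
    have "exp (2 * of_real pi * \<i> * (z + w2) / w2) = exp (2 * of_real pi * \<i> * z / w2)"
      using w by (simp add: add_divide_distrib distrib_left exp_add)
    moreover have "exp (of_real pi * \<i> * B22 w1 w2 (z + w2)) = exp (of_real pi * \<i> * B22 w1 w2 z) * fac z"
      using exp_add_one[of "z / w1"] by (simp add: B22_shift w distrib_left exp_add fac_def)
    ultimately show ?thesis by (simp add: D_def)
  qed
  have qz: "\<exists>j. x * q ^ j = 1" if "qpoch_inf x q = 0" for x
    using qpoch_nonzero[OF q(1)] that by blast
  have lat: "\<exists>a b::int. z = of_int a * w1 + of_int b * w2"
    if one: "exp (2 * of_real pi * \<i> * (z + of_int n * w1) / w2) = 1" for z n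
  proof -
    obtain k :: int where "2 * of_real pi * \<i> * (z + of_int n * w1) / w2 = 0 + of_int (2 * k) * of_real pi * \<i>"
      using one exp_eq[of "2 * of_real pi * \<i> * (z + of_int n * w1) / w2" 0] by auto
    then have "(2 * of_real pi * \<i>) * ((z + of_int n * w1) / w2) = (2 * of_real pi * \<i>) * of_int k"
      by (simp add: mult_ac)
    then have "(z + of_int n * w1) / w2 = of_int k"
      by (subst (asm) mult_cancel_left) simp
    then have "z + of_int n * w1 = of_int k * w2"
      using w by (simp add: field_simps)
    then have "z = of_int (- n) * w1 + of_int k * w2" by (simp add: algebra_simps)
    then show ?thesis by blast
  qed
  have zeros: "\<exists>a b::int. z = of_int a * w1 + of_int b * w2" if "D z = 0" for z
  proof -
    have qpow: "q ^ j = exp (2 * of_real pi * \<i> * (of_int (int j) * w1) / w2)" for j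
      by (simp add: q_def flip: exp_of_nat_mult) (simp add: field_simps)
    from that have "qpoch_inf (exp (2 * of_real pi * \<i> * z / w2)) q = 0 \<or>
        qpoch_inf (q / exp (2 * of_real pi * \<i> * z / w2)) q = 0"
      by (simp add: D_def jtheta_def)
    then show ?thesis
    proof
      assume "qpoch_inf (exp (2 * of_real pi * \<i> * z / w2)) q = 0"
      then obtain j where "exp (2 * of_real pi * \<i> * z / w2) * q ^ j = 1" using qz by blast
      then have "exp (2 * of_real pi * \<i> * (z + of_int (int j) * w1) / w2) = 1"
        by (simp add: qpow add_divide_distrib distrib_left exp_add)
      then show ?thesis by (rule lat)
    next
      assume "qpoch_inf (q / exp (2 * of_real pi * \<i> * z / w2)) q = 0"
      then obtain j where "q / exp (2 * of_real pi * \<i> * z / w2) * q ^ j = 1" using qz by blast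
      then have "exp (2 * of_real pi * \<i> * z / w2) = q ^ Suc j" by (simp add: field_simps)
      then have "exp (2 * of_real pi * \<i> * (z + of_int (- int (Suc j)) * w1) / w2) = 1"
        by (simp only: qpow) (simp add: diff_divide_distrib algebra_simps exp_diff)
      then show ?thesis by (rule lat)
    qed
  qed
  \<comment> \<open>The cofactor of the simple zero of \<open>D\<close> at 0. Its value there
    contains the square of \<open>qpoch_inf q q\<close>, which is not zero, so l'Hospital's rule
    gives a finite limit of \<open>N z / D z\<close>.\<close>
  define E where "E = (\<lambda>z. exp (of_real pi * \<i> * B22 w1 w2 z) *
    (qpoch_inf (exp (2 * of_real pi * \<i> * z / w2) * q) q * qpoch_inf (q / exp (2 * of_real pi * \<i> * z / w2)) q))"
  have DE: "D z = E z * (1 - exp (2 * of_real pi * \<i> * z / w2))" for z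
    by (simp add: D_def E_def jtheta_alt q)
  have holE: "E holomorphic_on UNIV" unfolding E_def B22_def
    by (intro holomorphic_intros hol q) (use w in auto)
  have E0: "E 0 \<noteq> 0"
  proof -
    have "qpoch_inf q q \<noteq> 0"
    proof (rule qpoch_nonzero[OF q(1)])
      fix j
      have "norm (q * q ^ j) < 1"
        using q(1) power_less_one_iff[of "norm q" "Suc j"] by (simp add: norm_mult norm_power)
      then show "q * q ^ j \<noteq> 1" by auto
    qed
    then show ?thesis by (simp add: E_def)
  qed
  have D0: "D 0 = 0" "N 0 = 0" by (simp_all add: DE N_def jtheta_alt q)
  have dE: "(E has_field_derivative deriv E 0) (at 0)" and dN: "(N has_field_derivative deriv N 0) (at 0)"
    using holE holN by (auto intro: holomorphic_derivI[of _ UNIV])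
  have dD: "(D has_field_derivative - (2 * of_real pi * \<i> / w2) * E 0) (at 0)"
    unfolding DE using w by (auto intro!: derivative_eq_intros dE)
  have "((\<lambda>z. N z / D z) \<longlongrightarrow> deriv N 0 / (- (2 * of_real pi * \<i> / w2) * E 0)) (at 0)"
    by (rule lhopital_complex_simple[OF dN dD D0(2) D0(1)]) (use w E0 in auto)
  moreover have "\<exists>z. D z \<noteq> 0"
  proof (rule ccontr)
    assume "\<nexists>z. D z \<noteq> 0"
    then have "D = (\<lambda>_. 0)" by auto
    with dD have "((\<lambda>_. 0) has_field_derivative - (2 * of_real pi * \<i> / w2) * E 0) (at 0)" by simp
    from DERIV_unique[OF this DERIV_const] show False using E0 w by simp
  qed
  ultimately have "\<exists>c. \<forall>z. N z = c * D z"
    using elliptic_quotient_constant[OF holN holD im] N1 D1 N2 D2 fac zeros by auto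
  then show ?thesis by (simp add: N_def D_def)
qed

text \<open>At a half period the argument of each theta function is -1 or a square root of the nome
  up to sign, so its value is the square of one symbol, with a factor 2 at -1. In the product of the
  three evaluations the factors 2 agree, the values of \<open>B22\<close> add up to 0, and Euler's
  identity removes all symbols, which leaves \<open>c ^ 3\<close>.\<close>

lemma theta_constant_cube:
  assumes im: "Im (w1 / w2) > 0"
  defines "q \<equiv> exp (2 * of_real pi * \<i> * w1 / w2)" and "q' \<equiv> exp (- 2 * of_real pi * \<i> * w2 / w1)"
  assumes c: "\<And>z. jtheta (exp (- (2 * of_real pi * \<i> * z / w1))) q' =
     c * (exp (of_real pi * \<i> * B22 w1 w2 z) * jtheta (exp (2 * of_real pi * \<i> * z / w2)) q)"
  shows "c ^ 3 = 1"
proof -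
  have w: "w1 \<noteq> 0" "w2 \<noteq> 0" using im by auto
  have im': "Im (w2 / w1) < 0" using im w by (simp add: Im_complex_div_gt_0 Im_complex_div_lt_0 field_simps)
  define h h' where "h = exp (of_real pi * \<i> * (w1 / w2))" and "h' = exp (- (of_real pi * \<i> * (w2 / w1)))"
  have h: "norm h < 1" "norm h' < 1" "h \<noteq> 0" "h' \<noteq> 0"
  proof -
    define t t' where "t = w1 / w2" and "t' = w2 / w1"
    have "h = exp (of_real pi * \<i> * t)" "h' = exp (- (of_real pi * \<i> * t'))"
      by (simp_all add: h_def h'_def t_def t'_def)
    moreover have "Im t > 0" "Im t' < 0" using im im' by (simp_all add: t_def t'_def)
    ultimately show "norm h < 1" "norm h' < 1" by (simp_all add: mult_pos_neg)
  qed (simp_all add: h_def h'_def)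
  have qh: "q = h\<^sup>2" "q' = h'\<^sup>2"
    by (simp_all add: q_def q'_def h_def h'_def power2_eq_square mult_ac flip: exp_add)
  have q: "norm q < 1" "norm q' < 1"
    using h by (simp_all add: qh norm_power power_less_one_iff)
  have half: "jtheta x p = (qpoch_inf x p)\<^sup>2" if "p = x\<^sup>2" "x \<noteq> 0" for x p
    using that by (simp add: jtheta_def power2_eq_square)
  have m1: "jtheta (- 1) p = 2 * (qpoch_inf (- p) p)\<^sup>2" if "norm p < 1" for p
    using that by (simp add: jtheta_alt power2_eq_square)
  define B1 B2 B3 where "B1 = B22 w1 w2 (w1 / 2)" and "B2 = B22 w1 w2 (w2 / 2)" and "B3 = B22 w1 w2 ((w1 + w2) / 2)"
  have "B1 + B2 + B3 = 0"
    using w by (simp add: B1_def B2_def B3_def B22_def field_simps power2_eq_square)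
  then have "exp (of_real pi * \<i> * (B1 + B2 + B3)) = 1" by simp
  then have EB: "exp (of_real pi * \<i> * B1) * exp (of_real pi * \<i> * B2) * exp (of_real pi * \<i> * B3) = 1"
    by (simp only: distrib_left exp_add mult.assoc)
  have e1: "2 * (qpoch_inf (- q') q')\<^sup>2 = c * (exp (of_real pi * \<i> * B1) * (qpoch_inf h q)\<^sup>2)"
  proof -
    have "exp (- (2 * of_real pi * \<i> * (w1 / 2) / w1)) = - 1" using w by (simp add: exp_minus)
    moreover have "exp (2 * of_real pi * \<i> * (w1 / 2) / w2) = h" by (simp add: h_def mult.assoc)
    ultimately show ?thesis using c[of "w1 / 2"] h q by (simp add: half[OF qh(1)] m1 B1_def)
  qed
  have e2: "(qpoch_inf h' q')\<^sup>2 = c * (exp (of_real pi * \<i> * B2) * (2 * (qpoch_inf (- q) q)\<^sup>2))"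
  proof -
    have "exp (2 * of_real pi * \<i> * (w2 / 2) / w2) = - 1" using w by simp
    moreover have "exp (- (2 * of_real pi * \<i> * (w2 / 2) / w1)) = h'" by (simp add: h'_def mult.assoc)
    ultimately show ?thesis using c[of "w2 / 2"] h q by (simp add: half[OF qh(2)] m1 B2_def)
  qed
  have e3: "(qpoch_inf (- h') q')\<^sup>2 = c * (exp (of_real pi * \<i> * B3) * (qpoch_inf (- h) q)\<^sup>2)"
  proof -
    have "exp (2 * of_real pi * \<i> * ((w1 + w2) / 2) / w2) = - h"
      using w by (simp add: h_def add_divide_distrib distrib_left exp_add mult.assoc)
    moreover have "exp (- (2 * of_real pi * \<i> * ((w1 + w2) / 2) / w1)) = - h'"
      using w by (simp add: h'_def add_divide_distrib distrib_left exp_diff exp_minus mult.assoc inverse_eq_divide)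
    ultimately show ?thesis using c[of "(w1 + w2) / 2"] h q
half[of q "- h"] half[of q' "- h'"]
      by (simp add: qh B3_def)
  qed
  have eu: "qpoch_inf (- q) q * qpoch_inf (- h) q * qpoch_inf h q = 1"
    "qpoch_inf (- q') q' * qpoch_inf (- h') q' * qpoch_inf h' q' = 1"
    using qpoch_euler[of h] qpoch_euler[of h'] h by (simp_all add: qh)
  have "2 * (qpoch_inf (- q') q')\<^sup>2 * (qpoch_inf h' q')\<^sup>2 * (qpoch_inf (- h') q')\<^sup>2 =
    c ^ 3 * (exp (of_real pi * \<i> * B1) * exp (of_real pi * \<i> * B2) * exp (of_real pi * \<i> * B3)) *
    (2 * (qpoch_inf (- q) q * qpoch_inf (- h) q * qpoch_inf h q)\<^sup>2)"
    unfolding e1 e2 e3 by (simp add: power_mult_distrib power2_eq_square power3_eq_cube mult_ac)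
  moreover have "2 * (qpoch_inf (- q') q')\<^sup>2 * (qpoch_inf h' q')\<^sup>2 * (qpoch_inf (- h') q')\<^sup>2 =
      2 * (qpoch_inf (- q') q' * qpoch_inf (- h') q' * qpoch_inf h' q')\<^sup>2"
    by (simp add: power_mult_distrib mult_ac)
  ultimately show ?thesis unfolding EB eu by simp
qed

section \<open>The periods of the theorem and the value of the constant\<close>

lemma omega_nonzero:
  shows "omega1 \<delta> \<noteq> 0" "omega2 \<delta> \<noteq> 0"
  by (auto simp: omega1_def omega2_def complex_eq_iff)

lemma omega_mult: "omega1 \<delta> * omega2 \<delta> = of_real (1 + \<delta>\<^sup>2)"
  by (simp add: omega1_def omega2_def complex_eq_iff power2_eq_square)

lemma omega_add: "omega1 \<delta> + omega2 \<delta> = of_real (2 * \<delta>)"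
  by (simp add: omega1_def omega2_def complex_eq_iff)

lemma omega_Im_quotient:
  assumes "\<delta> > 0"
  shows "Im (omega1 \<delta> / omega2 \<delta>) > 0"
  using assms by (simp add: omega1_def omega2_def Im_divide field_simps power2_eq_square add_pos_pos)

text \<open>The constant is a cube root of unity depending continuously on \<open>\<delta>\<close>, and equals 1 at \<open>\<delta> = 1\<close>,
  where the nome is real.\<close>

lemma theta_transform_omega:
  assumes "\<delta> > 0"
  defines "w1 \<equiv> omega1 \<delta>" and "w2 \<equiv> omega2 \<delta>"
  defines "q \<equiv> exp (2 * of_real pi * \<i> * w1 / w2)" and "q' \<equiv> exp (- 2 * of_real pi * \<i> * w2 / w1)"
  shows "jtheta (exp (- (2 * of_real pi * \<i> * z / w1))) q' =
     exp (of_real pi * \<i> * B22 w1 w2 z) * jtheta (exp (2 * of_real pi * \<i> * z / w2)) q"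
proof -
  \<comment> \<open>Since the periods add up to \<open>2 * d\<close>,
    \<open>omega1 d / omega2 d\<close> equals \<open>2 * d / omega2 d - 1\<close>, and
    \<open>p d\<close> is a square root of the nome. At the half period \<open>z = d\<close> both
    theta functions are therefore squares, and \<open>c d\<close> is the constant solved from that
    single evaluation.\<close>
  define p where "p = (\<lambda>d. exp (2 * of_real pi * \<i> * of_real d / omega2 d))"
  define A where "A = (\<lambda>d. qpoch_inf (p d) ((p d)\<^sup>2))"
  define b where "b = (\<lambda>d::real. (1 - d\<^sup>2) / (6 * (1 + d\<^sup>2)))"
  define c where "c = (\<lambda>d. (cnj (A d))\<^sup>2 / (exp (of_real pi * \<i> * of_real (b d)) * (A d)\<^sup>2))"
  define Q where "Q = (\<lambda>d. exp (2 * of_real pi * \<i> * omega1 d / omega2 d))"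
  define Q' where "Q' = (\<lambda>d. exp (- 2 * of_real pi * \<i> * omega2 d / omega1 d))"
  have p1: "norm (p d) < 1" if "d > 0" for d
  proof -
    have "2 * of_real pi * \<i> * of_real d / omega2 d = of_real (2 * pi * d / (1 + d\<^sup>2)) * (\<i> * omega1 d)"
      by (simp only: of_real_divide omega_mult[symmetric]) (simp add: omega_nonzero field_simps)
    then have "Re (2 * of_real pi * \<i> * of_real d / omega2 d) = 2 * pi * d / (1 + d\<^sup>2) * - 1"
      by (simp add: omega1_def)
    also have "\<dots> < 0" using that by (simp add: add_pos_nonneg)
    finally show ?thesis by (simp add: p_def)
  qed
  have Qp: "Q d = (p d)\<^sup>2" "Q' d = (cnj (p d))\<^sup>2" for d
  proof -
    have "omega1 d / omega2 d = 2 * of_real d / omega2 d - 1" 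
      using omega_nonzero[of d] by (simp add: field_simps omega1_def omega2_def)
    then have "2 * of_real pi * \<i> * omega1 d / omega2 d =
        2 * (2 * of_real pi * \<i> * of_real d / omega2 d) - of_real (2 * pi) * \<i>"
      by (simp only: times_divide_eq_right[symmetric]) (simp add: algebra_simps)
    then show Q: "Q d = (p d)\<^sup>2"
      by (simp add: Q_def p_def exp_diff flip: exp_double)
    have "Q' d = cnj (Q d)" by (simp add: Q_def Q'_def exp_cnj omega2_def)
    then show "Q' d = (cnj (p d))\<^sup>2" using Q by simp
  qed
  have A0: "A d \<noteq> 0" if "d > 0" for d
    unfolding A_def
  proof (rule qpoch_nonzero)
    show "norm ((p d)\<^sup>2) < 1" using p1[OF that] by (simp add: norm_power power_less_one_iff)
    fix j
    have "norm (p d * (p d)\<^sup>2 ^ j) < 1"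
      using p1[OF that] power_less_one_iff[of "norm (p d)" "Suc (2 * j)"]
      by (simp add: norm_mult norm_power power_mult)
    then show "p d * (p d)\<^sup>2 ^ j \<noteq> 1" by auto
  qed
  have transf: "jtheta (exp (- (2 * of_real pi * \<i> * z / omega1 d))) (Q' d) =
     c d * (exp (of_real pi * \<i> * B22 (omega1 d) (omega2 d) z) * jtheta (exp (2 * of_real pi * \<i> * z / omega2 d)) (Q d))
     \<and> (c d) ^ 3 = 1" if d: "d > 0" for d z
  proof -
    obtain k where k: "\<And>z. jtheta (exp (- (2 * of_real pi * \<i> * z / omega1 d))) (Q' d) =
     k * (exp (of_real pi * \<i> * B22 (omega1 d) (omega2 d) z) * jtheta (exp (2 * of_real pi * \<i> * z / omega2 d)) (Q d))"
      using theta_transform[OF omega_Im_quotient[OF d]] unfolding Q_def Q'_def by blast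
    have "k ^ 3 = 1"
      using theta_constant_cube[OF omega_Im_quotient[OF d]] k unfolding Q_def Q'_def by blast
    moreover have "k = c d"
    proof -
      have x: "exp (2 * of_real pi * \<i> * of_real d / omega2 d) = p d"
        "exp (- (2 * of_real pi * \<i> * of_real d / omega1 d)) = cnj (p d)"
        by (simp_all add: p_def exp_cnj omega2_def)
      have "B22 (omega1 d) (omega2 d) (of_real d) = of_real (b d)"
      proof -
        have sq: "(omega1 d)\<^sup>2 + (omega2 d)\<^sup>2 = of_real (2 * d\<^sup>2 - 2)"
          by (simp add: omega1_def omega2_def complex_eq_iff power2_eq_square)
        have "1 + d\<^sup>2 > 0" by (simp add: add_pos_nonneg)
        then have "1 / (1 + d\<^sup>2) * (- ((2 * d\<^sup>2 - 2) / 12)) = b d"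
          by (simp add: b_def divide_simps) (simp add: algebra_simps)
        then have "b d = 1 / (1 + d\<^sup>2) * (- ((2 * d\<^sup>2 - 2) / 12))" by simp
        then show ?thesis
          unfolding B22_def omega_mult omega_add sq by simp
      qed
      moreover have "jtheta (p d) (Q d) = (A d)\<^sup>2"
        by (simp add: jtheta_def A_def Qp power2_eq_square p_def)
      moreover have "jtheta (cnj (p d)) (Q' d) = (cnj (A d))\<^sup>2"
      proof -
        have "qpoch_inf (cnj (p d)) (cnj ((p d)\<^sup>2)) = cnj (A d)"
          unfolding A_def using p1[OF d] by (intro qpoch_cnj) (simp add: norm_power power_less_one_iff)
        then show ?thesis by (simp add: jtheta_def Qp power2_eq_square p_def)
      qed
      ultimately have "(cnj (A d))\<^sup>2 = k * (exp (of_real pi * \<i> * of_real (b d)) * (A d)\<^sup>2)"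
        using k[of "of_real d"] unfolding x by simp
      then show ?thesis using A0[OF d] by (simp add: c_def field_simps)
    qed
    ultimately show ?thesis using k by simp
  qed
  have cont: "continuous_on {0<..} c"
  proof -
    have hol: "(\<lambda>x. qpoch_inf x (x\<^sup>2)) holomorphic_on ball 0 1"
      by (rule qpoch_holomorphic) (auto intro!: holomorphic_intros simp: norm_power power_less_one_iff)
    have "continuous_on {0<..} p"
      unfolding p_def omega2_def omega1_def
      by (intro continuous_intros) (auto simp: complex_eq_iff)
    then have "continuous_on {0<..} A"
      unfolding A_def
      by (rule continuous_on_compose2[OF holomorphic_on_imp_continuous_on[OF hol]]) (auto simp: p1)
    moreover have "6 * (1 + d\<^sup>2) \<noteq> 0" for d :: real
      using add_pos_nonneg[OF zero_less_one zero_le_power2[of d]] by simp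
    ultimately show ?thesis
      unfolding c_def b_def by (intro continuous_intros) (simp_all add: A0 del: mult_eq_0_iff distrib_left_numeral)
  qed
  have "finite (c ` {0<..})"
    by (rule finite_subset[OF _ finite_roots_unity[of 3]]) (use transf in auto)
  then have "c constant_on {0<..}"
    by (intro continuous_finite_range_constant cont) auto
  then have "c \<delta> = c 1" using assms by (auto simp: constant_on_def)
  also have "c 1 = 1"
  proof -
    \<comment> \<open>From \<open>1 / omega2 1 = (\<i> + 1) / 2\<close> one gets the real value
      \<open>p 1 = - exp (- pi)\<close>. Then \<open>A 1\<close> is real and nonzero, and
      \<open>b 1 = 0\<close>.\<close>
    have "cnj (p 1) = p 1"
    proof -
      have "1 / omega2 1 = (\<i> + 1) / 2" by (simp add: omega2_def omega1_def complex_eq_iff Re_divide Im_divide)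
      moreover have "2 * of_real pi * \<i> * of_real 1 / omega2 1 = 2 * of_real pi * \<i> * (1 / omega2 1)"
        by simp
      ultimately have "2 * of_real pi * \<i> * of_real 1 / omega2 1 = of_real pi * \<i> - of_real pi"
        by (simp add: algebra_simps)
      then have "p 1 = - exp (- of_real pi)" by (simp only: p_def exp_diff) (simp add: exp_minus field_simps)
      then show ?thesis by (simp add: exp_cnj)
    qed
    then have "cnj (A 1) = A 1"
      using qpoch_cnj[of "(p 1)\<^sup>2" "p 1"] p1[of 1] by (simp add: A_def norm_power power_less_one_iff)
    then show ?thesis using A0[of 1] by (simp add: c_def b_def)
  qed
  finally show ?thesis using transf[OF \<open>\<delta> > 0\<close>, of z] unfolding Q_def Q'_def w1_def w2_def q_def q'_def by simp
qed

section \<open>Quotients of q-Pochhammer symbols as the nome tends to 1\<close>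

lemma exp_minus_one_bound:
  fixes z :: complex
  shows "norm (1 - exp (- z) - z) \<le> exp (norm z) * (norm z)\<^sup>2"
proof -
  have "norm (exp (- z) - (\<Sum>i\<le>1. (- z) ^ i / fact i)) \<le> exp \<bar>Re (- z)\<bar> * norm (- z) ^ Suc 1 / fact 1"
    by (rule Taylor_exp)
  moreover have "exp (- z) - (\<Sum>i\<le>1. (- z) ^ i / fact i) = - (1 - exp (- z) - z)" by simp
  moreover have "exp \<bar>Re (- z)\<bar> * (norm z)\<^sup>2 \<le> exp (norm z) * (norm z)\<^sup>2"
    using abs_Re_le_cmod[of z] by (intro mult_right_mono) auto
  ultimately show ?thesis by (simp only: norm_minus_cancel) (simp add: power2_eq_square)
qed

lemma norm_Ln_one_plus_diff:
  fixes z :: complex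
  assumes "norm z \<le> 1 / 2"
  shows "norm (Ln (1 + z) - z) \<le> 2 * (norm z)\<^sup>2"
proof -
  have "norm (ln (1 + z) - z) \<le> (norm z)\<^sup>2 / (1 - norm z)" using assms by (intro Ln_approx_linear) auto
  also have "\<dots> \<le> (norm z)\<^sup>2 / (1 / 2)" using assms by (intro divide_left_mono) auto
  finally show ?thesis by simp
qed

text \<open>Both logarithms have imaginary part of modulus below \<pi> / 2, so their difference
  stays in the principal strip and no multiple of 2 \<pi> \<i> appears.\<close>

lemma Ln_quotient_right_half:
  assumes "Re a > 0" "Re b > 0"
  shows "Ln (a / b) = Ln a - Ln b"
proof -
  have nz: "a \<noteq> 0" "b \<noteq> 0" using assms by auto
  have "\<bar>Im (Ln a)\<bar> < pi / 2" "\<bar>Im (Ln b)\<bar> < pi / 2" using assms Re_Ln_pos_lt_imp by blast+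
  then have "Ln (exp (Ln a - Ln b)) = Ln a - Ln b" by (intro Ln_exp) auto
  then show ?thesis using nz by (simp add: exp_diff)
qed

text \<open>The four constants refer to an exponent \<sigma> of norm at most \<open>M\<close>:
  \<open>ratio_const1 M * norm h\<close> bounds \<open>shift_ratio - \<sigma>\<close>,
  \<open>ratio_const2 M\<close> bounds \<open>shift_ratio\<close>, \<open>ratio_const3 M\<close>
  collects the errors of one factor, and \<open>ratio_threshold M\<close> is the depth inside the
  unit disc, in units of \<open>Re h\<close>, from which the logarithms may be expanded.\<close>

definition ratio_const1 :: "real \<Rightarrow> real" where
  "ratio_const1 M = 2 * (exp M * M\<^sup>2 + 3 * M)"

definition ratio_const2 :: "real \<Rightarrow> real" where
  "ratio_const2 M = M + ratio_const1 M"

definition ratio_const3 :: "real \<Rightarrow> real" where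
  "ratio_const3 M = 16 * (ratio_const1 M + 2 * (ratio_const2 M)\<^sup>2 + 2 * M)"

definition ratio_threshold :: "real \<Rightarrow> real" where
  "ratio_threshold M = 8 * (1 + ratio_const2 M)"

context
  fixes h \<sigma> :: complex and M :: real
  assumes h0: "0 < Re h" "norm h \<le> 2 * Re h" "norm h \<le> 1 / 6" and \<sigma>: "norm \<sigma> \<le> M"
begin

text \<open>The q-number of \<sigma>, which tends to \<sigma> with \<open>h\<close>. The complex
  \<open>h\<close> is confined to a sector by \<open>norm h \<le> 2 * Re h\<close>, so that the
  powers of \<open>exp (- h)\<close> decay at a rate comparable to \<open>norm h\<close>.\<close>

definition "shift_ratio = (1 - exp (- (h * \<sigma>))) / (1 - exp (- h))"

private lemma M_nonneg: "0 \<le> M" using \<sigma> norm_ge_zero order_trans by blast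

private lemma ratio_const1_nonneg: "0 \<le> ratio_const1 M" using M_nonneg by (simp add: ratio_const1_def)

private lemma h_pos: "0 < norm h" using h0 by auto

private lemma one_minus_exp_bounds: "norm (1 - exp (- h) - h) \<le> 3 * (norm h)\<^sup>2"
  "norm h / 2 \<le> norm (1 - exp (- h))" "norm (1 - exp (- h)) \<le> 2 * norm h"
proof -
  have "exp (norm h) \<le> exp 1" using h0 by simp
  also have "exp 1 \<le> (3::real)" using exp_le by simp
  finally have e3: "exp (norm h) * (norm h)\<^sup>2 \<le> 3 * (norm h)\<^sup>2" by (intro mult_right_mono) auto
  with exp_minus_one_bound[of h] show 1: "norm (1 - exp (- h) - h) \<le> 3 * (norm h)\<^sup>2" by linarith
  have "(norm h)\<^sup>2 \<le> 1 / 6 * norm h" unfolding power2_eq_square using h0 by (intro mult_right_mono) auto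
  with 1 have 2: "norm (1 - exp (- h) - h) \<le> norm h / 2" by linarith
  have "norm h \<le> norm (1 - exp (- h)) + norm (1 - exp (- h) - h)"
    using norm_triangle_ineq4[of "1 - exp (- h)" "1 - exp (- h) - h"] by simp
  with 2 show "norm h / 2 \<le> norm (1 - exp (- h))" by linarith
  have "norm (1 - exp (- h)) \<le> norm h + norm (1 - exp (- h) - h)"
    using norm_triangle_ineq[of h "1 - exp (- h) - h"] by simp
  with 2 h_pos show "norm (1 - exp (- h)) \<le> 2 * norm h" by linarith
qed

private lemma one_minus_exp_nz: "1 - exp (- h) \<noteq> 0"
  using one_minus_exp_bounds(2) h_pos by auto

private lemma shift_ratio_diff: "norm (shift_ratio - \<sigma>) \<le> ratio_const1 M * norm h"
proof -
  have "norm (1 - exp (- (h * \<sigma>)) - h * \<sigma>) \<le> exp (norm (h * \<sigma>)) * (norm (h * \<sigma>))\<^sup>2"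
    by (rule exp_minus_one_bound)
  also have "\<dots> \<le> exp M * (norm h * M)\<^sup>2"
  proof (intro mult_mono power_mono)
    have "norm h * norm \<sigma> \<le> 1 * M" using h0 \<sigma> by (intro mult_mono) auto
    then show "exp (norm (h * \<sigma>)) \<le> exp M" by (simp add: norm_mult)
    show "norm (h * \<sigma>) \<le> norm h * M" using \<sigma> by (simp add: norm_mult mult_left_mono)
  qed auto
  finally have a: "norm (1 - exp (- (h * \<sigma>)) - h * \<sigma>) \<le> exp M * M\<^sup>2 * (norm h)\<^sup>2"
    by (simp add: power_mult_distrib mult_ac)
  have b: "norm (\<sigma> * (1 - exp (- h) - h)) \<le> 3 * M * (norm h)\<^sup>2"
    using mult_mono[OF \<sigma> one_minus_exp_bounds(1)] M_nonneg by (simp add: norm_mult mult_ac)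
  have "(shift_ratio - \<sigma>) * (1 - exp (- h)) = (1 - exp (- (h * \<sigma>)) - h * \<sigma>) - \<sigma> * (1 - exp (- h) - h)"
    using one_minus_exp_nz by (simp add: shift_ratio_def field_simps)
  then have "norm (shift_ratio - \<sigma>) * norm (1 - exp (- h)) \<le> exp M * M\<^sup>2 * (norm h)\<^sup>2 + 3 * M * (norm h)\<^sup>2"
    using a b norm_triangle_ineq4[of "1 - exp (- (h * \<sigma>)) - h * \<sigma>" "\<sigma> * (1 - exp (- h) - h)"]
    by (simp flip: norm_mult)
  moreover have "norm (shift_ratio - \<sigma>) * (norm h / 2) \<le> norm (shift_ratio - \<sigma>) * norm (1 - exp (- h))"
    by (intro mult_left_mono one_minus_exp_bounds) auto
  ultimately have "norm (shift_ratio - \<sigma>) * norm h \<le> (ratio_const1 M * norm h) * norm h"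
    by (simp add: ratio_const1_def power2_eq_square algebra_simps)
  then show ?thesis using h_pos by simp
qed

private lemma shift_ratio_bound: "norm shift_ratio \<le> ratio_const2 M"
proof -
  have "norm shift_ratio \<le> norm \<sigma> + norm (shift_ratio - \<sigma>)" using norm_triangle_ineq[of \<sigma> "shift_ratio - \<sigma>"] by simp
  also have "norm (shift_ratio - \<sigma>) \<le> ratio_const1 M * 1"
    using shift_ratio_diff h0 ratio_const1_nonneg mult_left_mono[of "norm h" 1 "ratio_const1 M"] by linarith
  finally show ?thesis using \<sigma> by (simp add: ratio_const2_def)
qed

text \<open>Multiplying \<open>w\<close> by \<open>exp (- h)\<close> changes \<open>1 - w\<close> by
  the factor \<open>1 + step_ratio w\<close>; multiplying it by
  \<open>exp (- (h * \<sigma>))\<close> changes it by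
  \<open>1 + shift_ratio * step_ratio w\<close>.\<close>

definition "step_ratio w = w * (1 - exp (- h)) / (1 - w)"
definition "step_error w = Ln (1 + shift_ratio * step_ratio w) - \<sigma> * Ln (1 + step_ratio w)"

private lemma factor_identity:
  assumes "w \<noteq> 1"
  shows "1 - w * exp (- (h * \<sigma>)) = (1 - w) * (1 + shift_ratio * step_ratio w)" "1 - w * exp (- h) = (1 - w) * (1 + step_ratio w)"
proof -
  have w: "1 - w \<noteq> 0" using assms by simp
  have "(1 - w) * (shift_ratio * step_ratio w) = w * (shift_ratio * (1 - exp (- h)))" using w by (simp add: step_ratio_def)
  also have "shift_ratio * (1 - exp (- h)) = 1 - exp (- (h * \<sigma>))" using one_minus_exp_nz by (simp add: shift_ratio_def)
  finally show "1 - w * exp (- (h * \<sigma>)) = (1 - w) * (1 + shift_ratio * step_ratio w)"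
    by (simp only: distrib_left[of "1 - w"]) (simp add: algebra_simps)
  have "(1 - w) * step_ratio w = w * (1 - exp (- h))" using w by (simp add: step_ratio_def)
  then show "1 - w * exp (- h) = (1 - w) * (1 + step_ratio w)"
    by (simp only: distrib_left[of "1 - w"]) (simp add: algebra_simps)
qed

text \<open>The linear terms of the two logarithms leave
  \<open>(shift_ratio - \<sigma>) * step_ratio w\<close>, which carries an extra factor
  \<open>norm h\<close>; everything else is quadratic in \<open>step_ratio w\<close>. The hypothesis
  keeps the arguments of both logarithms within 1/2 of 1.\<close>

private lemma step_error_bound:
  assumes "norm (step_ratio w) \<le> 1 / (2 + 2 * ratio_const2 M)"
  shows "norm (step_error w) \<le> ratio_const1 M * (norm h * norm (step_ratio w)) + (2 * (ratio_const2 M)\<^sup>2 + 2 * M) * (norm (step_ratio w))\<^sup>2"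
    and "exp (Ln (1 + shift_ratio * step_ratio w)) = 1 + shift_ratio * step_ratio w"
proof -
  have const2_nonneg: "0 \<le> ratio_const2 M" using shift_ratio_bound norm_ge_zero order_trans by blast
  have "norm (step_ratio w) * (2 + 2 * ratio_const2 M) \<le> 1" using assms const2_nonneg by (simp add: field_simps)
  then have s: "2 * norm (step_ratio w) + 2 * (ratio_const2 M * norm (step_ratio w)) \<le> 1" by (simp add: algebra_simps)
  have kr: "norm (shift_ratio * step_ratio w) \<le> ratio_const2 M * norm (step_ratio w)" using shift_ratio_bound by (simp add: norm_mult mult_right_mono)
  have prod_nonneg: "0 \<le> ratio_const2 M * norm (step_ratio w)" using const2_nonneg by simp
  have r2: "norm (step_ratio w) \<le> 1 / 2" and kr2: "norm (shift_ratio * step_ratio w) \<le> 1 / 2"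
    using s kr prod_nonneg norm_ge_zero[of "step_ratio w"] by linarith+
  have "1 + shift_ratio * step_ratio w \<noteq> 0"
  proof
    assume "1 + shift_ratio * step_ratio w = 0"
    then have "shift_ratio * step_ratio w = - 1" by (simp add: add_eq_0_iff)
    with kr2 show False by simp
  qed
  then show "exp (Ln (1 + shift_ratio * step_ratio w)) = 1 + shift_ratio * step_ratio w" by simp
  have "step_error w = (shift_ratio - \<sigma>) * step_ratio w + (Ln (1 + shift_ratio * step_ratio w) - shift_ratio * step_ratio w) - \<sigma> * (Ln (1 + step_ratio w) - step_ratio w)"
    by (simp add: step_error_def algebra_simps)
  then have "norm (step_error w) \<le> norm ((shift_ratio - \<sigma>) * step_ratio w) + norm (Ln (1 + shift_ratio * step_ratio w) - shift_ratio * step_ratio w)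
      + norm (\<sigma> * (Ln (1 + step_ratio w) - step_ratio w))"
    using norm_triangle_ineq norm_triangle_ineq4 by (smt (verit, best))
  moreover have "norm ((shift_ratio - \<sigma>) * step_ratio w) \<le> ratio_const1 M * norm h * norm (step_ratio w)"
    using shift_ratio_diff by (simp add: norm_mult mult_right_mono)
  moreover have "norm (Ln (1 + shift_ratio * step_ratio w) - shift_ratio * step_ratio w) \<le> 2 * (ratio_const2 M)\<^sup>2 * (norm (step_ratio w))\<^sup>2"
    using norm_Ln_one_plus_diff[OF kr2] power_mono[OF kr, of 2] by (simp add: power_mult_distrib)
  moreover have "norm (\<sigma> * (Ln (1 + step_ratio w) - step_ratio w)) \<le> 2 * M * (norm (step_ratio w))\<^sup>2"
    using mult_mono[OF \<sigma> norm_Ln_one_plus_diff[OF r2]] M_nonneg by (simp add: norm_mult mult_ac)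
  ultimately show "norm (step_error w) \<le> ratio_const1 M * (norm h * norm (step_ratio w)) + (2 * (ratio_const2 M)\<^sup>2 + 2 * M) * (norm (step_ratio w))\<^sup>2"
    by (simp add: algebra_simps)
qed

text \<open>With \<open>x = n * Re h\<close>, the quotient \<open>norm w / norm (1 - w)\<close> is
  at most \<open>1 / (exp x - 1)\<close>. The lower bounds \<open>x\<close> and
  \<open>x\<^sup>2 / 2\<close> of this denominator absorb all powers of \<open>norm h\<close>. As
  \<open>n\<close> grows by 1 from factor to factor, the second bound and the square of the first
  are summable uniformly in \<open>h\<close>.\<close>

private lemma step_ratio_bounds:
  assumes "norm w \<le> exp (- (n * Re h))" "n > 0"
  shows "norm (step_ratio w) \<le> 4 / n" "norm h * norm (step_ratio w) \<le> 16 / n\<^sup>2" "norm w < 1"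
proof -
  define x where "x = n * Re h"
  have x: "x > 0" using assms h0 by (simp add: x_def)
  have w: "norm w \<le> exp (- x)" using assms by (simp add: x_def)
  also have "exp (- x) < 1" using x by simp
  finally show w1: "norm w < 1" .
  have "1 - norm w \<le> norm (1 - w)" using norm_triangle_ineq2[of 1 w] by simp
  then have d: "1 - exp (- x) \<le> norm (1 - w)" using w by linarith
  have ex: "x \<le> exp x - 1" "x\<^sup>2 / 2 \<le> exp x - 1"
    using exp_ge_add_one_self[of x] exp_lower_Taylor_quadratic[of x] x by linarith+
  have "norm w / norm (1 - w) \<le> exp (- x) / (1 - exp (- x))"
    using w d x by (intro frac_le) auto
  also have "\<dots> = 1 / (exp x - 1)" using x by (simp add: exp_minus field_simps)
  finally have q: "norm w / norm (1 - w) \<le> 1 / (exp x - 1)" .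
  have qx: "norm w / norm (1 - w) \<le> 1 / x"
    using q ex x by (intro order_trans[OF q] divide_left_mono) (auto simp: add_pos_pos)
  have qx2: "norm w / norm (1 - w) \<le> 1 / (x\<^sup>2 / 2)"
    using q ex x by (intro order_trans[OF q] divide_left_mono) auto
  have step_ratio: "norm (step_ratio w) \<le> 2 * norm h * (norm w / norm (1 - w))"
    using mult_right_mono[OF one_minus_exp_bounds(3), of "norm w / norm (1 - w)"]
    by (simp add: step_ratio_def norm_mult norm_divide mult_ac)
  also have "\<dots> \<le> 2 * norm h * (1 / x)" using qx by (intro mult_left_mono) auto
  also have "\<dots> \<le> 2 * (2 * Re h) * (1 / x)" using h0 x by (intro mult_right_mono) auto
  also have "\<dots> = 4 / n" using h0 assms by (simp add: x_def)
  finally show "norm (step_ratio w) \<le> 4 / n" .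
  have "norm h * norm (step_ratio w) \<le> norm h * (2 * norm h * (norm w / norm (1 - w)))"
    using step_ratio by (intro mult_left_mono) auto
  also have "\<dots> \<le> norm h * (2 * norm h * (1 / (x\<^sup>2 / 2)))" using qx2 by (intro mult_left_mono) auto
  also have "\<dots> = 4 * (norm h)\<^sup>2 * (1 / x\<^sup>2)" by (simp add: power2_eq_square)
  also have "\<dots> \<le> 4 * (2 * Re h)\<^sup>2 * (1 / x\<^sup>2)" using h0 by (intro mult_right_mono mult_left_mono power_mono) auto
  also have "\<dots> = 16 / n\<^sup>2" using h0 assms by (simp add: x_def power_mult_distrib)
  finally show "norm h * norm (step_ratio w) \<le> 16 / n\<^sup>2" .
qed

text \<open>Each factor quotient is compared with the \<open>\<sigma>\<close>-th power of the corresponding quotient for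
  \<open>\<sigma> = 1\<close>; the latter telescope to \<open>(1 - Y) powr (- \<sigma>)\<close>, and the errors \<open>step_error\<close> of the
  comparison sum up to \<open>E\<close>.\<close>

lemma qpoch_quotient_expansion:
  assumes Y: "norm Y \<le> exp (- (ratio_threshold M * Re h))"
  shows "\<exists>E. qpoch_inf (Y * exp (- (h * \<sigma>))) (exp (- h)) = exp (E - \<sigma> * Ln (1 - Y)) * qpoch_inf Y (exp (- h)) \<and>
    norm E \<le> ratio_const3 M * (\<Sum>j. 1 / (real j + 1)\<^sup>2) \<and>
    (\<forall>\<rho><1. norm Y \<le> \<rho> \<longrightarrow> norm E \<le> 4 * ratio_const3 M * norm h / (1 - \<rho>)\<^sup>2)"
proof -
  define q where "q = exp (- h)"
  define w where "w = (\<lambda>j. Y * q ^ j)"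
  have const2_nonneg: "0 \<le> ratio_const2 M" using shift_ratio_bound norm_ge_zero order_trans by blast
  have L1: "ratio_threshold M \<ge> 8" using const2_nonneg by (simp add: ratio_threshold_def)
  have q1: "norm q < 1" using h0 by (simp add: q_def)
  have qj: "norm (q ^ j) = exp (- (real j * Re h))" for j
    by (simp add: q_def norm_power flip: exp_of_nat_mult)
  have wn: "norm (w j) \<le> exp (- ((real j + ratio_threshold M) * Re h))" for j
    using mult_right_mono[OF Y, of "norm (q ^ j)"] by (simp add: w_def norm_mult qj algebra_simps flip: exp_add)
  have w1: "norm (w j) < 1" for j using step_ratio_bounds(3)[OF wn[of j]] L1 by simp
  have rb: "norm (step_ratio (w j)) \<le> 4 / (real j + ratio_threshold M)" "norm h * norm (step_ratio (w j)) \<le> 16 / (real j + ratio_threshold M)\<^sup>2" for j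
    using step_ratio_bounds(1,2)[OF wn[of j]] L1 by auto
  \<comment> \<open>The factor 8 in the threshold is chosen so that
    \<open>4 / ratio_threshold M\<close> is exactly the radius required by
    \<open>step_error_bound\<close>.\<close>
  have rs: "norm (step_ratio (w j)) \<le> 1 / (2 + 2 * ratio_const2 M)" for j
  proof -
    have "4 / (real j + ratio_threshold M) \<le> 4 / ratio_threshold M" using L1 by (intro divide_left_mono) auto
    also have "\<dots> = 1 / (2 + 2 * ratio_const2 M)" using const2_nonneg by (simp add: ratio_threshold_def field_simps)
    finally show ?thesis using rb(1)[of j] by linarith
  qed
  define c where "c = 2 * (ratio_const2 M)\<^sup>2 + 2 * M"
  have c0: "c \<ge> 0" using M_nonneg by (simp add: c_def)
  have const3_eq: "ratio_const3 M = 16 * (ratio_const1 M + c)" by (simp add: ratio_const3_def c_def)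
  have Eb: "norm (step_error (w j)) \<le> ratio_const1 M * (norm h * norm (step_ratio (w j))) + c * (norm (step_ratio (w j)))\<^sup>2" for j
    unfolding c_def by (rule step_error_bound(1)[OF rs])
  have E1: "norm (step_error (w j)) \<le> ratio_const3 M * (1 / (real j + 1)\<^sup>2)" for j
  proof -
    have "norm (step_error (w j)) \<le> ratio_const1 M * (16 / (real j + ratio_threshold M)\<^sup>2) + c * (4 / (real j + ratio_threshold M))\<^sup>2"
      using Eb[of j] mult_left_mono[OF rb(2)[of j] ratio_const1_nonneg]
        mult_left_mono[OF power_mono[OF rb(1)[of j] norm_ge_zero, of 2] c0] by linarith
    also have "\<dots> = ratio_const3 M * (1 / (real j + ratio_threshold M)\<^sup>2)" by (simp add: const3_eq power_divide add_divide_distrib[symmetric] algebra_simps)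
    also have "\<dots> \<le> ratio_const3 M * (1 / (real j + 1)\<^sup>2)"
      using L1 ratio_const1_nonneg c0 by (intro mult_left_mono divide_left_mono power_mono) (auto simp: const3_eq)
    finally show ?thesis .
  qed
  have sum2: "summable (\<lambda>j. 1 / (real j + 1)\<^sup>2)"
    using inverse_power_summable[of 2, where 'a = real]
    unfolding summable_Suc_iff[of "\<lambda>n. inverse (real n ^ 2)", symmetric] by (simp add: inverse_eq_divide add.commute)
  have sumE: "summable (\<lambda>j. norm (step_error (w j)))"
    by (rule summable_comparison_test'[OF summable_mult[OF sum2]]) (use E1 in auto)
  define E where "E = (\<Sum>j. step_error (w j))"
  have partial: "(\<Prod>j<n. 1 - Y * exp (- (h * \<sigma>)) * q ^ j) =
      (\<Prod>j<n. 1 - Y * q ^ j) * exp ((\<Sum>j<n. step_error (w j)) + \<sigma> * (Ln (1 - w n) - Ln (1 - Y)))" for n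
  proof (induction n)
    case (Suc n)
    have "w n \<noteq> 1" using w1[of n] by auto
    note fi = factor_identity[OF this]
    have "w (Suc n) = w n * exp (- h)" by (simp add: w_def q_def)
    then have "1 + step_ratio (w n) = (1 - w (Suc n)) / (1 - w n)" using fi \<open>w n \<noteq> 1\<close> by simp
    moreover have re: "Re (1 - w j) > 0" for j using w1[of j] complex_Re_le_cmod[of "w j"] by simp
    \<comment> \<open>All \<open>1 - w j\<close> lie in the right half plane, so the telescoping
      holds for principal logarithms, without branch jumps.\<close>
    ultimately have ln: "Ln (1 + step_ratio (w n)) = Ln (1 - w (Suc n)) - Ln (1 - w n)"
      using Ln_quotient_right_half[OF re re] by metis
    have "1 + shift_ratio * step_ratio (w n) = exp (step_error (w n) + \<sigma> * (Ln (1 - w (Suc n)) - Ln (1 - w n)))"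
      unfolding step_error_def ln[symmetric] using step_error_bound(2)[OF rs[of n]] by simp
    then have fac: "1 - Y * exp (- (h * \<sigma>)) * q ^ n =
        (1 - Y * q ^ n) * exp (step_error (w n) + \<sigma> * (Ln (1 - w (Suc n)) - Ln (1 - w n)))"
      using fi(1) by (simp add: w_def mult_ac)
    have "(\<Sum>j<Suc n. step_error (w j)) + \<sigma> * (Ln (1 - w (Suc n)) - Ln (1 - Y)) =
        ((\<Sum>j<n. step_error (w j)) + \<sigma> * (Ln (1 - w n) - Ln (1 - Y))) +
        (step_error (w n) + \<sigma> * (Ln (1 - w (Suc n)) - Ln (1 - w n)))"
      by (simp add: algebra_simps)
    then show ?case
      unfolding prod.lessThan_Suc Suc fac by (simp only: exp_add[of "_ + _" "_ + _"] mult_ac)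
  qed (simp add: w_def)
  have "w \<longlonglongrightarrow> Y * 0" unfolding w_def using q1 by (intro tendsto_intros LIMSEQ_power_zero)
  then have w0: "w \<longlonglongrightarrow> 0" by simp
  then have "(\<lambda>n. Ln (1 - w n)) \<longlonglongrightarrow> Ln (1 - 0)" by (intro tendsto_intros) auto
  then have lim: "(\<lambda>n. (\<Prod>j<n. 1 - Y * q ^ j) * exp ((\<Sum>j<n. step_error (w j)) + \<sigma> * (Ln (1 - w n) - Ln (1 - Y)))) \<longlonglongrightarrow>
      qpoch_inf Y q * exp (E + \<sigma> * (Ln (1 - 0) - Ln (1 - Y)))"
    unfolding E_def using summable_LIMSEQ[OF summable_norm_cancel[OF sumE]]
    by (intro tendsto_intros qpoch_LIMSEQ q1 w0) auto
  have "qpoch_inf (Y * exp (- (h * \<sigma>))) q = qpoch_inf Y q * exp (E + \<sigma> * (Ln (1 - 0) - Ln (1 - Y)))"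
    by (rule qpoch_eqI[OF q1]) (use lim in \<open>simp only: partial\<close>)
  then have main: "qpoch_inf (Y * exp (- (h * \<sigma>))) q = exp (E - \<sigma> * Ln (1 - Y)) * qpoch_inf Y q"
    by (simp add: mult_ac)
  have "norm E \<le> (\<Sum>j. norm (step_error (w j)))" unfolding E_def by (rule summable_norm[OF sumE])
  also have "\<dots> \<le> (\<Sum>j. ratio_const3 M * (1 / (real j + 1)\<^sup>2))" by (intro suminf_le E1 sumE summable_mult sum2)
  also have "\<dots> = ratio_const3 M * (\<Sum>j. 1 / (real j + 1)\<^sup>2)" by (rule suminf_mult[OF sum2])
  finally have b1: "norm E \<le> ratio_const3 M * (\<Sum>j. 1 / (real j + 1)\<^sup>2)" .
  \<comment> \<open>Away from the unit circle \<open>norm (1 - w j)\<close> is at least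
    \<open>1 - \<rho>\<close>, and each error is of order \<open>(norm h)\<^sup>2 * t ^ j\<close>.
    The geometric sum costs at most \<open>4 / norm h\<close>, so one factor \<open>norm h\<close>
    survives and makes \<open>E\<close> vanish in the limit.\<close>
  have b2: "norm E \<le> 4 * ratio_const3 M * norm h / (1 - \<rho>)\<^sup>2" if \<rho>: "\<rho> < 1" "norm Y \<le> \<rho>" for \<rho>
  proof -
    define t where "t = exp (- Re h)"
    have \<rho>0: "0 \<le> \<rho>" using \<rho> norm_ge_zero[of Y] by linarith
    have t: "0 < t" "t < 1" using h0 by (auto simp: t_def)
    have tj: "norm (q ^ j) = t ^ j" for j by (simp add: qj t_def flip: exp_of_nat_mult)
    have bound: "norm (step_error (w j)) \<le> ratio_const3 M * (norm h)\<^sup>2 / (1 - \<rho>)\<^sup>2 * t ^ j" for j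
    proof -
      have "norm (w j) = norm Y * t ^ j" by (simp add: w_def norm_mult tj)
      also have "\<dots> \<le> 1 * t ^ j" using \<rho> t by (intro mult_right_mono) auto
      finally have wj: "norm (w j) \<le> t ^ j" by simp
      have "norm Y * t ^ j \<le> \<rho> * 1" using \<rho> \<rho>0 t by (intro mult_mono power_le_one) auto
      then have "norm (w j) \<le> \<rho>" by (simp add: w_def norm_mult tj)
      then have d: "1 - \<rho> \<le> norm (1 - w j)" using norm_triangle_ineq2[of 1 "w j"] by simp
      have "norm (step_ratio (w j)) = norm (w j) * norm (1 - exp (- h)) / norm (1 - w j)"
        by (simp add: step_ratio_def norm_mult norm_divide)
      also have "\<dots> \<le> t ^ j * (2 * norm h) / (1 - \<rho>)"
        using wj d \<rho> t by (intro frac_le mult_mono one_minus_exp_bounds) auto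
      finally have r: "norm (step_ratio (w j)) \<le> 2 * norm h / (1 - \<rho>) * t ^ j" by (simp add: mult_ac)
      have "t ^ j \<le> 1" using t by (intro power_le_one) auto
      define a where "a = norm h / (1 - \<rho>)"
      have a0: "a \<ge> 0" "norm h \<le> a" using \<rho> \<rho>0 by (auto simp: a_def field_simps mult_left_le)
      have r': "norm (step_ratio (w j)) \<le> 2 * a * t ^ j" using r by (simp add: a_def)
      have "2 * a * t ^ j \<le> 2 * a * 1" using a0 \<open>t ^ j \<le> 1\<close> by (intro mult_left_mono) auto
      with r' have "(norm (step_ratio (w j)))\<^sup>2 \<le> (2 * a) * (2 * a * t ^ j)"
        unfolding power2_eq_square using a0 by (intro mult_mono) auto
      moreover have "norm h * norm (step_ratio (w j)) \<le> a * (2 * a * t ^ j)" using r' a0 by (intro mult_mono) auto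
      ultimately have "norm (step_error (w j)) \<le> ratio_const1 M * (a * (2 * a * t ^ j)) + c * ((2 * a) * (2 * a * t ^ j))"
        using Eb[of j] mult_left_mono[OF _ ratio_const1_nonneg] mult_left_mono[OF _ c0] by (smt (verit, best))
      also have "\<dots> = (2 * ratio_const1 M + 4 * c) * (a\<^sup>2 * t ^ j)" by (simp add: power2_eq_square algebra_simps)
      also have "\<dots> \<le> ratio_const3 M * (a\<^sup>2 * t ^ j)" using ratio_const1_nonneg c0 t by (intro mult_right_mono) (auto simp: const3_eq)
      finally show ?thesis by (simp add: a_def power_divide mult_ac)
    qed
    define B where "B = ratio_const3 M * (norm h)\<^sup>2 / (1 - \<rho>)\<^sup>2"
    have B0: "B \<ge> 0" using ratio_const1_nonneg c0 by (simp add: B_def const3_eq)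
    have "norm E \<le> (\<Sum>j. norm (step_error (w j)))" unfolding E_def by (rule summable_norm[OF sumE])
    also have "\<dots> \<le> (\<Sum>j. B * t ^ j)" using t bound unfolding B_def
      by (intro suminf_le sumE summable_mult summable_geometric) auto
    also have "\<dots> = B * (1 / (1 - t))" using t by (subst suminf_mult) (auto simp: suminf_geometric summable_geometric)
    also have "\<dots> \<le> B * (4 / norm h)"
    proof -
      have "Re h \<le> 1 / 6" using h0 complex_Re_le_cmod[of h] by linarith
      have "1 + Re h \<le> exp (Re h)" by (rule exp_ge_add_one_self)
      then have "t \<le> 1 / (1 + Re h)" using h0 by (simp add: t_def exp_minus field_simps)
      also have "\<dots> \<le> 1 - Re h / 2"
      proof -
        have "1 \<le> (1 - Re h / 2) * (1 + Re h)" using h0 \<open>Re h \<le> 1 / 6\<close>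
          mult_left_mono[of "Re h" 1 "Re h"] by (simp add: algebra_simps)
        then show ?thesis using h0 by (simp add: field_simps)
      qed
      finally have "norm h / 4 \<le> 1 - t" using h0 by linarith
      then have "1 / (1 - t) \<le> 1 / (norm h / 4)" using h_pos t by (intro divide_left_mono) auto
      then show ?thesis using B0 by (intro mult_left_mono) auto
    qed
    also have "\<dots> = 4 * ratio_const3 M * norm h / (1 - \<rho>)\<^sup>2" using h_pos by (simp add: B_def power2_eq_square)
    finally show ?thesis .
  qed
  show ?thesis using main b1 b2 unfolding q_def by blast
qed

end

section \<open>Pairs of hyperbolic gamma functions on the line of integration\<close>

text \<open>Where the denominator does not vanish the quotient is analytic, and
  \<open>remove_sings\<close> leaves its value unchanged.\<close>

lemma hyp_gamma_eq:
  assumes im: "Im (w1 / w2) > 0"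
  defines "q \<equiv> exp (2 * of_real pi * \<i> * w1 / w2)" and "q' \<equiv> exp (- 2 * of_real pi * \<i> * w2 / w1)"
  assumes q1: "norm q < 1" "norm q' < 1"
  assumes nz: "qpoch_inf (exp (2 * of_real pi * \<i> * z / w2)) q \<noteq> 0"
  shows "hyp_gamma w1 w2 z = exp (- (of_real pi * \<i> / 2) * B22 w1 w2 z) *
     (qpoch_inf (q' * exp (2 * of_real pi * \<i> * z / w1)) q' / qpoch_inf (exp (2 * of_real pi * \<i> * z / w2)) q)"
proof -
  have w: "w1 \<noteq> 0" "w2 \<noteq> 0" using im by auto
  have hol: "(\<lambda>z. qpoch_inf (f z) p) holomorphic_on UNIV" if "f holomorphic_on UNIV" "norm p < 1" for f p
    using that by (intro qpoch_holomorphic) auto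
  have ana: "(\<lambda>z. qpoch_inf (f z) p) analytic_on A" if "f holomorphic_on UNIV" "norm p < 1" for f p A
    using hol[OF that] by (meson analytic_on_holomorphic open_UNIV subset_UNIV)
  have "(\<lambda>z. exp (- (of_real pi * \<i> / 2) * B22 w1 w2 z) *
     (qpoch_inf (q' * exp (2 * of_real pi * \<i> * z / w1)) q' / qpoch_inf (exp (2 * of_real pi * \<i> * z / w2)) q))
     analytic_on {z}"
    unfolding B22_def
    by (intro analytic_intros ana q1 holomorphic_intros) (use w nz in auto)
  then show ?thesis
    unfolding hyp_gamma_def Let_def q_def[symmetric] q'_def[symmetric] by simp
qed

section \<open>The nome and the line of integration in real coordinates\<close>

definition sqrt_omega_real :: "real \<Rightarrow> real" where "sqrt_omega_real \<delta> = sqrt (1 + \<delta>\<^sup>2)"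

text \<open>The unit vector of \<open>omega1 \<delta>\<close>, whose modulus is
  \<open>sqrt_omega_real \<delta>\<close>. Division by \<open>omega2 \<delta>\<close> is
  multiplication by it up to that modulus, and it tends to \<i>.\<close>

definition omega_dir :: "real \<Rightarrow> complex" where "omega_dir \<delta> = omega1 \<delta> / of_real (sqrt_omega_real \<delta>)"

text \<open>The nome is \<open>q = exp (- log_nome \<delta>)\<close>, with \<open>log_nome \<delta>\<close> close to \<open>4 \<pi> \<delta>\<close>, and on the line
  \<open>z = \<i> S y\<close> with \<open>S = sqrt_omega_real \<delta>\<close> the point \<open>line_point \<delta> b y\<close> is
  \<open>exp (2 \<pi> \<i> (\<delta> - \<i> S b + z) / omega2 \<delta>)\<close>.\<close>

definition log_nome :: "real \<Rightarrow> complex" where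
  "log_nome \<delta> = - (4 * of_real pi * \<i> * of_real \<delta> * omega_dir \<delta> / of_real (sqrt_omega_real \<delta>))"

definition line_point :: "real \<Rightarrow> complex \<Rightarrow> real \<Rightarrow> complex" where
  "line_point \<delta> b y = exp (- log_nome \<delta> / 2 - 2 * of_real pi * of_real y * omega_dir \<delta> + 2 * of_real pi * b * omega_dir \<delta>)"

abbreviation "line_qpoch \<delta> b y \<equiv> qpoch_inf (line_point \<delta> b y) (exp (- log_nome \<delta>))"

lemma sqrt_omega_real_pos: "sqrt_omega_real \<delta> > 0" "sqrt_omega_real \<delta> \<ge> 1"
  by (auto simp: sqrt_omega_real_def add_pos_nonneg)

lemma sqrt_omega_real_sq: "(sqrt_omega_real \<delta>)\<^sup>2 = 1 + \<delta>\<^sup>2"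
  by (simp add: sqrt_omega_real_def add_nonneg_nonneg)

lemma sqrt_omega_eq: "sqrt_omega \<delta> = of_real (sqrt_omega_real \<delta>)"
  by (simp add: sqrt_omega_def sqrt_omega_real_def)

lemma omega_dir_eq: "omega_dir \<delta> = Complex (\<delta> / sqrt_omega_real \<delta>) (1 / sqrt_omega_real \<delta>)"
  by (simp add: omega_dir_def omega1_def complex_eq_iff)

lemma norm_omega_dir: "norm (omega_dir \<delta>) = 1"
  using sqrt_omega_real_pos[of \<delta>] sqrt_omega_real_sq[of \<delta>]
    add_pos_nonneg[OF zero_less_one zero_le_power2[of \<delta>]]
  by (simp add: omega_dir_eq cmod_def power_divide add_divide_distrib[symmetric] add.commute)

lemma inverse_omega: "1 / omega2 \<delta> = omega_dir \<delta> / of_real (sqrt_omega_real \<delta>)"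
  "1 / omega1 \<delta> = cnj (omega_dir \<delta>) / of_real (sqrt_omega_real \<delta>)"
proof -
  have "of_real (sqrt_omega_real \<delta>) * of_real (sqrt_omega_real \<delta>) = omega1 \<delta> * omega2 \<delta>"
    unfolding omega_mult sqrt_omega_real_sq[symmetric] by (simp add: power2_eq_square)
  then show "1 / omega2 \<delta> = omega_dir \<delta> / of_real (sqrt_omega_real \<delta>)"
    using omega_nonzero[of \<delta>] by (simp add: omega_dir_def)
  then have "cnj (1 / omega2 \<delta>) = cnj (omega_dir \<delta> / of_real (sqrt_omega_real \<delta>))" by simp
  then show "1 / omega1 \<delta> = cnj (omega_dir \<delta>) / of_real (sqrt_omega_real \<delta>)"
    by (simp add: omega2_def)
qed

lemma log_nome_eq: "log_nome \<delta> = of_real (4 * pi * \<delta> / (1 + \<delta>\<^sup>2)) * (1 - \<i> * of_real \<delta>)"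
proof -
  have "log_nome \<delta> = - (4 * of_real pi * \<i> * of_real \<delta> * omega1 \<delta> / of_real ((sqrt_omega_real \<delta>)\<^sup>2))"
    by (simp add: log_nome_def omega_dir_def power2_eq_square)
  then show ?thesis unfolding sqrt_omega_real_sq
    by (simp add: omega1_def minus_divide_left[symmetric] algebra_simps) (simp add: minus_divide_left)
qed

lemma Re_log_nome: "Re (log_nome \<delta>) = 4 * pi * \<delta> / (1 + \<delta>\<^sup>2)"
  by (simp add: log_nome_eq)

lemma norm_log_nome: "\<delta> > 0 \<Longrightarrow> norm (log_nome \<delta>) = 4 * pi * \<delta> / sqrt_omega_real \<delta>"
  by (simp add: log_nome_def norm_mult norm_divide norm_omega_dir abs_of_pos[OF sqrt_omega_real_pos(1)])

text \<open>The quotient of the periods is -1 plus a term of order \<delta>. The exponential does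
  not see the -1, and this is why the nome tends to 1.\<close>

lemma nome_eq:
  "exp (2 * of_real pi * \<i> * omega1 \<delta> / omega2 \<delta>) = exp (- log_nome \<delta>)"
  "exp (- 2 * of_real pi * \<i> * omega2 \<delta> / omega1 \<delta>) = cnj (exp (- log_nome \<delta>))"
proof -
  have "omega1 \<delta> / omega2 \<delta> = 2 * of_real \<delta> * (1 / omega2 \<delta>) - 1"
    using omega_nonzero[of \<delta>] by (simp add: field_simps omega1_def omega2_def)
  then have "2 * of_real pi * \<i> * omega1 \<delta> / omega2 \<delta> = - log_nome \<delta> - of_real (2 * pi) * \<i>"
    unfolding inverse_omega by (simp only: times_divide_eq_right[symmetric]) (simp add: log_nome_def algebra_simps)
  then show 1: "exp (2 * of_real pi * \<i> * omega1 \<delta> / omega2 \<delta>) = exp (- log_nome \<delta>)"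
    by (simp add: exp_diff)
  have "exp (- 2 * of_real pi * \<i> * omega2 \<delta> / omega1 \<delta>) = cnj (exp (2 * of_real pi * \<i> * omega1 \<delta> / omega2 \<delta>))"
    by (simp add: exp_cnj omega2_def)
  then show "exp (- 2 * of_real pi * \<i> * omega2 \<delta> / omega1 \<delta>) = cnj (exp (- log_nome \<delta>))" using 1 by simp
qed

lemma norm_nome: "\<delta> > 0 \<Longrightarrow> norm (exp (- log_nome \<delta>)) < 1"
  by (simp add: Re_log_nome add_pos_nonneg)

text \<open>With the reflection formula, both gamma functions of a pair are expressed by \<open>q\<close>-products whose
  arguments are bounded for \<open>y \<ge> 0\<close>.\<close>

definition gamma_quot :: "real \<Rightarrow> complex \<Rightarrow> real \<Rightarrow> complex" where
  "gamma_quot \<delta> a y = exp (- (2 * of_real pi * \<i> * of_real y * a)) *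
     (line_qpoch \<delta> (- a) y / line_qpoch \<delta> a y) * cnj (line_qpoch \<delta> (cnj a) y / line_qpoch \<delta> (- cnj a) y)"

text \<open>For \<open>y \<ge> 0\<close> the symbols at \<open>- y\<close>, coming from the gamma
  function at \<delta> - g - z, are those with large arguments. The theta transformation at the
  reflected point \<open>w\<close> trades their quotient for symbols at \<open>y\<close>. Since
  \<open>B22\<close> is symmetric about half the sum of the periods, it has the same value at
  \<open>w\<close> and at \<delta> - g - z, and the quadratic exponents combine to a term linear in
  \<open>y\<close>.\<close>

lemma hyp_gamma_pm_eq:
  fixes a :: complex and y \<delta> :: real
  assumes \<delta>: "\<delta> > 0"
    and nz: "line_qpoch \<delta> a y \<noteq> 0" "line_qpoch \<delta> a (- y) \<noteq> 0" "line_qpoch \<delta> (- cnj a) y \<noteq> 0"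
  defines "S \<equiv> complex_of_real (sqrt_omega_real \<delta>)"
  shows "hyp_gamma_pm (omega1 \<delta>) (omega2 \<delta>) (\<i> * S * of_real y) ((omega1 \<delta> + omega2 \<delta>) / 2 - \<i> * S * a)
    = gamma_quot \<delta> a y"
proof -
  define z g where "z = \<i> * S * of_real y" and "g = \<i> * S * a"
  define q where "q = exp (- log_nome \<delta>)"
  define B where "B = B22 (omega1 \<delta>) (omega2 \<delta>)"
  have S0: "S \<noteq> 0" using sqrt_omega_real_pos[of \<delta>] by (simp add: S_def)
  have im: "Im (omega1 \<delta> / omega2 \<delta>) > 0" by (rule omega_Im_quotient[OF \<delta>])
  have q1: "norm q < 1" using norm_nome[OF \<delta>] by (simp add: q_def)
  have sum2: "(omega1 \<delta> + omega2 \<delta>) / 2 = of_real \<delta>" by (simp add: omega_add)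
  have div2: "2 * of_real pi * \<i> * w / omega2 \<delta> = 2 * of_real pi * \<i> * (omega_dir \<delta> / S) * w"
    and div1: "2 * of_real pi * \<i> * w / omega1 \<delta> = 2 * of_real pi * \<i> * (cnj (omega_dir \<delta>) / S) * w" for w
  proof -
    have "2 * of_real pi * \<i> * w / omega2 \<delta> = 2 * of_real pi * \<i> * w * (1 / omega2 \<delta>)"
      "2 * of_real pi * \<i> * w / omega1 \<delta> = 2 * of_real pi * \<i> * w * (1 / omega1 \<delta>)" by simp_all
    then show "2 * of_real pi * \<i> * w / omega2 \<delta> = 2 * of_real pi * \<i> * (omega_dir \<delta> / S) * w"
      "2 * of_real pi * \<i> * w / omega1 \<delta> = 2 * of_real pi * \<i> * (cnj (omega_dir \<delta>) / S) * w"
      unfolding inverse_omega S_def by (simp_all only: mult_ac)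
  qed
  define k where "k = omega_dir \<delta> / S"
  have k: "omega_dir \<delta> = k * S" "log_nome \<delta> = - (4 * of_real pi * \<i> * of_real \<delta> * k)"
    unfolding k_def log_nome_def S_def[symmetric] by (simp_all add: S0)
  have Sr: "cnj S = S" by (simp add: S_def)
  have ex2: "exp (2 * of_real pi * \<i> * (of_real \<delta> - \<i> * S * b + \<i> * S * of_real t) / omega2 \<delta>) = line_point \<delta> b t" for b t
    unfolding div2 line_point_def k by (rule arg_cong[of _ _ exp]) (simp add: algebra_simps S0)
  have ex1: "cnj q * exp (2 * of_real pi * \<i> * (of_real \<delta> - \<i> * S * b + \<i> * S * of_real t) / omega1 \<delta>) =
      cnj (line_point \<delta> (cnj b) t)" for b t
  proof -
    have "cnj (- log_nome \<delta>) + 2 * of_real pi * \<i> * (cnj (omega_dir \<delta>) / S) * (of_real \<delta> - \<i> * S * b + \<i> * S * of_real t)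
      = cnj (- log_nome \<delta> / 2 - 2 * of_real pi * of_real t * omega_dir \<delta> + 2 * of_real pi * cnj b * omega_dir \<delta>)"
      using S0 unfolding k by (simp add: Sr algebra_simps)
    then show ?thesis unfolding q_def exp_cnj div1 line_point_def by (simp only: exp_add[symmetric])
  qed
  have gam: "hyp_gamma (omega1 \<delta>) (omega2 \<delta>) (of_real \<delta> - g + \<i> * S * of_real t) =
      exp (- (of_real pi * \<i> / 2) * B (of_real \<delta> - g + \<i> * S * of_real t)) *
      (cnj (line_qpoch \<delta> (cnj a) t) / line_qpoch \<delta> a t)" if "line_qpoch \<delta> a t \<noteq> 0" for t
  proof -
    have "qpoch_inf (cnj (line_point \<delta> (cnj a) t)) (cnj q) = cnj (line_qpoch \<delta> (cnj a) t)"
      using qpoch_cnj[OF q1] by (simp add: q_def)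
    then show ?thesis
      using hyp_gamma_eq[OF im, of "of_real \<delta> - g + \<i> * S * of_real t"] that q1 unfolding g_def B_def
      by (simp only: nome_eq ex2 q_def[symmetric] ex1 complex_mod_cnj simp_thms)
  qed
  define w where "w = of_real \<delta> + g + z"
  have x2: "exp (2 * of_real pi * \<i> * w / omega2 \<delta>) = line_point \<delta> (- a) y"
    using ex2[of "- a" y] by (simp add: w_def g_def z_def)
  have x2': "q / line_point \<delta> (- a) y = line_point \<delta> a (- y)"
    unfolding q_def line_point_def exp_diff[symmetric] by (rule arg_cong[of _ _ exp]) (simp add: algebra_simps)
  have x1': "cnj q / exp (- (2 * of_real pi * \<i> * w / omega1 \<delta>)) = cnj (line_point \<delta> (- cnj a) y)"
    using ex1[of "- a" y] by (simp add: w_def g_def z_def exp_minus field_simps)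
  have x1: "exp (- (2 * of_real pi * \<i> * w / omega1 \<delta>)) = cnj (line_point \<delta> (cnj a) (- y))"
  proof -
    have "exp (- (2 * of_real pi * \<i> * w / omega1 \<delta>)) = cnj q / cnj (line_point \<delta> (- cnj a) y)"
      using x1' by (simp add: field_simps line_point_def q_def)
    also have "\<dots> = cnj (q / line_point \<delta> (- cnj a) y)" by simp
    also have "q / line_point \<delta> (- cnj a) y = line_point \<delta> (cnj a) (- y)"
      unfolding q_def line_point_def exp_diff[symmetric] by (rule arg_cong[of _ _ exp]) (simp add: algebra_simps)
    finally show ?thesis .
  qed
  have "jtheta (exp (- (2 * of_real pi * \<i> * w / omega1 \<delta>))) (cnj q) =
      exp (of_real pi * \<i> * B w) * jtheta (exp (2 * of_real pi * \<i> * w / omega2 \<delta>)) q"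
    using theta_transform_omega[OF \<delta>, of w] by (simp only: nome_eq q_def B_def)
  then have th: "cnj (line_qpoch \<delta> (cnj a) (- y)) * cnj (line_qpoch \<delta> (- cnj a) y) =
      exp (of_real pi * \<i> * B w) * (line_qpoch \<delta> (- a) y * line_qpoch \<delta> a (- y))"
    unfolding jtheta_def x1 x1'[unfolded x1] x2 x2' unfolding q_def[symmetric] qpoch_cnj[OF q1] by simp
  have "hyp_gamma_pm (omega1 \<delta>) (omega2 \<delta>) z (of_real \<delta> - g) =
      exp (- (of_real pi * \<i> / 2) * B (of_real \<delta> - g + z)) * (cnj (line_qpoch \<delta> (cnj a) y) / line_qpoch \<delta> a y) *
      (exp (- (of_real pi * \<i> / 2) * B (of_real \<delta> - g - z)) * (cnj (line_qpoch \<delta> (cnj a) (- y)) / line_qpoch \<delta> a (- y)))"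
    using gam[OF nz(1)] gam[OF nz(2)] by (simp add: hyp_gamma_pm_def z_def algebra_simps)
  also have "cnj (line_qpoch \<delta> (cnj a) (- y)) / line_qpoch \<delta> a (- y) =
      exp (of_real pi * \<i> * B w) * (line_qpoch \<delta> (- a) y / cnj (line_qpoch \<delta> (- cnj a) y))"
    using th nz by (simp add: field_simps)
  also have "exp (- (of_real pi * \<i> / 2) * B (of_real \<delta> - g + z)) * (cnj (line_qpoch \<delta> (cnj a) y) / line_qpoch \<delta> a y) *
      (exp (- (of_real pi * \<i> / 2) * B (of_real \<delta> - g - z)) *
       (exp (of_real pi * \<i> * B w) * (line_qpoch \<delta> (- a) y / cnj (line_qpoch \<delta> (- cnj a) y)))) =
      exp (of_real pi * \<i> * (B w - B (of_real \<delta> - g + z) / 2 - B (of_real \<delta> - g - z) / 2)) *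
      (line_qpoch \<delta> (- a) y / line_qpoch \<delta> a y) * cnj (line_qpoch \<delta> (cnj a) y / line_qpoch \<delta> (- cnj a) y)"
  proof -
    have "exp (of_real pi * \<i> * (B w - B (of_real \<delta> - g + z) / 2 - B (of_real \<delta> - g - z) / 2)) =
      exp (- (of_real pi * \<i> / 2) * B (of_real \<delta> - g + z)) * exp (- (of_real pi * \<i> / 2) * B (of_real \<delta> - g - z)) *
      exp (of_real pi * \<i> * B w)"
      unfolding exp_add[symmetric] by (rule arg_cong[of _ _ exp]) (simp add: algebra_simps)
    then show ?thesis by simp
  qed
  also have "B w - B (of_real \<delta> - g + z) / 2 - B (of_real \<delta> - g - z) / 2 = - (2 * of_real y * a)"
  proof -
    have SS: "omega1 \<delta> * omega2 \<delta> = S * S"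
      unfolding omega_mult S_def sqrt_omega_real_sq[symmetric] by (simp add: power2_eq_square)
    show ?thesis
      unfolding B_def B22_def sum2 SS using S0
      by (simp add: w_def g_def z_def field_simps power2_eq_square)
  qed
  also have "of_real pi * \<i> * - (2 * of_real y * a) = - (2 * of_real pi * \<i> * of_real y * a)" by simp
  finally show ?thesis unfolding gamma_quot_def sum2 z_def g_def .
qed

section \<open>Distance of the factors from zero\<close>

lemma norm_one_minus_exp_le:
  fixes z :: complex
  shows "norm (1 - exp (- z)) \<le> norm z * (1 + norm z * exp (norm z))"
proof -
  have "norm (1 - exp (- z)) \<le> norm z + norm (1 - exp (- z) - z)"
    using norm_triangle_ineq[of z "1 - exp (- z) - z"] by simp
  also have "\<dots> \<le> norm z + exp (norm z) * (norm z)\<^sup>2" using exp_minus_one_bound[of z] by simp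
  finally show ?thesis by (simp add: power2_eq_square algebra_simps)
qed

text \<open>If \<open>exp \<zeta>\<close> is within 1/2 of 1, its principal logarithm has norm at
  most twice that distance and differs from \<zeta> by a multiple of 2 \<pi> \<i>, so its norm is at
  least \<open>d\<close>.\<close>

lemma norm_one_minus_exp_ge:
  fixes \<zeta> :: complex
  assumes "\<And>l::int. d \<le> norm (\<zeta> - 2 * of_real pi * \<i> * of_int l)"
  shows "min 1 d / 2 \<le> norm (1 - exp \<zeta>)"
proof (cases "norm (1 - exp \<zeta>) \<le> 1 / 2")
  case True
  define x where "x = exp \<zeta> - 1"
  have x: "norm x \<le> 1 / 2" "norm x = norm (1 - exp \<zeta>)" using True by (simp_all add: x_def norm_minus_commute)
  define \<xi> where "\<xi> = Ln (1 + x)"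
  have "norm \<xi> \<le> norm x + norm (Ln (1 + x) - x)" using norm_triangle_ineq[of x "Ln (1 + x) - x"] by (simp add: \<xi>_def)
  also have "\<dots> \<le> norm x + 2 * (norm x * norm x)" using norm_Ln_one_plus_diff[OF x(1)] by (simp add: power2_eq_square)
  also have "norm x * norm x \<le> 1 / 2 * norm x" using x by (intro mult_right_mono) auto
  finally have "norm \<xi> \<le> 2 * norm x" by simp
  moreover have "exp \<xi> = exp \<zeta>" by (simp add: \<xi>_def x_def)
  then obtain l :: int where "\<zeta> = \<xi> + of_real (of_int (2 * l) * pi) * \<i>"
    using exp_eq[of \<zeta> \<xi>] by auto
  then have "\<zeta> - 2 * of_real pi * \<i> * of_int l = \<xi>" by (simp add: algebra_simps)
  with assms[of l] have "d \<le> norm \<xi>" by simp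
  ultimately show ?thesis using x by (auto simp: min_def)
qed auto

lemma line_point_power: "line_point \<delta> b y * exp (- log_nome \<delta>) ^ j =
   exp (- (of_nat j + 1 / 2) * log_nome \<delta> - 2 * of_real pi * of_real y * omega_dir \<delta> + 2 * of_real pi * b * omega_dir \<delta>)"
  unfolding line_point_def exp_of_nat_mult[symmetric] exp_add[symmetric]
  by (rule arg_cong[of _ _ exp]) (simp add: algebra_simps)

lemma Re_omega_dir: "Re (omega_dir \<delta>) = \<delta> / sqrt_omega_real \<delta>" "Im (omega_dir \<delta>) = 1 / sqrt_omega_real \<delta>"
  by (simp_all add: omega_dir_eq)

text \<open>On the real line the zeros of the denominators stay away by a multiple of \<open>\<delta>\<close>, because
  they lie on the lines \<open>Im y = \<delta> (p / sqrt_omega_real \<delta> - s)\<close> with \<open>p\<close> an integer.\<close>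

lemma line_point_lower:
  assumes \<delta>: "0 < \<delta>" "\<delta> \<le> 1 / 2" and s: "0 < s" "s < 1" and S: "(1 + s) / 2 \<le> 1 / sqrt_omega_real \<delta>"
    and b: "Im b = - (\<delta> * s)"
  shows "min s ((1 - s) / 2) * \<delta> \<le> norm (1 - line_point \<delta> b y * exp (- log_nome \<delta>) ^ j)"
proof -
  define c where "c = min s ((1 - s) / 2)"
  define \<theta> where "\<theta> = omega_dir \<delta>"
  define T where "T = sqrt_omega_real \<delta>"
  have T: "T > 0" using sqrt_omega_real_pos by (simp add: T_def)
  define \<zeta> where "\<zeta> = - (of_nat j + 1 / 2) * log_nome \<delta> - 2 * of_real pi * of_real y * \<theta> + 2 * of_real pi * b * \<theta>"
  have c: "0 < c" "c \<le> 1" "c \<le> s" "c \<le> (1 - s) / 2" using s by (auto simp: c_def min_def)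
  have "2 * pi * (c * \<delta>) \<le> norm (\<zeta> - 2 * of_real pi * \<i> * of_int l)" for l
  proof -
    \<comment> \<open>Dividing by \<open>2 * pi * \<theta>\<close>, where
      \<open>norm \<theta> = 1\<close>, turns the difference into \<open>\<beta>\<close>, and the
      imaginary part of \<open>\<beta>\<close> does not depend on the real coordinate
      \<open>y\<close>.\<close>
    define \<beta> where "\<beta> = \<i> * of_real (\<delta> * (2 * real j + 1) / T) - of_real y + b - \<i> * of_int l * cnj \<theta>"
    define k where "k = \<theta> / of_real T"
    have "\<theta> * cnj \<theta> = 1" using norm_omega_dir[of \<delta>] by (simp add: complex_norm_square[symmetric] \<theta>_def)
    then have \<theta>1: "\<theta> * (cnj \<theta> * x) = x" for x by (simp flip: mult.assoc)
    have "log_nome \<delta> = - (4 * of_real pi * \<i> * of_real \<delta> * k)"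
      by (simp add: log_nome_def \<theta>_def T_def k_def)
    moreover define X where "X = complex_of_real (\<delta> * (2 * real j + 1))"
    have "\<theta> * \<beta> = \<i> * (k * X) - of_real y * \<theta> + b * \<theta> - \<i> * of_int l"
    proof -
      have \<beta>: "\<beta> = \<i> * (X / of_real T) - of_real y + b - \<i> * of_int l * cnj \<theta>" by (simp add: \<beta>_def X_def)
      have "\<theta> * \<beta> = \<i> * (\<theta> / of_real T * X) - of_real y * \<theta> + b * \<theta> - \<theta> * (cnj \<theta> * (\<i> * of_int l))"
        unfolding \<beta> by (simp add: algebra_simps)
      then show ?thesis by (simp only: \<theta>1 k_def)
    qed
    then have "of_real (2 * pi) * \<theta> * \<beta> = of_real (2 * pi) * (\<i> * (k * X) - of_real y * \<theta> + b * \<theta> - \<i> * of_int l)"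
      by (simp only: mult.assoc)
    ultimately have "\<zeta> - 2 * of_real pi * \<i> * of_int l = of_real (2 * pi) * \<theta> * \<beta>"
      unfolding \<zeta>_def X_def by (simp add: algebra_simps)
    then have n: "norm (\<zeta> - 2 * of_real pi * \<i> * of_int l) = 2 * pi * norm \<beta>"
      using norm_omega_dir[of \<delta>] by (simp add: norm_mult \<theta>_def)
    define p where "p = 2 * int j + 1 - l"
    have "Im \<beta> = \<delta> * (of_int p / T - s)"
      using T by (simp add: \<beta>_def b Re_omega_dir \<theta>_def T_def[symmetric] p_def field_simps)
    \<comment> \<open>For \<open>p \<le> 0\<close> the gap is at least \<open>s\<close>; for
      \<open>p \<ge> 1\<close> the assumption on \<open>sqrt_omega_real \<delta>\<close> leaves
      \<open>(1 - s) / 2\<close>. These are the two entries of the minimum.\<close>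
    moreover have "c \<le> \<bar>of_int p / T - s\<bar>"
    proof (cases "p \<le> 0")
      case True
      then have "of_int p / T \<le> 0" using T by (simp add: divide_nonpos_pos)
      then show ?thesis using c s by linarith
    next
      case False
      then have "1 / T \<le> of_int p / T" using T by (intro divide_right_mono) auto
      with S have "(1 + s) / 2 \<le> of_int p / T" unfolding T_def by (rule order_trans)
      moreover define P where "P = of_int p / T"
      ultimately have "(1 + s) / 2 \<le> P" by simp
      then have "c \<le> \<bar>P - s\<bar>" using c by argo
      then show ?thesis by (simp add: P_def)
    qed
    ultimately have "\<delta> * c \<le> \<bar>Im \<beta>\<bar>" using \<delta> by (simp add: abs_mult)
    also have "\<dots> \<le> norm \<beta>" by (rule abs_Im_le_cmod)
    finally show ?thesis unfolding n by (simp add: mult.commute)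
  qed
  from norm_one_minus_exp_ge[OF this] have "min 1 (2 * pi * (c * \<delta>)) / 2 \<le> norm (1 - exp \<zeta>)" .
  moreover have "c * \<delta> \<le> min 1 (2 * pi * (c * \<delta>)) / 2"
  proof -
    have "c * \<delta> \<le> 1 * (1 / 2)" using c \<delta> by (intro mult_mono) auto
    moreover have "1 * (c * \<delta>) \<le> pi * (c * \<delta>)" using c \<delta> pi_gt3 by (intro mult_right_mono) auto
    ultimately show ?thesis unfolding min_def by (simp add: mult_ac)
  qed
  ultimately show ?thesis unfolding line_point_power \<zeta>_def \<theta>_def c_def by linarith
qed

lemma line_qpoch_nonzero:
  assumes \<delta>: "0 < \<delta>" "\<delta> \<le> 1 / 2" and s: "0 < s" "s < 1" and S: "(1 + s) / 2 \<le> 1 / sqrt_omega_real \<delta>"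
    and b: "Im b = - (\<delta> * s)"
  shows "line_qpoch \<delta> b y \<noteq> 0"
proof (rule qpoch_nonzero[OF norm_nome[OF \<delta>(1)]])
  fix j
  have "0 < min s ((1 - s) / 2) * \<delta>" using s \<delta> by auto
  with line_point_lower[OF assms, of y j] show "line_point \<delta> b y * exp (- log_nome \<delta>) ^ j \<noteq> 1" by auto
qed

text \<open>For a parameter with imaginary part \<open>- (\<delta> * s)\<close> this shift is
  complex conjugation; in terms of the nome it is a power with the real exponent
  \<open>sqrt_omega_real \<delta> * s\<close>.\<close>

lemma line_point_shift:
  "line_point \<delta> (b + 2 * \<i> * of_real (s * \<delta>)) y = line_point \<delta> b y * exp (- (log_nome \<delta> * of_real (sqrt_omega_real \<delta> * s)))"
proof -
  have "log_nome \<delta> * of_real (sqrt_omega_real \<delta> * s) = - (4 * of_real pi * \<i> * of_real (\<delta> * s) * omega_dir \<delta>)"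
    using sqrt_omega_real_pos[of \<delta>] by (simp add: log_nome_def)
  then show ?thesis unfolding line_point_def exp_add[symmetric]
    by (intro arg_cong[of _ _ exp]) (simp add: algebra_simps)
qed

text \<open>Projecting to the unit circle moves the point by \<open>1 - r\<close>, and this is at
  most its distance from 1 before the projection.\<close>

lemma norm_one_minus_exp_imag:
  fixes r \<phi> :: real
  assumes "0 \<le> r" "r \<le> 1"
  shows "norm (1 - exp (\<i> * of_real \<phi>)) \<le> 2 * norm (1 - of_real r * exp (\<i> * of_real \<phi>))"
proof -
  define e where "e = exp (\<i> * of_real \<phi>)"
  have e: "norm e = 1" by (simp add: e_def)
  have re: "norm (of_real r * e) = r" using assms e by (simp add: norm_mult)
  have "norm (of_real r * e - e) = norm (of_real (r - 1) * e)" by (simp add: algebra_simps)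
  also have "\<dots> = 1 - r" using assms e by (simp add: norm_mult del: of_real_diff)
  finally have "norm (1 - e) \<le> norm (1 - of_real r * e) + (1 - r)"
    using norm_triangle_ineq[of "1 - of_real r * e" "of_real r * e - e"] by simp
  moreover have "1 - r \<le> norm (1 - of_real r * e)"
    using norm_triangle_ineq2[of 1 "of_real r * e"] re by simp
  ultimately show ?thesis unfolding e_def by linarith
qed

lemma norm_exp_imag_diff_le:
  fixes a b :: real
  shows "norm (exp (\<i> * of_real a) - exp (\<i> * of_real b)) \<le> \<bar>a - b\<bar>"
proof -
  have "norm (exp (\<i> * of_real a) - exp (\<i> * of_real b)) =
      norm (exp (\<i> * of_real b) * (exp (\<i> * of_real (a - b)) - 1))"
    by (simp add: algebra_simps flip: exp_add)
  also have "\<dots> = norm (exp (\<i> * of_real (a - b)) - 1)"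
    by (simp add: norm_mult)
  also have "\<dots> = 2 * \<bar>sin ((a - b) / 2)\<bar>" by (rule dist_exp_i_1)
  also have "\<dots> \<le> \<bar>a - b\<bar>" using abs_sin_x_le_abs_x[of "(a - b) / 2"] by simp
  finally show ?thesis .
qed

lemma sqrt_omega_real_le: "sqrt_omega_real \<delta> \<le> 1 + \<delta>\<^sup>2 / 2" "\<delta> \<ge> 0 \<Longrightarrow> sqrt_omega_real \<delta> \<le> 1 + \<delta>"
proof -
  have "1 + \<delta>\<^sup>2 \<le> (1 + \<delta>\<^sup>2 / 2)\<^sup>2" by (simp add: power2_sum power2_eq_square[of 1] power_divide)
  then show "sqrt_omega_real \<delta> \<le> 1 + \<delta>\<^sup>2 / 2" unfolding sqrt_omega_real_def by (intro real_le_lsqrt) auto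
  assume "\<delta> \<ge> 0"
  then have "1 + \<delta>\<^sup>2 \<le> (1 + \<delta>)\<^sup>2" by (simp add: power2_eq_square algebra_simps)
  then show "sqrt_omega_real \<delta> \<le> 1 + \<delta>" unfolding sqrt_omega_real_def using \<open>\<delta> \<ge> 0\<close> by (intro real_le_lsqrt) auto
qed

lemma norm_omega_dir_minus_i:
  assumes "0 < \<delta>" "\<delta> \<le> 1"
  shows "norm (omega_dir \<delta> - \<i>) \<le> 2 * \<delta>"
proof -
  define T where "T = sqrt_omega_real \<delta>"
  have T: "T > 0" "1 \<le> T" "T \<le> 1 + \<delta>"
    using sqrt_omega_real_pos[of \<delta>] sqrt_omega_real_le(2)[of \<delta>] assms by (auto simp: T_def)
  have "norm (omega_dir \<delta> - \<i>) \<le> \<bar>Re (omega_dir \<delta> - \<i>)\<bar> + \<bar>Im (omega_dir \<delta> - \<i>)\<bar>" by (rule cmod_le)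
  also have "\<dots> = \<delta> / T + (1 - 1 / T)"
    using T assms by (simp add: Re_omega_dir T_def)
  also have "\<delta> / T \<le> \<delta> / 1" using T assms by (intro divide_left_mono) auto
  also have "1 - 1 / T \<le> \<delta>"
  proof -
    have "(1 - \<delta>) * T \<le> (1 - \<delta>) * (1 + \<delta>)" using T assms by (intro mult_left_mono) auto
    also have "\<dots> \<le> 1" by (simp add: algebra_simps)
    finally show ?thesis using T by (simp add: field_simps)
  qed
  finally show ?thesis by simp
qed

text \<open>A substitute, free of the parameter \<open>b\<close>, for the distance from 1 of the
  arguments of the symbols: the first entry accounts for their modulus, the second for their phase.
  The summand 1 in \<open>y + 1\<close> records that the distance remains of order \<delta> even at
  \<open>y = 0\<close>.\<close>

definition singular_dist :: "real \<Rightarrow> real \<Rightarrow> real" where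
  "singular_dist \<delta> y = max (min 1 (\<delta> * (y + 1))) (norm (1 - exp (2 * of_real pi * \<i> * of_real y)) / 2)"

text \<open>The first \<open>J\<close> factors, with \<open>J\<close> independent of \<delta>, are
  treated separately: the shift changes each by order \<delta>, and each is at least of order
  \<delta>, so their ratios are bounded. The remaining symbols obey the expansion with its uniform
  error bound, after which \<open>norm (1 - Y')\<close> is compared with
  \<open>singular_dist\<close>.\<close>

lemma quot_bound:
  fixes n :: int and b1 :: complex
  assumes s: "0 < s" "s < 1" and b1: "Im b1 = - s"
  shows "\<exists>C>0. \<forall>\<delta> y. 0 < \<delta> \<longrightarrow> \<delta> \<le> 1 / 80 \<longrightarrow> (1 + s) / 2 \<le> 1 / sqrt_omega_real \<delta> \<longrightarrow> 0 \<le> y \<longrightarrow>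
     norm (line_qpoch \<delta> (of_int n + of_real \<delta> * b1 + 2 * \<i> * of_real (s * \<delta>)) y / line_qpoch \<delta> (of_int n + of_real \<delta> * b1) y)
       \<le> C * singular_dist \<delta> y powr (- (sqrt_omega_real \<delta> * s))"
proof -
  define A where "A = \<bar>real_of_int n\<bar> + norm b1 + 1"
  define L where "L = ratio_threshold 2"
  \<comment> \<open>\<open>2 * L\<close> factors push the argument below the threshold, where the 2
    pays for knowing only that \<open>Re h\<close> lies between 2 \<pi> \<delta> and 4 \<pi>
    \<delta>. The other \<open>A\<close> factors compensate for the parameter \<open>b\<close>,
    which enlarges the modulus by at most \<open>exp (2 * pi * \<delta> * A)\<close>.\<close>
  define J where "J = nat \<lceil>A + 2 * L\<rceil>"
  define c0 where "c0 = min s ((1 - s) / 2)"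
  define K where "K = 1 + exp (2 * pi * A) * (16 * pi) / c0"
  define B where "B = ratio_const3 2 * (\<Sum>j. 1 / (real j + 1)\<^sup>2)"
  define C2 where "C2 = 4 * pi * (real J + 1) + 4 * pi * A"
  define C3 where "C3 = C2 * (1 + C2 * exp C2)"
  define c4 where "c4 = 3 + 2 * C3"
  have L8: "L \<ge> 8"
  proof -
    have "ratio_const2 2 \<ge> 0" by (simp add: ratio_const2_def ratio_const1_def)
    then show ?thesis by (simp add: L_def ratio_threshold_def)
  qed
  have A1: "A \<ge> 1" by (simp add: A_def)
  have J: "real J \<ge> A + 2 * L" unfolding J_def by linarith
  have c0: "0 < c0" using s by (simp add: c0_def)
  have K: "K \<ge> 1" using c0 by (simp add: K_def)
  have C2: "C2 \<ge> 0" using A1 by (simp add: C2_def)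
  then have C3: "C3 \<ge> 0" by (simp add: C3_def)
  have c4: "c4 \<ge> 1" using C3 by (simp add: c4_def)
  have main: "norm (line_qpoch \<delta> (b + 2 * \<i> * of_real (s * \<delta>)) y / line_qpoch \<delta> b y)
       \<le> K ^ J * exp B * c4\<^sup>2 * singular_dist \<delta> y powr (- (sqrt_omega_real \<delta> * s))"
    if \<delta>: "0 < \<delta>" "\<delta> \<le> 1 / 80" and S: "(1 + s) / 2 \<le> 1 / sqrt_omega_real \<delta>" and y: "0 \<le> y"
      and b: "b = of_int n + of_real \<delta> * b1" for \<delta> y b
  proof -
    define h where "h = log_nome \<delta>"
    define T where "T = sqrt_omega_real \<delta>"
    define \<theta> where "\<theta> = omega_dir \<delta>"
    define q where "q = exp (- h)"
    define \<sigma> where "\<sigma> = T * s"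
    define Y where "Y = line_point \<delta> b y"
    define Y' where "Y' = Y * q ^ J"
    define e where "e = exp (- (h * of_real \<sigma>))"
    have T: "1 \<le> T" "T \<le> 2" "0 < T" using sqrt_omega_real_le(2)[of \<delta>] sqrt_omega_real_pos[of \<delta>] \<delta> by (auto simp: T_def)
    have \<sigma>: "0 < \<sigma>" "\<sigma> \<le> 2" using T s mult_mono[of T 2 s 1] by (auto simp: \<sigma>_def)
    have Imb: "Im b = - (\<delta> * s)" using b b1 by simp
    have q1: "norm q < 1" using norm_nome[OF \<delta>(1)] by (simp add: q_def h_def)
    have d2: "\<delta>\<^sup>2 \<le> 1" using \<delta> by (simp add: power_le_one)
    have Reh: "2 * pi * \<delta> \<le> Re h" "Re h \<le> 4 * pi * \<delta>" "0 < Re h"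
    proof -
      have "4 * pi * \<delta> / 2 \<le> 4 * pi * \<delta> / (1 + \<delta>\<^sup>2)" using d2 \<delta> by (intro divide_left_mono) (auto simp: add_pos_nonneg)
      then show 1: "2 * pi * \<delta> \<le> Re h" by (simp add: h_def Re_log_nome)
      have "4 * pi * \<delta> / (1 + \<delta>\<^sup>2) \<le> 4 * pi * \<delta> / 1" using d2 \<delta> by (intro divide_left_mono) (auto simp: add_pos_nonneg)
      then show "Re h \<le> 4 * pi * \<delta>" by (simp add: h_def Re_log_nome)
      show "0 < Re h" using 1 \<delta> by (smt (verit) mult_pos_pos pi_gt_zero)
    qed
    have nh: "norm h \<le> 4 * pi * \<delta>"
    proof -
      have "4 * pi * \<delta> / T \<le> 4 * pi * \<delta> / 1" using T \<delta> by (intro divide_left_mono) auto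
      then show ?thesis using norm_log_nome[OF \<delta>(1)] by (simp add: h_def T_def)
    qed
    have pi4: "pi < 3.2" using pi_less_4 pi_approx by simp
    \<comment> \<open>The bound 1/80 on \<delta> is made for this step, as 4 * 3.2 / 80 is below
      1/6.\<close>
    have h16: "norm h \<le> 1 / 6"
    proof -
      have "pi * \<delta> \<le> 3.2 * (1 / 80)" using pi4 \<delta> by (intro mult_mono) auto
      with nh show ?thesis by linarith
    qed
    have h2: "norm h \<le> 2 * Re h" using nh Reh by linarith
    have hs: "norm (h * of_real \<sigma>) \<le> 8 * pi * \<delta>" "norm (h * of_real \<sigma>) \<le> 1 / 3"
    proof -
      have "norm h * \<sigma> \<le> (4 * pi * \<delta>) * 2" using nh \<sigma> \<delta> by (intro mult_mono) auto
      then show "norm (h * of_real \<sigma>) \<le> 8 * pi * \<delta>" using \<sigma> by (simp add: norm_mult)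
      have "norm h * \<sigma> \<le> 1 / 6 * 2" using h16 \<sigma> by (intro mult_mono) auto
      then show "norm (h * of_real \<sigma>) \<le> 1 / 3" using \<sigma> by (simp add: norm_mult)
    qed
    have e1: "norm (1 - e) \<le> 16 * pi * \<delta>"
    proof -
      define t where "t = norm (h * of_real \<sigma>)"
      have t: "0 \<le> t" "t \<le> 1 / 3" "t \<le> 8 * pi * \<delta>" using hs by (auto simp: t_def)
      have "exp t \<le> exp 1" using t by simp
      also have "\<dots> \<le> 3" by (rule exp_le)
      finally have "t * exp t \<le> 1 / 3 * 3" using t by (intro mult_mono) auto
      then have "t * (1 + t * exp t) \<le> t * 2" using t by (intro mult_left_mono) auto
      then show ?thesis using norm_one_minus_exp_le[of "h * of_real \<sigma>"] t by (simp add: e_def t_def)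
    qed
    have Reb: "Re (b * \<theta>) \<le> \<delta> * A"
    proof -
      have "Re (b * \<theta>) = \<delta> * (Re b + s) / T"
        using T by (simp add: Re_omega_dir \<theta>_def T_def[symmetric] Imb field_simps)
      also have "\<dots> \<le> \<delta> * A / T"
      proof (intro divide_right_mono mult_left_mono)
        have "\<bar>\<delta> * Re b1\<bar> \<le> 1 * norm b1" unfolding abs_mult using \<delta> abs_Re_le_cmod[of b1] by (intro mult_mono) auto
        then show "Re b + s \<le> A" using s by (simp add: A_def b)
      qed (use \<delta> T in auto)
      also have "\<dots> \<le> \<delta> * A / 1" using T A1 \<delta> by (intro divide_left_mono) auto
      finally show ?thesis by simp
    qed
    have Yj: "norm (Y * q ^ j) = exp (- (real j + 1 / 2) * Re h - 2 * pi * y * \<delta> / T + 2 * pi * Re (b * \<theta>))" for j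
    proof -
      have "Re (2 * of_real pi * b * \<theta>) = 2 * pi * Re (b * \<theta>)" by (simp add: algebra_simps)
      moreover have "Re (2 * of_real pi * of_real y * \<theta>) = 2 * pi * y * \<delta> / T"
        by (simp add: Re_omega_dir \<theta>_def T_def)
      moreover have "Re (- (of_nat j + 1 / 2) * h) = - (real j + 1 / 2) * Re h" by simp
      ultimately show ?thesis
        unfolding Y_def q_def h_def line_point_power norm_exp_eq_Re
        unfolding h_def[symmetric] \<theta>_def[symmetric]
        by (simp only: minus_complex.sel plus_complex.sel)
    qed
    have yT: "2 * pi * y * \<delta> / T \<ge> pi * \<delta> * y"
    proof -
      have "2 * pi * y * \<delta> / 2 \<le> 2 * pi * y * \<delta> / T" using T y \<delta> by (intro divide_left_mono) auto
      then show ?thesis by (simp add: mult_ac)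
    qed
    have pd: "0 < pi * \<delta>" "0 \<le> pi * \<delta> * y" using \<delta> y by auto
    have Yj1: "norm (Y * q ^ j) \<le> exp (2 * pi * A)" for j
    proof -
      have "- (real j + 1 / 2) * Re h \<le> 0" using Reh by (simp add: mult_nonpos_nonneg)
      moreover have "\<delta> * A \<le> 1 * A" using \<delta> A1 by (intro mult_right_mono) auto
      then have "2 * pi * Re (b * \<theta>) \<le> 2 * pi * A" using Reb by simp
      ultimately show ?thesis unfolding Yj exp_le_cancel_iff using yT pd by linarith
    qed
    have Y'n: "norm Y' \<le> exp (- (4 * pi * \<delta> * L + pi * \<delta> * y))"
    proof -
      have "(A + 2 * L) * (2 * pi * \<delta>) \<le> (real J + 1 / 2) * Re h"
        using J Reh \<delta> A1 L8 by (intro mult_mono) auto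
      moreover have "2 * pi * Re (b * \<theta>) \<le> 2 * pi * (\<delta> * A)" using Reb by simp
      ultimately have "- (real J + 1 / 2) * Re h - 2 * pi * y * \<delta> / T + 2 * pi * Re (b * \<theta>)
          \<le> 2 * pi * (\<delta> * A) - (A + 2 * L) * (2 * pi * \<delta>) - pi * \<delta> * y"
        using yT by (simp only: mult_minus_left)
      also have "\<dots> = - (4 * pi * \<delta> * L + pi * \<delta> * y)" by (simp add: algebra_simps)
      finally show ?thesis unfolding Y'_def Yj exp_le_cancel_iff .
    qed
    have "L * Re h \<le> L * (4 * pi * \<delta>)" using Reh L8 by (intro mult_left_mono) auto
    then have Y'L: "norm Y' \<le> exp (- (L * Re h))"
      using pd by (intro order_trans[OF Y'n]) (simp add: mult_ac)
    define \<mu> where "\<mu> = min 1 (\<delta> * (y + 1))"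
    have \<mu>: "0 < \<mu>" "\<mu> \<le> 1" "\<delta> \<le> \<mu>" 
    proof -
      have "0 \<le> \<delta> * y" using \<delta> y by simp
      then show "0 < \<mu>" "\<mu> \<le> 1" "\<delta> \<le> \<mu>"
        unfolding \<mu>_def distrib_left using \<delta> by (auto simp: add_nonneg_pos)
    qed
    \<comment> \<open>The radial half of the comparison: the modulus of \<open>Y'\<close> is at most
      \<open>exp (- \<mu>)\<close>.\<close>
    have one_Y': "\<mu> \<le> 2 * norm (1 - Y')"
    proof -
      have "1 * (\<delta> * y) \<le> pi * (\<delta> * y)" using pi_gt3 \<delta> y by (intro mult_right_mono) auto
      moreover have "1 * \<delta> \<le> (4 * pi * L) * \<delta>"
      proof (rule mult_right_mono)
        have "1 * 1 \<le> (4 * pi) * L" using pi_gt3 L8 by (intro mult_mono) auto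
        then show "1 \<le> 4 * pi * L" by simp
      qed (use \<delta> in simp)
      moreover have "\<mu> \<le> \<delta> * y + \<delta>" by (simp add: \<mu>_def distrib_left)
      ultimately have "\<mu> \<le> 4 * pi * \<delta> * L + pi * \<delta> * y" by (simp add: mult_ac)
      then have "norm Y' \<le> exp (- \<mu>)" using Y'n by (smt (verit) exp_le_cancel_iff)
      also have "exp (- \<mu>) \<le> 1 / (1 + \<mu>)" using exp_ge_add_one_self[of \<mu>] \<mu> by (simp add: exp_minus field_simps)
      also have "\<dots> \<le> 1 - \<mu> / 2"
      proof -
        have "\<mu> * \<mu> \<le> \<mu> * 1" using \<mu> by (intro mult_left_mono) auto
        then show ?thesis using \<mu> by (simp add: field_simps)
      qed
      finally show ?thesis using norm_triangle_ineq2[of 1 Y'] by simp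
    qed
    define X where "X = exp (- (2 * of_real pi * of_real y * \<theta>))"
    define r where "r = exp (- (2 * pi * y * \<delta> / T))"
    have X: "X = of_real r * exp (\<i> * of_real (- (2 * pi * y / T)))"
    proof -
      have "- (2 * of_real pi * of_real y * \<theta>) = of_real (- (2 * pi * y * \<delta> / T)) + \<i> * of_real (- (2 * pi * y / T))"
        by (simp add: complex_eq_iff Re_omega_dir \<theta>_def T_def)
      then show ?thesis unfolding X_def r_def by (simp only: exp_add exp_of_real)
    qed
    have r: "0 \<le> r" "r \<le> 1" using y \<delta> T by (auto simp: r_def)
    have nX: "norm X = r" using r by (simp add: X norm_mult)
    \<comment> \<open>\<open>X\<close> is \<open>Y'\<close> freed from the powers of the nome and
      from the parameter \<open>b\<close>. Once the integer part of the parameter is discarded as a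
      number of full turns, the two differ by a factor \<open>exp (- \<xi>)\<close> with
      \<open>\<xi>\<close> of order \<delta>, and \<open>one_Y'\<close> absorbs an error of that
      order.\<close>
    have X1: "norm (1 - X) \<le> (1 + 2 * C3) * norm (1 - Y')"
    proof -
      define \<xi> where "\<xi> = (of_nat J + 1 / 2) * h - 2 * of_real pi * (b * \<theta> - \<i> * of_int n)"
      have "norm (b * \<theta> - \<i> * of_int n) = norm (of_int n * (\<theta> - \<i>) + of_real \<delta> * b1 * \<theta>)"
        by (simp add: b algebra_simps)
      also have "\<dots> \<le> \<bar>real_of_int n\<bar> * (2 * \<delta>) + \<delta> * norm b1"
      proof (intro norm_triangle_le add_mono)
        show "norm (of_int n * (\<theta> - \<i>)) \<le> \<bar>real_of_int n\<bar> * (2 * \<delta>)"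
          unfolding norm_mult norm_of_int \<theta>_def using \<delta> by (intro mult_left_mono norm_omega_dir_minus_i) auto
        show "norm (of_real \<delta> * b1 * \<theta>) \<le> \<delta> * norm b1"
          using \<delta> norm_omega_dir[of \<delta>] by (simp add: norm_mult \<theta>_def)
      qed
      also have "\<dots> \<le> 2 * \<delta> * A" using \<delta> by (simp add: A_def algebra_simps)
      finally have n1: "norm (b * \<theta> - \<i> * of_int n) \<le> 2 * \<delta> * A" .
      have "norm ((of_nat J + 1 / 2) * h) \<le> (real J + 1) * (4 * pi * \<delta>)"
      proof -
        have "norm (of_nat J + 1 / 2 :: complex) = real J + 1 / 2"
          using norm_of_real[of "real J + 1 / 2", where 'a = complex] by simp
        then show ?thesis unfolding norm_mult using nh by (intro mult_mono) auto
      qed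
      moreover have "norm (2 * of_real pi * (b * \<theta> - \<i> * of_int n)) \<le> 2 * pi * (2 * \<delta> * A)"
        using mult_left_mono[OF n1, of "2 * pi"] by (simp only: norm_mult) simp
      ultimately have xi: "norm \<xi> \<le> C2 * \<delta>"
        unfolding \<xi>_def by (intro norm_triangle_le_diff) (simp add: C2_def algebra_simps)
      then have xi2: "norm \<xi> \<le> C2" using \<delta> C2 mult_left_mono[of \<delta> 1 C2] by linarith
      have "norm (1 - exp (- \<xi>)) \<le> norm \<xi> * (1 + norm \<xi> * exp (norm \<xi>))" by (rule norm_one_minus_exp_le)
      also have "\<dots> \<le> (C2 * \<delta>) * (1 + C2 * exp C2)"
        using xi xi2 C2 \<delta> by (intro mult_mono add_mono) auto
      finally have ex: "norm (1 - exp (- \<xi>)) \<le> C3 * \<delta>" by (simp add: C3_def mult_ac)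
      have "Y' = X * exp (- \<xi>)"
      proof -
        have "exp (2 * of_real pi * (\<i> * of_int n)) = 1"
          using exp_integer_2pi[of "of_int n"] by (simp add: mult_ac)
        then have "X * exp (- \<xi>) = X * exp (- \<xi>) * exp (2 * of_real pi * (\<i> * of_int n))" by simp
        also have "\<dots> = Y'"
          unfolding Y'_def Y_def q_def h_def line_point_power X_def exp_add[symmetric]
          by (rule arg_cong[of _ _ exp]) (simp add: \<xi>_def h_def \<theta>_def algebra_simps)
        finally show ?thesis by simp
      qed
      then have "1 - X = (1 - Y') - X * (1 - exp (- \<xi>))" by (simp add: algebra_simps)
      then have "norm (1 - X) \<le> norm (1 - Y') + norm X * norm (1 - exp (- \<xi>))"
        using norm_triangle_ineq4[of "1 - Y'" "X * (1 - exp (- \<xi>))"] by (simp only: norm_mult)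
      also have "norm X * norm (1 - exp (- \<xi>)) \<le> 1 * (C3 * \<delta>)" using ex nX r by (intro mult_mono) auto
      also have "1 * (C3 * \<delta>) \<le> C3 * \<mu>" using \<mu> C3 by (simp add: mult_left_mono)
      also have "\<dots> \<le> C3 * (2 * norm (1 - Y'))" using one_Y' C3 by (intro mult_left_mono) auto
      finally show ?thesis by (simp add: algebra_simps)
    qed
    \<comment> \<open>The phase of \<open>X\<close> involves \<open>y / T\<close> instead of
      \<open>y\<close>. Since \<open>1 - 1 / T\<close> is of order \<delta> squared, the discrepancy
      is below \<open>2 * \<mu>\<close> as long as \<open>\<delta> * (y + 1) \<le> 1\<close>; beyond
      that \<open>\<mu> = 1\<close> and the bound is trivial.\<close>
    have per: "norm (1 - exp (2 * of_real pi * \<i> * of_real y)) \<le> 2 * norm (1 - X) + 2 * \<mu>"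
    proof -
      define f where "f = (\<lambda>t. exp (\<i> * complex_of_real t))"
      have "norm (1 - exp (2 * of_real pi * \<i> * of_real y)) = norm (cnj (1 - exp (2 * of_real pi * \<i> * of_real y)))"
        by (simp only: complex_mod_cnj)
      also have "\<dots> = norm (1 - f (- (2 * pi * y)))" by (simp add: f_def exp_cnj mult_ac)
      also have "\<dots> \<le> norm (1 - f (- (2 * pi * y / T))) + norm (f (- (2 * pi * y / T)) - f (- (2 * pi * y)))"
        using norm_triangle_ineq[of "1 - f (- (2 * pi * y / T))" "f (- (2 * pi * y / T)) - f (- (2 * pi * y))"] by simp
      also have "norm (1 - f (- (2 * pi * y / T))) \<le> 2 * norm (1 - X)"
        unfolding f_def X using r by (rule norm_one_minus_exp_imag)
      also have "norm (f (- (2 * pi * y / T)) - f (- (2 * pi * y))) \<le> 2 * \<mu>"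
      proof (cases "\<delta> * (y + 1) \<le> 1")
        case True
        have "norm (f (- (2 * pi * y / T)) - f (- (2 * pi * y))) \<le> \<bar>- (2 * pi * y / T) - - (2 * pi * y)\<bar>"
          unfolding f_def by (rule norm_exp_imag_diff_le)
        also have "- (2 * pi * y / T) - - (2 * pi * y) = 2 * pi * y * (1 - 1 / T)" by (simp add: algebra_simps)
        also have "\<bar>2 * pi * y * (1 - 1 / T)\<bar> = 2 * pi * y * (1 - 1 / T)"
          using T y by (intro abs_of_nonneg mult_nonneg_nonneg) auto
        also have "1 - 1 / T \<le> \<delta>\<^sup>2 / 2"
        proof -
          have "1 - 1 / T = (T - 1) / T" using T by (simp add: field_simps)
          also have "\<dots> \<le> (T - 1) / 1" using T by (intro divide_left_mono) auto
          finally show ?thesis using sqrt_omega_real_le(1)[of \<delta>] by (simp add: T_def)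
        qed
        then have "2 * pi * y * (1 - 1 / T) \<le> 2 * pi * y * (\<delta>\<^sup>2 / 2)" using y by (intro mult_left_mono) auto
        also have "2 * pi * y * (\<delta>\<^sup>2 / 2) = (pi * \<delta>) * (\<delta> * y)" by (simp add: power2_eq_square)
        also have "\<dots> \<le> 1 * (\<delta> * y)"
          using pi4 \<delta> y mult_mono[of pi "3.2" \<delta> "1 / 80"] by (intro mult_right_mono) auto
        also have "\<dots> \<le> 2 * \<mu>" using True \<delta> y by (simp add: \<mu>_def algebra_simps)
        finally show ?thesis by linarith
      next
        case False
        then have "\<mu> = 1" by (simp add: \<mu>_def)
        moreover have "norm (f a - f b) \<le> 2" for a b
          using norm_triangle_ineq4[of "f a" "f b"] by (simp add: f_def)
        ultimately show ?thesis by simp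
      qed
      finally show ?thesis by simp
    qed
    define V where "V = singular_dist \<delta> y"
    have V0: "0 < V" using \<mu> by (simp add: V_def singular_dist_def \<mu>_def)
    have V: "V \<le> c4 * norm (1 - Y')"
    proof -
      have "norm (1 - exp (2 * of_real pi * \<i> * of_real y)) / 2 \<le> (1 + 2 * C3) * norm (1 - Y') + 2 * norm (1 - Y')"
        using per X1 one_Y' by linarith
      also have "\<dots> = c4 * norm (1 - Y')" by (simp add: c4_def algebra_simps)
      finally have 1: "norm (1 - exp (2 * of_real pi * \<i> * of_real y)) / 2 \<le> c4 * norm (1 - Y')" .
      have "2 * norm (1 - Y') \<le> c4 * norm (1 - Y')" using C3 by (intro mult_right_mono) (auto simp: c4_def)
      then have "\<mu> \<le> c4 * norm (1 - Y')" using one_Y' by linarith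
      with 1 show ?thesis by (simp add: V_def singular_dist_def \<mu>_def)
    qed
    have Y'1: "norm (1 - Y') > 0" using one_Y' \<mu> by linarith
    have pw: "norm (1 - Y') powr (- \<sigma>) \<le> c4\<^sup>2 * V powr (- \<sigma>)"
    proof -
      have "V / c4 \<le> norm (1 - Y')" using V c4 by (simp add: field_simps)
      then have "norm (1 - Y') powr (- \<sigma>) \<le> (V / c4) powr (- \<sigma>)"
        using V0 c4 \<sigma> by (intro powr_mono2') auto
      also have "\<dots> = c4 powr \<sigma> * V powr (- \<sigma>)"
        using V0 c4 by (simp add: powr_divide powr_minus field_simps)
      also have "c4 powr \<sigma> \<le> c4 powr 2" using c4 \<sigma> by (intro powr_mono) auto
      also have "c4 powr 2 = c4\<^sup>2" using c4 by simp
      finally show ?thesis using V0 by (simp add: mult_right_mono)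
    qed
    obtain E where E: "qpoch_inf (Y' * e) q = exp (E - of_real \<sigma> * Ln (1 - Y')) * qpoch_inf Y' q"
      "norm E \<le> ratio_const3 2 * (\<Sum>j. 1 / (real j + 1)\<^sup>2)"
      using qpoch_quotient_expansion[of h "of_real \<sigma>" 2 Y'] Reh h2 h16 \<sigma> Y'L
      unfolding e_def q_def L_def by auto
    have nE: "norm (exp (E - of_real \<sigma> * Ln (1 - Y'))) \<le> exp B * norm (1 - Y') powr (- \<sigma>)"
    proof -
      have "Re (E - of_real \<sigma> * Ln (1 - Y')) = Re E - \<sigma> * ln (norm (1 - Y'))" using Y'1 by simp
      moreover have "Re E \<le> B" using E(2) complex_Re_le_cmod[of E] by (simp add: B_def)
      ultimately show ?thesis using Y'1 by (simp add: powr_def flip: exp_add)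
    qed
    have lower: "c0 * \<delta> \<le> norm (1 - Y * q ^ j)" for j
      unfolding c0_def Y_def q_def h_def using line_point_lower[OF _ _ s S Imb] \<delta> by simp
    have ratio: "norm (1 - Y * e * q ^ j) \<le> K * norm (1 - Y * q ^ j)" for j
    proof -
      have "1 - Y * e * q ^ j = (1 - Y * q ^ j) + Y * q ^ j * (1 - e)" by (simp add: algebra_simps)
      then have "norm (1 - Y * e * q ^ j) \<le> norm (1 - Y * q ^ j) + norm (Y * q ^ j) * norm (1 - e)"
        using norm_triangle_ineq[of "1 - Y * q ^ j" "Y * q ^ j * (1 - e)"] by (simp only: norm_mult)
      also have "norm (Y * q ^ j) * norm (1 - e) \<le> exp (2 * pi * A) * (16 * pi * \<delta>)"
        using Yj1 e1 by (intro mult_mono) auto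
      also have "\<dots> = exp (2 * pi * A) * (16 * pi) / c0 * (c0 * \<delta>)" using c0 by simp
      also have "\<dots> \<le> exp (2 * pi * A) * (16 * pi) / c0 * norm (1 - Y * q ^ j)"
        using c0 lower by (intro mult_left_mono) auto
      finally show ?thesis by (simp add: K_def algebra_simps)
    qed
    define P where "P = (\<Prod>j<J. 1 - Y * q ^ j)"
    define P' where "P' = (\<Prod>j<J. 1 - Y * e * q ^ j)"
    have PP: "norm P' \<le> K ^ J * norm P"
    proof -
      have "norm P' = (\<Prod>j<J. norm (1 - Y * e * q ^ j))" unfolding P'_def by (rule prod_norm[symmetric])
      also have "\<dots> \<le> (\<Prod>j<J. K * norm (1 - Y * q ^ j))" by (intro prod_mono conjI norm_ge_zero ratio)
      also have "\<dots> = K ^ J * norm P" by (simp add: prod.distrib P_def prod_norm)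
      finally show ?thesis .
    qed
    have nz: "qpoch_inf Y q \<noteq> 0"
      unfolding Y_def q_def h_def using line_qpoch_nonzero[OF _ _ s S Imb] \<delta> by simp
    have dec: "qpoch_inf Y q = P * qpoch_inf Y' q"
      unfolding P_def Y'_def by (rule qpoch_shift[OF q1])
    have "qpoch_inf (Y * e) q = P' * qpoch_inf (Y' * e) q"
      unfolding P'_def Y'_def using qpoch_shift[OF q1, of "Y * e" J] by (simp add: mult_ac)
    also have "\<dots> = P' * exp (E - of_real \<sigma> * Ln (1 - Y')) * qpoch_inf Y' q" by (simp add: E(1))
    finally have "norm (qpoch_inf (Y * e) q) =
        norm P' * norm (exp (E - of_real \<sigma> * Ln (1 - Y'))) * norm (qpoch_inf Y' q)"
      by (simp only: norm_mult)
    also have "\<dots> \<le> (K ^ J * norm P) * (exp B * (c4\<^sup>2 * V powr (- \<sigma>))) * norm (qpoch_inf Y' q)"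
      using K by (intro mult_right_mono mult_mono[OF PP order_trans[OF nE mult_left_mono[OF pw]]]) auto
    also have "\<dots> = (K ^ J * exp B * c4\<^sup>2 * V powr (- \<sigma>)) * norm (qpoch_inf Y q)"
      by (simp add: dec norm_mult)
    finally have "norm (qpoch_inf (Y * e) q / qpoch_inf Y q) \<le> K ^ J * exp B * c4\<^sup>2 * V powr (- \<sigma>)"
      using nz by (simp add: norm_divide divide_le_eq)
    then show ?thesis
      unfolding line_point_shift Y_def e_def h_def q_def V_def \<sigma>_def T_def .
  qed
  have "0 < K ^ J * exp B * c4\<^sup>2" using K c4 by simp
  with main show ?thesis by blast
qed

section \<open>The pointwise limit\<close>

text \<open>The last condition keeps the zeros of the denominators away from the real line and also
  gives \<open>sqrt_omega_real \<delta> * s \<le> (1 + s) / 2\<close>, an exponent bound independent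
  of \<delta>.\<close>

abbreviation "small_step s \<delta> \<equiv> 0 < \<delta> \<and> \<delta> \<le> 1 / 80 \<and> (1 + s) / 2 \<le> 1 / sqrt_omega_real \<delta>"

lemma sqrt_omega_real_tendsto: "((\<lambda>\<delta>. sqrt_omega_real \<delta>) \<longlongrightarrow> 1) (at_right 0)"
proof -
  have "((\<lambda>\<delta>::real. sqrt (1 + \<delta>\<^sup>2)) \<longlongrightarrow> sqrt (1 + 0\<^sup>2)) (at_right 0)" by (intro tendsto_intros)
  then show ?thesis by (simp add: sqrt_omega_real_def)
qed

lemma eventually_small_step:
  assumes "s < 1"
  shows "\<forall>\<^sub>F \<delta> in at_right 0. small_step s \<delta>"
proof -
  have "((\<lambda>\<delta>. 1 / sqrt_omega_real \<delta>) \<longlongrightarrow> 1 / 1) (at_right 0)" by (intro tendsto_intros sqrt_omega_real_tendsto) auto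
  then have "\<forall>\<^sub>F \<delta> in at_right 0. (1 + s) / 2 < 1 / sqrt_omega_real \<delta>"
    by (rule order_tendstoD) (use assms in auto)
  moreover have "\<forall>\<^sub>F \<delta>::real in at_right 0. \<delta> \<in> {0<..<1 / 80}"
    by (rule eventually_at_right_real) auto
  ultimately show ?thesis by eventually_elim auto
qed

definition gamma_pair :: "int \<Rightarrow> complex \<Rightarrow> real \<Rightarrow> real \<Rightarrow> complex" where
  "gamma_pair m u \<delta> y = hyp_gamma_pm (omega1 \<delta>) (omega2 \<delta>) (\<i> * of_real (sqrt_omega_real \<delta>) * of_real y)
     ((omega1 \<delta> + omega2 \<delta>) / 2 - \<i> * of_real (sqrt_omega_real \<delta>) * (of_int m + u * of_real \<delta>))"

lemma gamma_pair_minus: "gamma_pair m u \<delta> (- y) = gamma_pair m u \<delta> y"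
  by (simp add: gamma_pair_def hyp_gamma_pm_def mult.commute)

lemma gamma_pair_abs: "gamma_pair m u \<delta> \<bar>y\<bar> = gamma_pair m u \<delta> y"
  by (cases "y \<ge> 0") (simp_all add: gamma_pair_minus)

context
  fixes m :: int and u :: complex and s :: real
  assumes s: "0 < s" "s < 1" and u: "Im u = - s"
begin

lemma gamma_pair_eq_gamma_quot:
  assumes "small_step s \<delta>"
  shows "gamma_pair m u \<delta> y = gamma_quot \<delta> (of_int m + u * of_real \<delta>) y"
proof -
  have "line_qpoch \<delta> (of_int m + u * of_real \<delta>) y \<noteq> 0" "line_qpoch \<delta> (- cnj (of_int m + u * of_real \<delta>)) y \<noteq> 0" for y
  proof -
    have d: "0 < \<delta>" "\<delta> \<le> 1 / 2" "(1 + s) / 2 \<le> 1 / sqrt_omega_real \<delta>" using assms by auto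
    have "Im (of_int m + u * of_real \<delta>) = - (\<delta> * s)" "Im (- cnj (of_int m + u * of_real \<delta>)) = - (\<delta> * s)"
      using u by simp_all
    then show "line_qpoch \<delta> (of_int m + u * of_real \<delta>) y \<noteq> 0" "line_qpoch \<delta> (- cnj (of_int m + u * of_real \<delta>)) y \<noteq> 0"
      using line_qpoch_nonzero[OF d(1,2) s d(3)] by blast+
  qed
  then show ?thesis unfolding gamma_pair_def using assms by (intro hyp_gamma_pm_eq) auto
qed

lemma gamma_pair_continuous:
  assumes "small_step s \<delta>"
  shows "continuous_on UNIV (gamma_pair m u \<delta>)"
proof -
  have nz: "line_qpoch \<delta> (of_int m + u * of_real \<delta>) y \<noteq> 0" "line_qpoch \<delta> (- cnj (of_int m + u * of_real \<delta>)) y \<noteq> 0" for y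
  proof -
    have d: "0 < \<delta>" "\<delta> \<le> 1 / 2" "(1 + s) / 2 \<le> 1 / sqrt_omega_real \<delta>" using assms by auto
    have "Im (of_int m + u * of_real \<delta>) = - (\<delta> * s)" "Im (- cnj (of_int m + u * of_real \<delta>)) = - (\<delta> * s)"
      using u by simp_all
    then show "line_qpoch \<delta> (of_int m + u * of_real \<delta>) y \<noteq> 0" "line_qpoch \<delta> (- cnj (of_int m + u * of_real \<delta>)) y \<noteq> 0"
      using line_qpoch_nonzero[OF d(1,2) s d(3)] by blast+
  qed
  have "(\<lambda>x. qpoch_inf x (exp (- log_nome \<delta>))) holomorphic_on UNIV"
    using norm_nome assms by (intro qpoch_holomorphic) auto
  then have c: "continuous_on UNIV (\<lambda>x. qpoch_inf x (exp (- log_nome \<delta>)))"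
    by (rule holomorphic_on_imp_continuous_on)
  have "continuous_on UNIV (\<lambda>y. line_qpoch \<delta> b y)" for b
    by (rule continuous_on_compose2[OF c]) (auto simp: line_point_def intro!: continuous_intros)
  then have "continuous_on UNIV (\<lambda>y. gamma_quot \<delta> (of_int m + u * of_real \<delta>) y)"
    unfolding gamma_quot_def by (intro continuous_intros) (use nz in auto)
  then show ?thesis using gamma_pair_eq_gamma_quot[OF assms] by simp
qed

lemma gamma_pair_bound:
  "\<exists>C>0. \<forall>\<delta> y. small_step s \<delta> \<longrightarrow>
     norm (gamma_pair m u \<delta> y) \<le> C * exp (- (2 * pi * s * (\<delta> * \<bar>y\<bar>))) * singular_dist \<delta> \<bar>y\<bar> powr (- (2 * (sqrt_omega_real \<delta> * s)))"
proof -
  obtain C1 where C1: "C1 > 0" "\<And>\<delta> y. small_step s \<delta> \<Longrightarrow> 0 \<le> y \<Longrightarrow>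
     norm (line_qpoch \<delta> (of_int m + of_real \<delta> * u + 2 * \<i> * of_real (s * \<delta>)) y / line_qpoch \<delta> (of_int m + of_real \<delta> * u) y)
       \<le> C1 * singular_dist \<delta> y powr (- (sqrt_omega_real \<delta> * s))"
    using quot_bound[OF s u, of m] by blast
  have u': "Im (- cnj u) = - s" using u by simp
  obtain C2 where C2: "C2 > 0" "\<And>\<delta> y. small_step s \<delta> \<Longrightarrow> 0 \<le> y \<Longrightarrow>
     norm (line_qpoch \<delta> (of_int (- m) + of_real \<delta> * (- cnj u) + 2 * \<i> * of_real (s * \<delta>)) y / line_qpoch \<delta> (of_int (- m) + of_real \<delta> * (- cnj u)) y)
       \<le> C2 * singular_dist \<delta> y powr (- (sqrt_omega_real \<delta> * s))"
    using quot_bound[OF s u', of "- m"] by blast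
  have main: "norm (gamma_pair m u \<delta> y) \<le> C1 * C2 * exp (- (2 * pi * s * (\<delta> * y))) * singular_dist \<delta> y powr (- (2 * (sqrt_omega_real \<delta> * s)))"
    if d: "small_step s \<delta>" and y: "y \<ge> 0" for \<delta> y
  proof -
    define a where "a = of_int m + u * of_real \<delta>"
    have uc: "cnj u = u + 2 * \<i> * of_real s" using u by (simp add: complex_eq_iff)
    have e: "of_int m + of_real \<delta> * u = a" "of_int m + of_real \<delta> * u + 2 * \<i> * of_real (s * \<delta>) = cnj a"
      "of_int (- m) + of_real \<delta> * (- cnj u) = - cnj a"
      "of_int (- m) + of_real \<delta> * (- cnj u) + 2 * \<i> * of_real (s * \<delta>) = - a"
      by (simp_all add: a_def uc algebra_simps)
    define V where "V = singular_dist \<delta> y powr (- (sqrt_omega_real \<delta> * s))"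
    have "Re (- (2 * of_real pi * \<i> * of_real y * a)) = - (2 * pi * s * (\<delta> * y))"
      by (simp add: a_def u)
    then have ex: "norm (exp (- (2 * of_real pi * \<i> * of_real y * a))) = exp (- (2 * pi * s * (\<delta> * y)))"
      by (simp only: norm_exp_eq_Re)
    have "norm (gamma_pair m u \<delta> y) = exp (- (2 * pi * s * (\<delta> * y))) *
        (norm (line_qpoch \<delta> (cnj a) y / line_qpoch \<delta> a y) * norm (line_qpoch \<delta> (- a) y / line_qpoch \<delta> (- cnj a) y))"
      unfolding gamma_pair_eq_gamma_quot[OF d] a_def[symmetric] gamma_quot_def norm_mult complex_mod_cnj ex
      by (simp add: norm_divide)
    also have "\<dots> \<le> exp (- (2 * pi * s * (\<delta> * y))) * ((C1 * V) * (C2 * V))"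
      using C1(2)[OF d y] C2(2)[OF d y] C1(1) unfolding e(2,4) unfolding e(1,3) V_def
      by (intro mult_left_mono mult_mono) auto
    also have "V * V = singular_dist \<delta> y powr (- (2 * (sqrt_omega_real \<delta> * s)))"
      by (simp add: V_def mult_ac flip: powr_add)
    then have "exp (- (2 * pi * s * (\<delta> * y))) * ((C1 * V) * (C2 * V)) =
        C1 * C2 * exp (- (2 * pi * s * (\<delta> * y))) * singular_dist \<delta> y powr (- (2 * (sqrt_omega_real \<delta> * s)))"
      by (simp add: mult_ac)
    finally show ?thesis .
  qed
  show ?thesis using main[of _ "\<bar>_\<bar>"] C1(1) C2(1) unfolding gamma_pair_abs
    by (intro exI[of _ "C1 * C2"]) auto
qed

end

section \<open>Powers with two exponents\<close>

lemma bipow_alt: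
  assumes "a - a' = of_int k"
  shows "bipow w a a' = of_real (norm w) powr (a + a') * sgn w powi k"
proof (cases "w = 0")
  case False
  have "exp (\<i> * (a - a') * of_real (Arg w)) = exp (of_int k * (\<i> * of_real (Arg w)))"
    by (simp add: assms mult_ac)
  also have "\<dots> = exp (\<i> * of_real (Arg w)) powi k" by (rule exp_power_int[symmetric])
  also have "exp (\<i> * of_real (Arg w)) = sgn w"
    using False by (metis Arg_eq nonzero_mult_div_cancel_left norm_eq_zero of_real_eq_0_iff sgn_eq)
  finally show ?thesis by (simp add: bipow_def)
qed (simp add: bipow_def)

lemma bipow_mult:
  assumes "a - a' = of_int k"
  shows "bipow (w1 * w2) a a' = bipow w1 a a' * bipow w2 a a'"
proof -
  have "of_real (norm (w1 * w2)) powr (a + a') = of_real (norm w1) powr (a + a') * of_real (norm w2) powr (a + a')"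
    by (simp add: norm_mult powr_times_real)
  then show ?thesis
    unfolding bipow_alt[OF assms] by (simp add: sgn_mult power_int_mult_distrib)
qed

lemma bipow_uminus:
  assumes "a - a' = of_int (2 * k)"
  shows "bipow (- w) a a' = bipow w a a'"
  unfolding bipow_alt[OF assms] by (simp add: sgn_minus power_int_minus_left)

lemma sinh_factor: "2 * sinh z = exp z * (1 - exp (- (2 * z)))" for z :: complex
proof -
  have "exp z * exp (- (2 * z)) = exp (- z)" by (simp flip: exp_add)
  then show ?thesis by (simp add: sinh_def right_diff_distrib scaleR_conv_of_real)
qed

text \<open>For \<open>t > 0\<close> the factor \<open>1 - exp (- 2 * z)\<close> of
  \<open>2 * sinh z\<close> lies in the right half plane. Expressing the power through its principal
  logarithm \<open>l\<close> gives the form in which the limits of the two q-quotients appear, one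
  with \<open>l\<close> and one with \<open>cnj l\<close>.\<close>

lemma bipow_sinh:
  fixes m :: int and u :: complex and t \<beta> :: real
  assumes "t > 0"
  defines "l \<equiv> Ln (1 - exp (- (2 * of_real pi * (of_real t + \<i> * of_real \<beta>))))"
  shows "bipow (2 * sinh (of_real pi * (of_real t + \<i> * of_real \<beta>))) (- of_int m - \<i> * u) (of_int m - \<i> * u) =
    exp (- (2 * of_real pi * \<i> * (of_real \<beta> * of_int m + u * of_real t))) *
    exp (- (of_int m + \<i> * u) * l) * exp ((of_int m - \<i> * u) * cnj l)"
proof -
  define z where "z = complex_of_real pi * (of_real t + \<i> * of_real \<beta>)"
  define w where "w = 2 * sinh z"
  have "norm (exp (- (2 * z))) < 1" using assms by (simp add: z_def)
  then have "exp (- (2 * z)) \<noteq> 1" by (metis less_irrefl norm_one)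
  then have nz: "1 - exp (- (2 * z)) \<noteq> 0" by simp
  then have el: "exp l = 1 - exp (- (2 * z))" by (simp add: l_def z_def mult.assoc)
  have w: "w = exp (z + l)" unfolding w_def sinh_factor exp_add el ..
  have nw: "norm w = exp (pi * t + Re l)" unfolding w norm_exp_eq_Re by (simp add: z_def)
  have p1: "of_real (norm w) powr ((- of_int m - \<i> * u) + (of_int m - \<i> * u)) = exp (- (2 * \<i> * u) * of_real (pi * t + Re l))"
    unfolding nw powr_def by (simp flip: exp_of_real add: Ln_of_real mult.assoc)
  have "sgn w = exp (\<i> * of_real (pi * \<beta> + Im l))"
  proof -
    have "w = of_real (exp (pi * t + Re l)) * exp (\<i> * of_real (pi * \<beta> + Im l))"
      unfolding w exp_of_real[symmetric] exp_add[symmetric]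
      by (rule arg_cong[of _ _ exp]) (simp add: z_def complex_eq_iff algebra_simps)
    then show ?thesis using nw by (simp add: sgn_eq)
  qed
  then have p2: "sgn w powi (- 2 * m) = exp (of_int (- 2 * m) * (\<i> * of_real (pi * \<beta> + Im l)))"
    by (simp only: exp_power_int[symmetric])
  have eq: "(- of_int m - \<i> * u) - (of_int m - \<i> * u) = of_int (- 2 * m)" by simp
  have "bipow w (- of_int m - \<i> * u) (of_int m - \<i> * u) =
      exp (- (2 * \<i> * u) * of_real (pi * t + Re l) + of_int (- 2 * m) * (\<i> * of_real (pi * \<beta> + Im l)))"
    unfolding bipow_alt[OF eq] p1 p2 exp_add ..
  also have "- (2 * \<i> * u) * of_real (pi * t + Re l) + of_int (- 2 * m) * (\<i> * of_real (pi * \<beta> + Im l)) =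
      - (2 * of_real pi * \<i> * (of_real \<beta> * of_int m + u * of_real t)) + - (of_int m + \<i> * u) * l + (of_int m - \<i> * u) * cnj l"
  proof -
    define x y where "x = complex_of_real (Re l)" and "y = complex_of_real (Im l)"
    have l: "l = x + \<i> * y" "cnj l = x - \<i> * y"
      by (simp_all add: complex_eq_iff x_def y_def)
    show ?thesis unfolding of_real_add x_def[symmetric] y_def[symmetric] l(2)
      by (simp only: l(1)) (simp add: algebra_simps)
  qed
  finally show ?thesis unfolding w_def z_def by (simp only: exp_add)
qed

text \<open>By the first limit \<open>1 - 1 / sqrt_omega_real \<delta>\<close> is still negligible
  after multiplication by a coordinate of order \<open>1 / \<delta>\<close>. The second is needed
  because the integer part of a parameter is not small and gets divided by
  \<open>log_nome \<delta>\<close>.\<close>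

lemma omega_dir_tendsto:
  "((\<lambda>\<delta>. (1 - 1 / sqrt_omega_real \<delta>) / \<delta>) \<longlongrightarrow> 0) (at_right 0)"
  "((\<lambda>\<delta>. (omega_dir \<delta> - \<i>) / of_real \<delta>) \<longlongrightarrow> 1) (at_right 0)"
  "(omega_dir \<longlongrightarrow> \<i>) (at_right 0)"
  "(log_nome \<longlongrightarrow> 0) (at_right 0)"
proof -
  have ev: "\<forall>\<^sub>F \<delta>::real in at_right 0. 0 < \<delta>" by (simp add: eventually_at_right_less)
  show 1: "((\<lambda>\<delta>. (1 - 1 / sqrt_omega_real \<delta>) / \<delta>) \<longlongrightarrow> 0) (at_right 0)"
  proof (rule tendsto_sandwich)
    have b: "0 \<le> 1 - 1 / sqrt_omega_real \<delta>" "1 - 1 / sqrt_omega_real \<delta> \<le> \<delta>\<^sup>2 / 2" for \<delta>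
    proof -
      have T: "1 \<le> sqrt_omega_real \<delta>" by (rule sqrt_omega_real_pos)
      then show "0 \<le> 1 - 1 / sqrt_omega_real \<delta>" by simp
      have "1 - 1 / sqrt_omega_real \<delta> = (sqrt_omega_real \<delta> - 1) / sqrt_omega_real \<delta>" using T by (simp add: field_simps)
      also have "\<dots> \<le> (sqrt_omega_real \<delta> - 1) / 1" using T by (intro divide_left_mono) auto
      finally show "1 - 1 / sqrt_omega_real \<delta> \<le> \<delta>\<^sup>2 / 2" using sqrt_omega_real_le(1)[of \<delta>] by simp
    qed
    show "\<forall>\<^sub>F \<delta> in at_right 0. 0 \<le> (1 - 1 / sqrt_omega_real \<delta>) / \<delta>"
      using ev by eventually_elim (use b in auto)
    show "\<forall>\<^sub>F \<delta> in at_right 0. (1 - 1 / sqrt_omega_real \<delta>) / \<delta> \<le> \<delta> / 2"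
      using ev
    proof eventually_elim
      case (elim \<delta>)
      then have "(1 - 1 / sqrt_omega_real \<delta>) / \<delta> \<le> (\<delta>\<^sup>2 / 2) / \<delta>" using b by (intro divide_right_mono) auto
      also have "\<dots> = \<delta> / 2" using elim by (simp add: power2_eq_square)
      finally show ?case .
    qed
    have "((\<lambda>\<delta>::real. \<delta> / 2) \<longlongrightarrow> 0 / 2) (at_right 0)" by (intro tendsto_intros) auto
    then show "((\<lambda>\<delta>::real. \<delta> / 2) \<longlongrightarrow> 0) (at_right 0)" by simp
  qed simp
  have lim: "((\<lambda>\<delta>. of_real (1 / sqrt_omega_real \<delta>) - \<i> * of_real ((1 - 1 / sqrt_omega_real \<delta>) / \<delta>)) \<longlongrightarrow>
      complex_of_real (1 / 1) - \<i> * of_real 0) (at_right 0)"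
    by (intro tendsto_intros sqrt_omega_real_tendsto 1) auto
  show 2: "((\<lambda>\<delta>. (omega_dir \<delta> - \<i>) / of_real \<delta>) \<longlongrightarrow> 1) (at_right 0)"
  proof (rule Lim_transform_eventually)
    show "\<forall>\<^sub>F \<delta> in at_right 0. of_real (1 / sqrt_omega_real \<delta>) - \<i> * of_real ((1 - 1 / sqrt_omega_real \<delta>) / \<delta>) =
        (omega_dir \<delta> - \<i>) / of_real \<delta>"
      using ev
    proof eventually_elim
      case (elim \<delta>)
      define T where "T = sqrt_omega_real \<delta>"
      have th: "omega_dir \<delta> = (of_real \<delta> + \<i>) / of_real T" by (simp add: omega_dir_eq T_def complex_eq_iff)
      have "T \<noteq> 0" using sqrt_omega_real_pos[of \<delta>] by (simp add: T_def)
      then show ?case using elim unfolding T_def[symmetric] th by (simp add: field_simps)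
    qed
  qed (use lim in simp)
  have "((\<lambda>\<delta>. of_real \<delta> * ((omega_dir \<delta> - \<i>) / of_real \<delta>) + \<i>) \<longlongrightarrow> of_real 0 * 1 + \<i>) (at_right 0)"
    by (intro tendsto_intros 2)
  moreover have "\<forall>\<^sub>F \<delta> in at_right 0. of_real \<delta> * ((omega_dir \<delta> - \<i>) / of_real \<delta>) + \<i> = omega_dir \<delta>"
    using ev by eventually_elim auto
  ultimately show 3: "(omega_dir \<longlongrightarrow> \<i>) (at_right 0)" by (simp add: Lim_transform_eventually)
  have "((\<lambda>\<delta>. - (4 * of_real pi * \<i> * of_real \<delta> * omega_dir \<delta> / of_real (sqrt_omega_real \<delta>))) \<longlongrightarrow>
     - (4 * of_real pi * \<i> * of_real 0 * \<i> / of_real 1)) (at_right 0)"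
    by (intro tendsto_intros 3 sqrt_omega_real_tendsto) auto
  then show "(log_nome \<longlongrightarrow> 0) (at_right 0)" by (simp add: log_nome_def[abs_def])
qed

text \<open>Passing from \<open>b\<close> to \<open>- b\<close> multiplies the argument by
  \<open>exp (- (4 * pi * b * omega_dir))\<close>, whose exponent tends to
  \<open>- 4 * pi * \<i> * n\<close> and not to 0. Removing these full turns leaves a multiple of
  \<open>log_nome \<delta>\<close> with ratio \<open>\<sigma> \<delta>\<close> tending to
  \<open>n + \<i> * b1\<close>. As the arguments converge to a point \<open>X\<close> inside the
  unit disc, the error of the expansion vanishes.\<close>

lemma line_qpoch_quot_tendsto:
  fixes n :: int and b1 :: complex and t \<beta> :: real and y :: "real \<Rightarrow> real"
  assumes b1: "Im b1 = - s" and s: "0 < s" "s < 1" and t: "t > 0"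
    and lim: "((\<lambda>\<delta>. \<delta> * y \<delta>) \<longlongrightarrow> t) (at_right 0)"
    and per: "\<And>\<delta>. exp (2 * of_real pi * \<i> * of_real (y \<delta>)) = exp (2 * of_real pi * \<i> * of_real \<beta>)"
  defines "b \<equiv> \<lambda>\<delta>. of_int n + of_real \<delta> * b1"
  defines "l \<equiv> Ln (1 - exp (- (2 * of_real pi * (of_real t + \<i> * of_real \<beta>))))"
  shows "((\<lambda>\<delta>. line_qpoch \<delta> (- b \<delta>) (y \<delta>) / line_qpoch \<delta> (b \<delta>) (y \<delta>)) \<longlongrightarrow> exp (- (of_int n + \<i> * b1) * l)) (at_right 0)"
proof -
  define \<sigma> where "\<sigma> = (\<lambda>\<delta>. 4 * of_real pi * (b \<delta> * omega_dir \<delta> - \<i> * of_int n) / log_nome \<delta>)"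
  define Y where "Y = (\<lambda>\<delta>. line_point \<delta> (b \<delta>) (y \<delta>))"
  define X where "X = exp (- (2 * of_real pi * (of_real t + \<i> * of_real \<beta>)))"
  define \<sigma>0 where "\<sigma>0 = of_int n + \<i> * b1"
  define M where "M = norm \<sigma>0 + 1"
  have ev: "\<forall>\<^sub>F \<delta>::real in at_right 0. small_step s \<delta>" using eventually_small_step s by blast
  have h0: "log_nome \<delta> \<noteq> 0" if "\<delta> > 0" for \<delta>
    using norm_log_nome[OF that] sqrt_omega_real_pos(1)[of \<delta>] that by auto
  have bth: "((\<lambda>\<delta>. b \<delta> * omega_dir \<delta> - \<i> * of_int n) \<longlongrightarrow> 0) (at_right 0)"
  proof -
    have "((\<lambda>\<delta>. b \<delta> * omega_dir \<delta> - \<i> * of_int n) \<longlongrightarrow> (of_int n + of_real 0 * b1) * \<i> - \<i> * of_int n) (at_right 0)"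
      unfolding b_def by (intro tendsto_intros omega_dir_tendsto)
    then show ?thesis by simp
  qed
  have sig: "(\<sigma> \<longlongrightarrow> \<sigma>0) (at_right 0)"
  proof (rule Lim_transform_eventually)
    have "((\<lambda>\<delta>. of_real (sqrt_omega_real \<delta>) * \<i> * (of_int n * ((omega_dir \<delta> - \<i>) / of_real \<delta>) + b1 * omega_dir \<delta>) / omega_dir \<delta>)
        \<longlongrightarrow> of_real 1 * \<i> * (of_int n * 1 + b1 * \<i>) / \<i>) (at_right 0)"
      by (intro tendsto_intros omega_dir_tendsto sqrt_omega_real_tendsto) auto
    then show "((\<lambda>\<delta>. of_real (sqrt_omega_real \<delta>) * \<i> * (of_int n * ((omega_dir \<delta> - \<i>) / of_real \<delta>) + b1 * omega_dir \<delta>) / omega_dir \<delta>)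
        \<longlongrightarrow> \<sigma>0) (at_right 0)"
      by (simp add: \<sigma>0_def mult_ac add_ac)
    show "\<forall>\<^sub>F \<delta> in at_right 0. of_real (sqrt_omega_real \<delta>) * \<i> * (of_int n * ((omega_dir \<delta> - \<i>) / of_real \<delta>) + b1 * omega_dir \<delta>) / omega_dir \<delta> = \<sigma> \<delta>"
      using ev
    proof eventually_elim
      case (elim \<delta>)
      define T where "T = complex_of_real (sqrt_omega_real \<delta>)"
      have nz: "T \<noteq> 0" "omega_dir \<delta> \<noteq> 0" "complex_of_real \<delta> \<noteq> 0" "complex_of_real pi \<noteq> 0"
        using elim sqrt_omega_real_pos(1)[of \<delta>] norm_omega_dir[of \<delta>] by (auto simp: T_def)
      have num: "b \<delta> * omega_dir \<delta> - \<i> * of_int n = of_real \<delta> * (of_int n * ((omega_dir \<delta> - \<i>) / of_real \<delta>) + b1 * omega_dir \<delta>)"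
      proof -
        define k where "k = (omega_dir \<delta> - \<i>) / of_real \<delta>"
        have k: "omega_dir \<delta> - \<i> = of_real \<delta> * k" using nz by (simp add: k_def)
        have "b \<delta> * omega_dir \<delta> - \<i> * of_int n = of_int n * (omega_dir \<delta> - \<i>) + of_real \<delta> * (b1 * omega_dir \<delta>)"
          by (simp add: b_def algebra_simps)
        also have "\<dots> = of_real \<delta> * (of_int n * k + b1 * omega_dir \<delta>)" unfolding k by (simp add: algebra_simps)
        finally show ?thesis by (simp add: k_def)
      qed
      have "\<sigma> \<delta> = 4 * of_real pi * (of_real \<delta> * (of_int n * ((omega_dir \<delta> - \<i>) / of_real \<delta>) + b1 * omega_dir \<delta>)) /
          (- (4 * of_real pi * \<i> * of_real \<delta> * omega_dir \<delta> / T))"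
        unfolding \<sigma>_def num by (simp add: log_nome_def T_def)
      also have "\<dots> = T * \<i> * (of_int n * ((omega_dir \<delta> - \<i>) / of_real \<delta>) + b1 * omega_dir \<delta>) / omega_dir \<delta>"
        (is "4 * of_real pi * (of_real \<delta> * ?w) / _ = _")
        using nz by (simp add: divide_simps)
      finally show ?case by (simp add: T_def)
    qed
  qed
  have shift: "line_point \<delta> (- b \<delta>) (y \<delta>) = Y \<delta> * exp (- (log_nome \<delta> * \<sigma> \<delta>))" if "\<delta> > 0" for \<delta>
  proof -
    have e1: "exp (4 * of_real pi * (\<i> * of_int n)) = 1"
      using exp_integer_2pi[of "of_int (2 * n)"] by (simp add: mult_ac)
    have "log_nome \<delta> * \<sigma> \<delta> = 4 * of_real pi * (b \<delta> * omega_dir \<delta> - \<i> * of_int n)"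
      using h0[OF that] by (simp add: \<sigma>_def)
    then have "Y \<delta> * exp (- (log_nome \<delta> * \<sigma> \<delta>)) =
       exp (- log_nome \<delta> / 2 - 2 * of_real pi * of_real (y \<delta>) * omega_dir \<delta> + 2 * of_real pi * (- b \<delta>) * omega_dir \<delta>
         + 4 * of_real pi * (\<i> * of_int n))"
      unfolding Y_def line_point_def exp_add[symmetric] by (intro arg_cong[of _ _ exp]) (simp add: algebra_simps)
    also have "\<dots> = line_point \<delta> (- b \<delta>) (y \<delta>) * exp (4 * of_real pi * (\<i> * of_int n))"
      unfolding line_point_def by (simp only: exp_add)
    finally show ?thesis using e1 by simp
  qed
  have Ylim: "(Y \<longlongrightarrow> X) (at_right 0)"
  proof -
    \<comment> \<open>\<open>y \<delta>\<close> itself may diverge. The exponent is regrouped into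
      terms that converge: \<open>\<delta> * y \<delta>\<close>, the phase error caused by
      \<open>sqrt_omega_real\<close>, and the phase of \<open>y \<delta>\<close>, which
      \<open>per\<close> keeps fixed.\<close>
    have Yeq: "Y \<delta> = exp (- log_nome \<delta> / 2) * exp (2 * of_real pi * (b \<delta> * omega_dir \<delta> - \<i> * of_int n)) *
        exp (- (2 * of_real pi * of_real (\<delta> * y \<delta>) / of_real (sqrt_omega_real \<delta>))) *
        exp (2 * of_real pi * \<i> * of_real (\<delta> * y \<delta> * ((1 - 1 / sqrt_omega_real \<delta>) / \<delta>))) *
        exp (- (2 * of_real pi * \<i> * of_real \<beta>))" if "\<delta> > 0" for \<delta>
    proof -
      define T where "T = sqrt_omega_real \<delta>"
      have T: "complex_of_real T \<noteq> 0" using sqrt_omega_real_pos(1)[of \<delta>] by (simp add: T_def)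
      have e1: "exp (2 * of_real pi * (\<i> * of_int n)) = 1"
        using exp_integer_2pi[of "of_int n"] by (simp add: mult_ac)
      have th: "omega_dir \<delta> = of_real \<delta> / of_real T + \<i> / of_real T" by (simp add: omega_dir_eq T_def complex_eq_iff)
      have "exp (- log_nome \<delta> / 2) * exp (2 * of_real pi * (b \<delta> * omega_dir \<delta> - \<i> * of_int n)) *
        exp (- (2 * of_real pi * of_real (\<delta> * y \<delta>) / of_real (sqrt_omega_real \<delta>))) *
        exp (2 * of_real pi * \<i> * of_real (\<delta> * y \<delta> * ((1 - 1 / sqrt_omega_real \<delta>) / \<delta>))) *
        exp (- (2 * of_real pi * \<i> * of_real \<beta>)) =
        exp (- log_nome \<delta> / 2) * exp (2 * of_real pi * (b \<delta> * omega_dir \<delta> - \<i> * of_int n)) *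
        exp (- (2 * of_real pi * of_real (\<delta> * y \<delta>) / of_real (sqrt_omega_real \<delta>))) *
        exp (2 * of_real pi * \<i> * of_real (\<delta> * y \<delta> * ((1 - 1 / sqrt_omega_real \<delta>) / \<delta>))) *
        exp (- (2 * of_real pi * \<i> * of_real (y \<delta>))) * exp (2 * of_real pi * (\<i> * of_int n))"
        unfolding e1 using per[of \<delta>] by (simp add: exp_minus)
      also have "\<dots> = Y \<delta>"
        unfolding exp_add[symmetric] Y_def line_point_def
      proof (rule arg_cong[of _ _ exp])
        have "of_real (\<delta> * y \<delta> * ((1 - 1 / sqrt_omega_real \<delta>) / \<delta>)) = complex_of_real (y \<delta>) - of_real (y \<delta>) / of_real T"
          using that by (simp add: T_def field_simps)
        moreover have "of_real (y \<delta>) * omega_dir \<delta> = of_real (\<delta> * y \<delta>) / of_real T + \<i> * (of_real (y \<delta>) / of_real T)"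
          unfolding th by (simp add: algebra_simps)
        ultimately show "- log_nome \<delta> / 2 + 2 * of_real pi * (b \<delta> * omega_dir \<delta> - \<i> * of_int n) +
          - (2 * of_real pi * of_real (\<delta> * y \<delta>) / of_real (sqrt_omega_real \<delta>)) +
          2 * of_real pi * \<i> * of_real (\<delta> * y \<delta> * ((1 - 1 / sqrt_omega_real \<delta>) / \<delta>)) +
          - (2 * of_real pi * \<i> * of_real (y \<delta>)) + 2 * of_real pi * (\<i> * of_int n) =
          - log_nome \<delta> / 2 - 2 * of_real pi * of_real (y \<delta>) * omega_dir \<delta> + 2 * of_real pi * b \<delta> * omega_dir \<delta>"
          unfolding T_def[symmetric] by (simp only: mult.assoc) (simp add: algebra_simps)
      qed
      finally show ?thesis by simp
    qed
    have "((\<lambda>\<delta>. exp (- log_nome \<delta> / 2) * exp (2 * of_real pi * (b \<delta> * omega_dir \<delta> - \<i> * of_int n)) *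
        exp (- (2 * of_real pi * of_real (\<delta> * y \<delta>) / of_real (sqrt_omega_real \<delta>))) *
        exp (2 * of_real pi * \<i> * of_real (\<delta> * y \<delta> * ((1 - 1 / sqrt_omega_real \<delta>) / \<delta>))) *
        exp (- (2 * of_real pi * \<i> * of_real \<beta>))) \<longlongrightarrow>
        exp (- 0 / 2) * exp (2 * of_real pi * 0) * exp (- (2 * of_real pi * of_real t / of_real 1)) *
        exp (2 * of_real pi * \<i> * of_real (t * 0)) * exp (- (2 * of_real pi * \<i> * of_real \<beta>))) (at_right 0)"
      by (intro tendsto_intros bth omega_dir_tendsto sqrt_omega_real_tendsto lim) auto
    also have "exp (- 0 / 2) * exp (2 * of_real pi * 0) * exp (- (2 * of_real pi * of_real t / of_real 1)) *
        exp (2 * of_real pi * \<i> * of_real (t * 0)) * exp (- (2 * of_real pi * \<i> * of_real \<beta>)) = X"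
      by (simp add: X_def algebra_simps flip: exp_add)
    finally show ?thesis
      by (rule Lim_transform_eventually) (use ev Yeq in \<open>auto elim!: eventually_mono\<close>)
  qed
  define \<rho> where "\<rho> = (1 + norm X) / 2"
  have X1: "norm X < 1" using t by (simp add: X_def)
  then have \<rho>: "norm X < \<rho>" "\<rho> < 1" by (auto simp: \<rho>_def)
  have hn: "((\<lambda>\<delta>. norm (log_nome \<delta>)) \<longlongrightarrow> 0) (at_right 0)"
    using tendsto_norm[OF omega_dir_tendsto(4)] by simp
  have ev1: "\<forall>\<^sub>F \<delta> in at_right 0. norm (Y \<delta>) < \<rho>"
    using order_tendstoD(2)[OF tendsto_norm[OF Ylim] \<rho>(1)] .
  have ev2: "\<forall>\<^sub>F \<delta> in at_right 0. \<rho> < exp (- (ratio_threshold M * Re (log_nome \<delta>)))"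
  proof -
    have "((\<lambda>\<delta>. exp (- (ratio_threshold M * Re (log_nome \<delta>)))) \<longlongrightarrow> exp (- (ratio_threshold M * Re 0))) (at_right 0)"
      by (intro tendsto_intros omega_dir_tendsto)
    then show ?thesis using \<rho> by (intro order_tendstoD) auto
  qed
  have ev3: "\<forall>\<^sub>F \<delta> in at_right 0. norm (log_nome \<delta>) < 1 / 6" using order_tendstoD(2)[OF hn, of "1 / 6"] by simp
  have ev4: "\<forall>\<^sub>F \<delta> in at_right 0. norm (\<sigma> \<delta>) < M"
    using order_tendstoD(2)[OF tendsto_norm[OF sig]] by (simp add: M_def)
  define Q where "Q = (\<lambda>\<delta>. line_qpoch \<delta> (- b \<delta>) (y \<delta>) / line_qpoch \<delta> (b \<delta>) (y \<delta>))"
  define c where "c = 4 * ratio_const3 M / (1 - \<rho>)\<^sup>2"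
  have "\<forall>\<^sub>F \<delta> in at_right 0. \<exists>E. Q \<delta> = exp (E - \<sigma> \<delta> * Ln (1 - Y \<delta>)) \<and> norm E \<le> c * norm (log_nome \<delta>)"
    using ev ev1 ev2 ev3 ev4
  proof eventually_elim
    case (elim \<delta>)
    have \<delta>: "0 < \<delta>" "\<delta> \<le> 1 / 80" using elim by auto
    have R: "0 < Re (log_nome \<delta>)" "norm (log_nome \<delta>) \<le> 2 * Re (log_nome \<delta>)"
    proof -
      show "0 < Re (log_nome \<delta>)" using \<delta> by (simp add: Re_log_nome add_pos_nonneg)
      have T: "sqrt_omega_real \<delta> \<le> 2" "0 < sqrt_omega_real \<delta>" using sqrt_omega_real_le(2)[of \<delta>] sqrt_omega_real_pos(1)[of \<delta>] \<delta> by auto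
      have "4 * pi * \<delta> / sqrt_omega_real \<delta> = (4 * pi * \<delta> / (sqrt_omega_real \<delta>)\<^sup>2) * sqrt_omega_real \<delta>" using T by (simp add: power2_eq_square)
      also have "\<dots> \<le> (4 * pi * \<delta> / (sqrt_omega_real \<delta>)\<^sup>2) * 2" using T \<delta> by (intro mult_left_mono) auto
      finally show "norm (log_nome \<delta>) \<le> 2 * Re (log_nome \<delta>)"
        unfolding norm_log_nome[OF \<delta>(1)] Re_log_nome sqrt_omega_real_sq by simp
    qed
    have nz: "line_qpoch \<delta> (b \<delta>) (y \<delta>) \<noteq> 0"
      using elim s b1 by (intro line_qpoch_nonzero[where s = s]) (auto simp: b_def)
    have "norm (Y \<delta>) \<le> exp (- (ratio_threshold M * Re (log_nome \<delta>)))" using elim by linarith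
    then obtain E where E: "qpoch_inf (Y \<delta> * exp (- (log_nome \<delta> * \<sigma> \<delta>))) (exp (- log_nome \<delta>)) =
        exp (E - \<sigma> \<delta> * Ln (1 - Y \<delta>)) * qpoch_inf (Y \<delta>) (exp (- log_nome \<delta>))"
      "\<forall>\<rho><1. norm (Y \<delta>) \<le> \<rho> \<longrightarrow> norm E \<le> 4 * ratio_const3 M * norm (log_nome \<delta>) / (1 - \<rho>)\<^sup>2"
      using qpoch_quotient_expansion[of "log_nome \<delta>" "\<sigma> \<delta>" M "Y \<delta>"] R elim by auto
    have "norm E \<le> c * norm (log_nome \<delta>)" using E(2) \<rho> elim by (auto simp: c_def)
    moreover have "Q \<delta> = exp (E - \<sigma> \<delta> * Ln (1 - Y \<delta>))"
      unfolding Q_def shift[OF \<delta>(1)] E(1) using nz by (simp add: Y_def)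
    ultimately show ?case by blast
  qed
  then have "\<exists>E. \<forall>\<^sub>F \<delta> in at_right 0. Q \<delta> = exp (E \<delta> - \<sigma> \<delta> * Ln (1 - Y \<delta>)) \<and> norm (E \<delta>) \<le> c * norm (log_nome \<delta>)"
    by (intro exI[of _ "\<lambda>\<delta>. SOME E. Q \<delta> = exp (E - \<sigma> \<delta> * Ln (1 - Y \<delta>)) \<and> norm E \<le> c * norm (log_nome \<delta>)"])
       (auto elim!: eventually_mono intro: someI2_ex)
  then obtain E where E: "\<forall>\<^sub>F \<delta> in at_right 0. Q \<delta> = exp (E \<delta> - \<sigma> \<delta> * Ln (1 - Y \<delta>)) \<and> norm (E \<delta>) \<le> c * norm (log_nome \<delta>)"
    by blast
  have E0: "(E \<longlongrightarrow> 0) (at_right 0)"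
  proof (rule Lim_null_comparison)
    show "\<forall>\<^sub>F \<delta> in at_right 0. norm (E \<delta>) \<le> c * norm (log_nome \<delta>)" using E by (auto elim!: eventually_mono)
    show "((\<lambda>\<delta>. c * norm (log_nome \<delta>)) \<longlongrightarrow> 0) (at_right 0)" using tendsto_mult_right_zero[OF hn] .
  qed
  have "Re X < 1" using X1 complex_Re_le_cmod[of X] by linarith
  then have "1 - X \<notin> \<real>\<^sub>\<le>\<^sub>0" by (auto simp: complex_nonpos_Reals_iff)
  then have "((\<lambda>\<delta>. exp (E \<delta> - \<sigma> \<delta> * Ln (1 - Y \<delta>))) \<longlongrightarrow> exp (0 - \<sigma>0 * Ln (1 - X))) (at_right 0)"
    by (intro tendsto_intros E0 sig Ylim)
  moreover have "exp (0 - \<sigma>0 * Ln (1 - X)) = exp (- (of_int n + \<i> * b1) * l)"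
    unfolding \<sigma>0_def l_def X_def by (simp only: diff_0 mult_minus_left)
  ultimately have "((\<lambda>\<delta>. exp (E \<delta> - \<sigma> \<delta> * Ln (1 - Y \<delta>))) \<longlongrightarrow> exp (- (of_int n + \<i> * b1) * l)) (at_right 0)" by simp
  then show ?thesis unfolding Q_def[symmetric]
    by (rule Lim_transform_eventually) (use E in \<open>auto elim!: eventually_mono\<close>)
qed

text \<open>The second quotient is the first one for the parameters \<open>- m\<close> and
  \<open>- cnj u\<close>, the latter having the same imaginary part as \<open>u\<close>. Conjugating
  its limit replaces \<open>l\<close> by \<open>cnj l\<close> and produces the exponent of the
  conjugate power.\<close>

lemma gamma_pair_tendsto_pos:
  fixes m :: int and u :: complex and t \<beta> :: real and y :: "real \<Rightarrow> real"
  assumes u: "Im u = - s" and s: "0 < s" "s < 1" and t: "t > 0"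
    and lim: "((\<lambda>\<delta>. \<delta> * y \<delta>) \<longlongrightarrow> t) (at_right 0)"
    and per: "\<And>\<delta>. exp (2 * of_real pi * \<i> * of_real (y \<delta>)) = exp (2 * of_real pi * \<i> * of_real \<beta>)"
  shows "((\<lambda>\<delta>. gamma_pair m u \<delta> (y \<delta>)) \<longlongrightarrow>
    bipow (2 * sinh (of_real pi * (of_real t + \<i> * of_real \<beta>))) (- of_int m - \<i> * u) (of_int m - \<i> * u)) (at_right 0)"
proof -
  define a where "a = (\<lambda>\<delta>. of_int m + of_real \<delta> * u)"
  define l where "l = Ln (1 - exp (- (2 * of_real pi * (of_real t + \<i> * of_real \<beta>))))"
  have u': "Im (- cnj u) = - s" using u by simp
  have l1: "((\<lambda>\<delta>. line_qpoch \<delta> (- a \<delta>) (y \<delta>) / line_qpoch \<delta> (a \<delta>) (y \<delta>)) \<longlongrightarrow> exp (- (of_int m + \<i> * u) * l)) (at_right 0)"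
    unfolding a_def l_def by (rule line_qpoch_quot_tendsto[OF u s t lim per])
  have "((\<lambda>\<delta>. line_qpoch \<delta> (- (of_int (- m) + of_real \<delta> * (- cnj u))) (y \<delta>) / line_qpoch \<delta> (of_int (- m) + of_real \<delta> * (- cnj u)) (y \<delta>))
      \<longlongrightarrow> exp (- (of_int (- m) + \<i> * (- cnj u)) * l)) (at_right 0)"
    unfolding l_def by (rule line_qpoch_quot_tendsto[OF u' s t lim per])
  moreover have "- (of_int (- m) + of_real \<delta> * (- cnj u)) = cnj (a \<delta>)" "of_int (- m) + of_real \<delta> * (- cnj u) = - cnj (a \<delta>)" for \<delta>
    by (simp_all add: a_def)
  ultimately have l2: "((\<lambda>\<delta>. line_qpoch \<delta> (cnj (a \<delta>)) (y \<delta>) / line_qpoch \<delta> (- cnj (a \<delta>)) (y \<delta>)) \<longlongrightarrow>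
      exp (- (of_int (- m) + \<i> * (- cnj u)) * l)) (at_right 0)" by simp
  have e: "exp (- (2 * of_real pi * \<i> * of_real (y \<delta>) * a \<delta>)) =
      exp (- (2 * of_real pi * \<i> * (of_real \<beta> * of_int m))) * exp (- (2 * of_real pi * \<i> * (u * of_real (\<delta> * y \<delta>))))" for \<delta>
  proof -
    have "exp (of_int (- m) * (2 * of_real pi * \<i> * of_real (y \<delta>))) = exp (of_int (- m) * (2 * of_real pi * \<i> * of_real \<beta>))"
      unfolding exp_power_int[symmetric] per ..
    then have "exp (- (2 * of_real pi * \<i> * (of_real \<beta> * of_int m))) = exp (- (2 * of_real pi * \<i> * (of_real (y \<delta>) * of_int m)))"
      by (simp add: mult_ac)
    then show ?thesis by (simp add: a_def algebra_simps flip: exp_add)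
  qed
  have "((\<lambda>\<delta>. gamma_quot \<delta> (a \<delta>) (y \<delta>)) \<longlongrightarrow>
     exp (- (2 * of_real pi * \<i> * (of_real \<beta> * of_int m))) * exp (- (2 * of_real pi * \<i> * (u * of_real t))) *
     exp (- (of_int m + \<i> * u) * l) * cnj (exp (- (of_int (- m) + \<i> * (- cnj u)) * l))) (at_right 0)"
    unfolding gamma_quot_def e by (intro tendsto_intros l1 l2 lim)
  also have "exp (- (2 * of_real pi * \<i> * (of_real \<beta> * of_int m))) * exp (- (2 * of_real pi * \<i> * (u * of_real t))) *
     exp (- (of_int m + \<i> * u) * l) * cnj (exp (- (of_int (- m) + \<i> * (- cnj u)) * l)) =
     bipow (2 * sinh (of_real pi * (of_real t + \<i> * of_real \<beta>))) (- of_int m - \<i> * u) (of_int m - \<i> * u)"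
    unfolding bipow_sinh[OF t] l_def[symmetric] by (simp add: exp_cnj algebra_simps flip: exp_add)
  finally show ?thesis
  proof (rule Lim_transform_eventually)
    show "\<forall>\<^sub>F \<delta> in at_right 0. gamma_quot \<delta> (a \<delta>) (y \<delta>) = gamma_pair m u \<delta> (y \<delta>)"
      using eventually_small_step[OF s(2)]
      by eventually_elim (simp add: gamma_pair_eq_gamma_quot[OF s u] a_def mult.commute)
  qed
qed

text \<open>For \<open>t < 0\<close> evenness of the pair leads to \<open>- t\<close>. The
  hyperbolic sine then changes its sign, which the power ignores because its exponents differ by the
  even integer \<open>- 2 * m\<close>.\<close>

lemma gamma_pair_tendsto:
  fixes m :: int and u :: complex and t \<beta> :: real and y :: "real \<Rightarrow> real"
  assumes u: "Im u = - s" and s: "0 < s" "s < 1" and t: "t \<noteq> 0"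
    and lim: "((\<lambda>\<delta>. \<delta> * y \<delta>) \<longlongrightarrow> t) (at_right 0)"
    and per: "\<And>\<delta>. exp (2 * of_real pi * \<i> * of_real (y \<delta>)) = exp (2 * of_real pi * \<i> * of_real \<beta>)"
  shows "((\<lambda>\<delta>. gamma_pair m u \<delta> (y \<delta>)) \<longlongrightarrow>
    bipow (2 * sinh (of_real pi * (of_real t + \<i> * of_real \<beta>))) (- of_int m - \<i> * u) (of_int m - \<i> * u)) (at_right 0)"
proof (cases "t > 0")
  case True
  show ?thesis by (rule gamma_pair_tendsto_pos[OF u s True lim per])
next
  case False
  have lim': "((\<lambda>\<delta>. \<delta> * (- y \<delta>)) \<longlongrightarrow> - t) (at_right 0)" using tendsto_minus[OF lim] by simp
  have per': "exp (2 * of_real pi * \<i> * of_real (- y \<delta>)) = exp (2 * of_real pi * \<i> * of_real (- \<beta>))" for \<delta>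
    using per[of \<delta>] by (simp add: exp_minus)
  have "- t > 0" using t False by simp
  from gamma_pair_tendsto_pos[OF u s this lim' per', of m]
  have "((\<lambda>\<delta>. gamma_pair m u \<delta> (y \<delta>)) \<longlongrightarrow> bipow (2 * sinh (of_real pi * (of_real (- t) + \<i> * of_real (- \<beta>))))
     (- of_int m - \<i> * u) (of_int m - \<i> * u)) (at_right 0)"
    by (simp only: gamma_pair_minus)
  also have "2 * sinh (of_real pi * (of_real (- t) + \<i> * of_real (- \<beta>))) = - (2 * sinh (of_real pi * (of_real t + \<i> * complex_of_real \<beta>)))"
    using sinh_minus[of "of_real pi * (of_real t + \<i> * complex_of_real \<beta>)"] by (simp add: algebra_simps)
  also have "bipow (- (2 * sinh (of_real pi * (of_real t + \<i> * complex_of_real \<beta>)))) (- of_int m - \<i> * u) (of_int m - \<i> * u) =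
      bipow (2 * sinh (of_real pi * (of_real t + \<i> * of_real \<beta>))) (- of_int m - \<i> * u) (of_int m - \<i> * u)"
    by (rule bipow_uminus[of _ _ "- m"]) simp
  finally show ?thesis .
qed

section \<open>Integrals over lattice cells and dominating functions\<close>

text \<open>Substituting \<open>b = y - n(a)\<close> in the inner integral and exchanging the integrals reduces the
  claim to the fact that \<open>n(a)\<close> is the integer next to \<open>y\<close> on an interval of length \<open>\<delta>\<close>.\<close>

lemma nn_integral_round_shift:
  fixes f :: "real \<Rightarrow> ennreal" and \<delta> :: real
  assumes f[measurable]: "f \<in> borel_measurable borel" and \<delta>: "0 < \<delta>"
  shows "(\<integral>\<^sup>+ p. indicator (UNIV \<times> {-1/2..1/2}) p * f (of_int \<lfloor>fst p / \<delta> + 1 / 2\<rfloor> + snd p) \<partial>(lborel \<Otimes>\<^sub>M lborel))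
    = ennreal \<delta> * (\<integral>\<^sup>+ y. f y \<partial>lborel)"
proof -
  define r where "r = (\<lambda>a. real_of_int \<lfloor>a / \<delta> + 1 / 2\<rfloor>)"
  have [measurable]: "r \<in> borel_measurable borel" unfolding r_def by measurable
  define B where "B = {-1/2..1/2::real}"
  have [measurable]: "B \<in> sets borel" by (simp add: B_def)
  have inner: "(\<integral>\<^sup>+ b. indicator B b * f (r a + b) \<partial>lborel) = (\<integral>\<^sup>+ y. indicator B (y - r a) * f y \<partial>lborel)" for a
    by (subst nn_integral_real_affine[of "\<lambda>y. indicator B (y - r a) * f y" 1 "r a"]) (auto simp: add.commute)
  \<comment> \<open>The closed cell contains both of its endpoints, so a point with
    \<open>y + 1 / 2\<close> an integer belongs to two cells. Such points form a null set.\<close>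
  have slice: "(\<integral>\<^sup>+ a. indicator B (y - r a) \<partial>lborel) = ennreal \<delta>" if y: "y + 1 / 2 \<notin> \<int>" for y
  proof -
    define n where "n = \<lfloor>y + 1 / 2\<rfloor>"
    have "indicator B (y - r a) = (indicator {\<delta> * (of_int n - 1 / 2)..<\<delta> * (of_int n + 1 / 2)} a :: ennreal)" for a
    proof -
      have "y - r a \<in> B \<longleftrightarrow> \<lfloor>a / \<delta> + 1 / 2\<rfloor> = n"
      proof
        assume "y - r a \<in> B"
        then have "of_int \<lfloor>a / \<delta> + 1 / 2\<rfloor> \<le> y + 1 / 2" "y + 1 / 2 \<le> of_int \<lfloor>a / \<delta> + 1 / 2\<rfloor> + 1"
          by (auto simp: B_def r_def)
        moreover have "y + 1 / 2 \<noteq> of_int (\<lfloor>a / \<delta> + 1 / 2\<rfloor> + 1)" using y by (metis Ints_of_int)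
        ultimately show "\<lfloor>a / \<delta> + 1 / 2\<rfloor> = n" unfolding n_def by (intro floor_unique[symmetric]) auto
      next
        assume "\<lfloor>a / \<delta> + 1 / 2\<rfloor> = n"
        then show "y - r a \<in> B" unfolding B_def r_def n_def by simp linarith
      qed
      also have "\<dots> \<longleftrightarrow> of_int n \<le> a / \<delta> + 1 / 2 \<and> a / \<delta> + 1 / 2 < of_int n + 1"
        by (simp add: floor_eq_iff)
      also have "\<dots> \<longleftrightarrow> of_int n - 1 / 2 \<le> a / \<delta> \<and> a / \<delta> < of_int n + 1 / 2" by auto
      also have "\<dots> \<longleftrightarrow> a \<in> {\<delta> * (of_int n - 1 / 2)..<\<delta> * (of_int n + 1 / 2)}"
        using \<delta> by (simp add: le_divide_eq divide_less_eq mult.commute)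
      finally show ?thesis by (simp add: indicator_def)
    qed
    then have "(\<integral>\<^sup>+ a. indicator B (y - r a) \<partial>lborel) = emeasure lborel {\<delta> * (of_int n - 1 / 2)..<\<delta> * (of_int n + 1 / 2)}"
      by simp
    also have "\<dots> = ennreal \<delta>" using \<delta> by (simp add: algebra_simps)
    finally show ?thesis .
  qed
  have "AE y in lborel. y + 1 / 2 \<notin> (\<int> :: real set)"
  proof -
    have "{y. y + 1 / 2 \<in> (\<int> :: real set)} = (\<lambda>n. n - 1 / 2) ` \<int>" by (force simp: image_iff)
    then have "countable {y. y + 1 / 2 \<in> (\<int> :: real set)}" by (simp add: countable_int)
    then have "{y. y + 1 / 2 \<in> (\<int> :: real set)} \<in> null_sets lborel" by (rule countable_imp_null_set_lborel)
    from AE_not_in[OF this] show ?thesis by simp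
  qed
  then have sl: "AE y in lborel. (\<integral>\<^sup>+ a. indicator B (y - r a) * f y \<partial>lborel) = ennreal \<delta> * f y"
    by eventually_elim (simp add: nn_integral_multc slice)
  have "(\<integral>\<^sup>+ p. indicator (UNIV \<times> B) p * f (r (fst p) + snd p) \<partial>(lborel \<Otimes>\<^sub>M lborel)) =
     (\<integral>\<^sup>+ a. \<integral>\<^sup>+ b. indicator (UNIV \<times> B) (a, b) * f (r (fst (a, b)) + snd (a, b)) \<partial>lborel \<partial>lborel)"
    by (intro lborel.nn_integral_fst[symmetric]) measurable
  also have "\<dots> = (\<integral>\<^sup>+ a. \<integral>\<^sup>+ b. indicator B b * f (r a + b) \<partial>lborel \<partial>lborel)"
    by (simp add: indicator_def)
  also have "\<dots> = (\<integral>\<^sup>+ a. \<integral>\<^sup>+ y. indicator B (y - r a) * f y \<partial>lborel \<partial>lborel)"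
    by (simp only: inner)
  also have "\<dots> = (\<integral>\<^sup>+ y. \<integral>\<^sup>+ a. indicator B (y - r a) * f y \<partial>lborel \<partial>lborel)"
    by (rule lborel_pair.Fubini') measurable
  also have "\<dots> = (\<integral>\<^sup>+ y. ennreal \<delta> * f y \<partial>lborel)" by (rule nn_integral_cong_AE[OF sl])
  also have "\<dots> = ennreal \<delta> * (\<integral>\<^sup>+ y. f y \<partial>lborel)" by (rule nn_integral_cmult) simp
  finally show ?thesis unfolding B_def r_def .
qed

text \<open>As an equality of measures the statement transfers both integrability and the Bochner
  integral of complex functions by change of variables.\<close>

lemma distr_round_shift:
  assumes \<delta>: "0 < \<delta>"
  shows "distr (density (lborel \<Otimes>\<^sub>M lborel) (indicator (UNIV \<times> {-1/2..1/2::real}))) lborel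
      (\<lambda>p. real_of_int \<lfloor>fst p / \<delta> + 1 / 2\<rfloor> + snd p) = density lborel (\<lambda>_. ennreal \<delta>)"
    (is "distr (density ?P ?I) lborel ?\<Phi> = _")
proof (rule measure_eqI)
  fix A assume "A \<in> sets (distr (density ?P ?I) lborel ?\<Phi>)"
  then have A[measurable]: "A \<in> sets borel" by simp
  have [measurable]: "?\<Phi> \<in> measurable ?P borel" by measurable
  have [measurable]: "UNIV \<times> {-1/2..1/2::real} \<in> sets ?P" by (simp add: pair_measureI)
  have "emeasure (distr (density ?P ?I) lborel ?\<Phi>) A = (\<integral>\<^sup>+ y. indicator A y \<partial>distr (density ?P ?I) lborel ?\<Phi>)"
    by simp
  also have "\<dots> = (\<integral>\<^sup>+ p. ?I p * indicator A (?\<Phi> p) \<partial>?P)"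
    by (subst nn_integral_distr) (simp_all add: nn_integral_density)
  also have "\<dots> = ennreal \<delta> * (\<integral>\<^sup>+ y. indicator A y \<partial>lborel)"
    by (rule nn_integral_round_shift[OF _ \<delta>]) simp
  also have "\<dots> = emeasure (density lborel (\<lambda>_. ennreal \<delta>)) A"
    by (simp add: emeasure_density nn_integral_cmult)
  finally show "emeasure (distr (density ?P ?I) lborel ?\<Phi>) A = emeasure (density lborel (\<lambda>_. ennreal \<delta>)) A" .
qed simp

lemma integral_round_shift:
  fixes f :: "real \<Rightarrow> complex"
  assumes f[measurable]: "f \<in> borel_measurable borel" and \<delta>: "0 < \<delta>"
  defines "g \<equiv> \<lambda>p. indicator (UNIV \<times> {-1/2..1/2}) p *\<^sub>R f (of_int \<lfloor>fst p / \<delta> + 1 / 2\<rfloor> + snd p)"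
  shows "integrable (lborel \<Otimes>\<^sub>M lborel) g \<longleftrightarrow> integrable lborel f"
    and "integral\<^sup>L (lborel \<Otimes>\<^sub>M lborel) g = of_real \<delta> * integral\<^sup>L lborel f"
proof -
  let ?P = "lborel \<Otimes>\<^sub>M lborel :: (real \<times> real) measure"
  let ?\<Phi> = "\<lambda>p. real_of_int \<lfloor>fst p / \<delta> + 1 / 2\<rfloor> + snd p"
  let ?I = "indicator (UNIV \<times> {-1/2..1/2::real}) :: real \<times> real \<Rightarrow> real"
  have [measurable]: "?\<Phi> \<in> measurable ?P borel" by measurable
  have U[measurable]: "UNIV \<times> {-1/2..1/2::real} \<in> sets ?P" by (simp add: pair_measureI)
  have I: "(indicator (UNIV \<times> {-1/2..1/2}) :: real \<times> real \<Rightarrow> ennreal) = (\<lambda>p. ennreal (?I p))"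
    by (auto simp: indicator_def)
  note D = distr_round_shift[OF \<delta>, unfolded I]
  have "integrable lborel f \<longleftrightarrow> integrable lborel (\<lambda>y. \<delta> *\<^sub>R f y)"
  proof
    assume "integrable lborel (\<lambda>y. \<delta> *\<^sub>R f y)"
    then have "integrable lborel (\<lambda>y. (1 / \<delta>) *\<^sub>R (\<delta> *\<^sub>R f y))"
      by - (rule integrable_scaleR_right, assumption)
    then show "integrable lborel f" using \<delta> by simp
  qed (intro integrable_scaleR_right)
  also have "\<dots> \<longleftrightarrow> integrable (density lborel (\<lambda>_. ennreal \<delta>)) f"
    using \<delta> by (subst integrable_density) auto
  also have "\<dots> \<longleftrightarrow> integrable (density ?P (\<lambda>p. ennreal (?I p))) (\<lambda>p. f (?\<Phi> p))"
    unfolding D[symmetric] by (subst integrable_distr_eq) auto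
  also have "\<dots> \<longleftrightarrow> integrable ?P g" unfolding g_def
    by (subst integrable_density) auto
  finally show "integrable ?P g \<longleftrightarrow> integrable lborel f" by simp
  have "of_real \<delta> * integral\<^sup>L lborel f = integral\<^sup>L lborel (\<lambda>y. \<delta> *\<^sub>R f y)"
    by (simp add: scaleR_conv_of_real)
  also have "\<dots> = integral\<^sup>L (density lborel (\<lambda>_. ennreal \<delta>)) f"
    using \<delta> by (subst integral_density) auto
  also have "\<dots> = integral\<^sup>L (density ?P (\<lambda>p. ennreal (?I p))) (\<lambda>p. f (?\<Phi> p))"
    unfolding D[symmetric] by (subst integral_distr) auto
  also have "\<dots> = integral\<^sup>L ?P g" unfolding g_def
    by (subst integral_density) auto
  finally show "integral\<^sup>L ?P g = of_real \<delta> * integral\<^sup>L lborel f" by simp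
qed

section \<open>Integrable majorants\<close>

lemma integrable_lborel_from_has_integral:
  fixes f :: "real \<Rightarrow> real"
  assumes [measurable]: "f \<in> borel_measurable borel" and "\<And>x. 0 \<le> f x" and "(f has_integral I) UNIV"
  shows "integrable lborel f"
proof (rule integrableI_nonneg)
  have "integral\<^sup>N lborel (\<lambda>x. ennreal (f x)) = ennreal I"
    by (rule nn_integral_has_integral_lborel) (use assms in auto)
  then show "integral\<^sup>N lborel (\<lambda>x. ennreal (f x)) < \<infinity>" by simp
qed (use assms in auto)

lemma integrable_powr_near_0:
  fixes r M :: real
  assumes "r < 1" "0 \<le> M"
  shows "integrable lborel (\<lambda>x. indicator {-M..M} x * \<bar>x\<bar> powr (- r))"
proof -
  define g where "g = (\<lambda>x::real. indicator {0..M} x * x powr (- r))"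
  have int: "integrable lborel g"
  proof (rule integrable_lborel_from_has_integral)
    have "((\<lambda>x. x powr (- r)) has_integral (M powr (- r + 1) / (- r + 1))) {0..M}"
      using assms by (intro has_integral_powr_from_0) auto
    then have "((\<lambda>x. if x \<in> {0..M} then x powr (- r) else 0) has_integral (M powr (- r + 1) / (- r + 1))) UNIV"
      by (simp only: has_integral_restrict_UNIV)
    moreover have "g = (\<lambda>x. if x \<in> {0..M} then x powr (- r) else 0)" by (auto simp: g_def indicator_def)
    ultimately show "(g has_integral (M powr (- r + 1) / (- r + 1))) UNIV" by simp
  qed (auto simp: g_def indicator_def)
  have int': "integrable lborel (\<lambda>x. g x + g (0 + (- 1) * x))"
    by (intro Bochner_Integration.integrable_add int lborel_integrable_real_affine) auto
  show ?thesis
    by (rule Bochner_Integration.integrable_bound[OF int']) (auto simp: g_def indicator_def)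
qed

lemma integrable_exp_abs:
  fixes c :: real
  assumes "c > 0"
  shows "integrable lborel (\<lambda>x. exp (- (c * \<bar>x\<bar>)))"
proof -
  define g where "g = (\<lambda>x::real. indicator {0..} x * exp (- (c * x)))"
  have int: "integrable lborel g"
  proof (rule integrable_lborel_from_has_integral)
    have "((\<lambda>x. exp (- c * x)) has_integral exp (- c * 0) / c) {0..}"
      by (rule has_integral_exp_minus_to_infinity[OF assms])
    then have "((\<lambda>x. if x \<in> {0..} then exp (- c * x) else 0) has_integral exp (- c * 0) / c) UNIV"
      by (simp only: has_integral_restrict_UNIV)
    moreover have "g = (\<lambda>x. if x \<in> {0..} then exp (- c * x) else 0)" by (auto simp: g_def indicator_def)
    ultimately show "(g has_integral exp (- c * 0) / c) UNIV" by simp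
  qed (auto simp: g_def indicator_def)
  have int': "integrable lborel (\<lambda>x. g x + g (0 + (- 1) * x))"
    by (intro Bochner_Integration.integrable_add int lborel_integrable_real_affine) auto
  show ?thesis
    by (rule Bochner_Integration.integrable_bound[OF int']) (auto simp: g_def indicator_def)
qed

lemma integrable_lborel_prod:
  fixes f g :: "real \<Rightarrow> real"
  assumes f: "integrable lborel f" and g: "integrable lborel g"
  shows "integrable (lborel \<Otimes>\<^sub>M lborel) (\<lambda>p. f (fst p) * g (snd p))"
proof -
  have [measurable]: "f \<in> borel_measurable borel" "g \<in> borel_measurable borel"
    using f g by (auto dest: borel_measurable_integrable)
  show ?thesis
  proof (rule lborel_pair.Fubini_integrable)
    have "integrable lborel (\<lambda>x. \<bar>f x\<bar> * (\<integral>y. \<bar>g y\<bar> \<partial>lborel))"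
      using f by (intro integrable_mult_left integrable_abs) 
    then show "integrable lborel (\<lambda>x. \<integral>y. norm (f (fst (x, y)) * g (snd (x, y))) \<partial>lborel)"
      by (simp add: abs_mult)
    show "AE x in lborel. integrable lborel (\<lambda>y. f (fst (x, y)) * g (snd (x, y)))"
      using g by simp
  qed measurable
qed

text \<open>A constant plus a singularity with bounded support, hence integrable against an
  exponential weight when \<open>r < 1\<close>.\<close>

definition peak :: "real \<Rightarrow> real \<Rightarrow> real" where
  "peak r x = 1 + indicator {-1..1} x * \<bar>x\<bar> powr (- r)"

text \<open>On [-1, 1], where \<beta> and \<open>\<beta> - \<sigma>\<close> lie, an integer nearest
  to \<open>t\<close> can be found among -1, 0 and 1, so three powers suffice for the distance to
  all integers.\<close>

definition triple_peak :: "real \<Rightarrow> real \<Rightarrow> real" where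
  "triple_peak r t = \<bar>t\<bar> powr (- r) + \<bar>t - 1\<bar> powr (- r) + \<bar>t + 1\<bar> powr (- r)"

lemma peak_ge:
  assumes "x \<noteq> 0"
  shows "(min 1 \<bar>x\<bar>) powr (- r) \<le> peak r x"
  using assms by (auto simp: peak_def min_def indicator_def)

lemma integrable_peak:
  fixes c r \<rho> :: real
  assumes "c > 0" "r < 1"
  shows "integrable lborel (\<lambda>x. exp (- (c * \<bar>x\<bar>)) * peak r (x - \<rho>))"
proof -
  have [measurable]: "peak r \<in> borel_measurable borel" unfolding peak_def by measurable
  have "integrable lborel (\<lambda>x. indicator {-1..1} (- \<rho> + 1 * x) * \<bar>- \<rho> + 1 * x\<bar> powr (- r))"
    using integrable_powr_near_0[of r 1] assms by (intro lborel_integrable_real_affine) auto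
  then have int: "integrable lborel (\<lambda>x. exp (- (c * \<bar>x\<bar>)) + indicator {-1..1} (x - \<rho>) * \<bar>x - \<rho>\<bar> powr (- r))"
    using assms by (intro Bochner_Integration.integrable_add integrable_exp_abs) simp_all
  show ?thesis
  proof (rule Bochner_Integration.integrable_bound[OF int])
    have "exp (- (c * \<bar>x\<bar>)) * (indicator {-1..1} (x - \<rho>) * \<bar>x - \<rho>\<bar> powr (- r)) \<le> 1 * (indicator {-1..1} (x - \<rho>) * \<bar>x - \<rho>\<bar> powr (- r))" for x
      using assms by (intro mult_right_mono) auto
    then show "AE x in lborel. norm (exp (- (c * \<bar>x\<bar>)) * peak r (x - \<rho>))
        \<le> norm (exp (- (c * \<bar>x\<bar>)) + indicator {-1..1} (x - \<rho>) * \<bar>x - \<rho>\<bar> powr (- r))"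
      by (intro AE_I2) (simp add: peak_def distrib_left abs_mult)
  qed simp
qed

lemma integrable_triple_peak:
  fixes r \<sigma> :: real
  assumes "r < 1" "\<bar>\<sigma>\<bar> \<le> 1 / 2"
  shows "integrable lborel (\<lambda>x. indicator {-1/2..1/2} x * triple_peak r (x - \<sigma>))"
proof -
  have *: "integrable lborel (\<lambda>x. indicator {-1/2..1/2} x * \<bar>x - \<tau>\<bar> powr (- r))" if "\<bar>\<tau>\<bar> \<le> 2" for \<tau>
  proof -
    have int: "integrable lborel (\<lambda>x. indicator {-3..3} (- \<tau> + 1 * x) * \<bar>- \<tau> + 1 * x\<bar> powr (- r))"
      using integrable_powr_near_0[of r 3] assms by (intro lborel_integrable_real_affine) auto
    show ?thesis
      by (rule Bochner_Integration.integrable_bound[OF int]) (use that in \<open>auto simp: indicator_def\<close>)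
  qed
  have "integrable lborel (\<lambda>x. indicator {-1/2..1/2} x * \<bar>x - \<sigma>\<bar> powr (- r) +
      indicator {-1/2..1/2} x * \<bar>x - (\<sigma> + 1)\<bar> powr (- r) + indicator {-1/2..1/2} x * \<bar>x - (\<sigma> - 1)\<bar> powr (- r))"
    using assms by (intro Bochner_Integration.integrable_add *) auto
  moreover have "(\<lambda>x. indicator {-1/2..1/2} x * triple_peak r (x - \<sigma>)) = (\<lambda>x. indicator {-1/2..1/2} x * \<bar>x - \<sigma>\<bar> powr (- r) +
      indicator {-1/2..1/2} x * \<bar>x - (\<sigma> + 1)\<bar> powr (- r) + indicator {-1/2..1/2} x * \<bar>x - (\<sigma> - 1)\<bar> powr (- r))"
    by (auto simp: triple_peak_def algebra_simps)
  ultimately show ?thesis by simp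
qed

section \<open>The limit of the integral\<close>

lemma singular_dist_ge:
  assumes "A \<le> 1" "A \<le> \<delta> * (y + 1)"
  shows "A \<le> singular_dist \<delta> y"
  using assms by (simp add: singular_dist_def)

lemma singular_dist_le_1: "singular_dist \<delta> y \<le> 1"
proof -
  have "norm (1 - exp (2 * of_real pi * \<i> * complex_of_real y)) \<le> norm (1::complex) + norm (exp (2 * of_real pi * \<i> * complex_of_real y))"
    by (rule norm_triangle_ineq4)
  then show ?thesis by (simp add: singular_dist_def)
qed

lemma singular_dist_ge_dist:
  assumes d: "0 \<le> d" "\<And>l::int. d \<le> \<bar>y - of_int l\<bar>"
  shows "d / 4 \<le> singular_dist \<delta> y"
proof -
  have "\<bar>y - of_int (round y)\<bar> \<le> 1 / 2" using of_int_round_abs_le[of y] by (simp add: abs_minus_commute)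
  with d(2)[of "round y"] have d2: "d \<le> 1 / 2" by linarith
  have "2 * pi * d \<le> norm (2 * of_real pi * \<i> * complex_of_real y - 2 * of_real pi * \<i> * of_int l)" for l :: int
  proof -
    have "2 * of_real pi * \<i> * complex_of_real y - 2 * of_real pi * \<i> * of_int l = of_real (2 * pi) * (\<i> * of_real (y - of_int l))"
      by (simp add: algebra_simps)
    then have "norm (2 * of_real pi * \<i> * complex_of_real y - 2 * of_real pi * \<i> * of_int l) = 2 * pi * \<bar>y - of_int l\<bar>"
      by (simp only: norm_mult norm_of_real norm_ii) simp
    then show ?thesis using d(2)[of l] by simp
  qed
  from norm_one_minus_exp_ge[OF this]
  have "min 1 (2 * pi * d) / 2 \<le> norm (1 - exp (2 * of_real pi * \<i> * complex_of_real y))" .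
  moreover have "d \<le> min 1 (2 * pi * d)"
  proof -
    have "1 * d \<le> (2 * pi) * d" using d pi_gt3 by (intro mult_right_mono) auto
    then show ?thesis using d2 by simp
  qed
  ultimately have "d / 4 \<le> norm (1 - exp (2 * of_real pi * \<i> * complex_of_real y)) / 2" by linarith
  then show ?thesis by (simp add: singular_dist_def le_max_iff_disj)
qed

text \<open>The power \<open>- (2 * r)\<close> of \<open>singular_dist\<close> is split into equal
  halves, one estimated through the modulus by \<open>A\<close> and one through the phase by
  \<open>d\<close>. Each half is integrable in its own variable, whereas the full power in one
  variable may not be. The bound without \<open>d\<close> serves for a pair away from its
  singularity.\<close>

lemma gamma_pair_bound_separated:
  fixes m :: int and u :: complex and s :: real
  assumes s: "0 < s" "s < 1" and u: "Im u = - s"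
  defines "r \<equiv> (1 + s) / 2"
  shows "\<exists>C>0. \<forall>\<delta> y A d. small_step s \<delta> \<longrightarrow> 0 < A \<longrightarrow> A \<le> 1 \<longrightarrow> A \<le> \<delta> * (\<bar>y\<bar> + 1) \<longrightarrow>
     norm (gamma_pair m u \<delta> y) \<le> C * exp (- (2 * pi * s * (\<delta> * \<bar>y\<bar>))) * A powr (- (2 * r)) \<and>
     (0 < d \<longrightarrow> (\<forall>l::int. d \<le> \<bar>y - of_int l\<bar>) \<longrightarrow>
       norm (gamma_pair m u \<delta> y) \<le> C * exp (- (2 * pi * s * (\<delta> * \<bar>y\<bar>))) * (A powr (- r) * d powr (- r)))"
proof -
  obtain C where C: "C > 0" "\<And>\<delta> y. small_step s \<delta> \<Longrightarrow>
     norm (gamma_pair m u \<delta> y) \<le> C * exp (- (2 * pi * s * (\<delta> * \<bar>y\<bar>))) * singular_dist \<delta> \<bar>y\<bar> powr (- (2 * (sqrt_omega_real \<delta> * s)))"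
    using gamma_pair_bound[OF s u, of m] by blast
  have r: "0 < r" "r < 1" using s by (auto simp: r_def)
  have main: "norm (gamma_pair m u \<delta> y) \<le> (4 * C) * exp (- (2 * pi * s * (\<delta> * \<bar>y\<bar>))) * A powr (- (2 * r)) \<and>
     (0 < d \<longrightarrow> (\<forall>l::int. d \<le> \<bar>y - of_int l\<bar>) \<longrightarrow>
       norm (gamma_pair m u \<delta> y) \<le> (4 * C) * exp (- (2 * pi * s * (\<delta> * \<bar>y\<bar>))) * (A powr (- r) * d powr (- r)))"
    if ss: "small_step s \<delta>" and A: "0 < A" "A \<le> 1" "A \<le> \<delta> * (\<bar>y\<bar> + 1)" for \<delta> y A d
  proof -
    define D where "D = singular_dist \<delta> \<bar>y\<bar>"
    define e where "e = exp (- (2 * pi * s * (\<delta> * \<bar>y\<bar>)))"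
    have AD: "A \<le> D" unfolding D_def by (rule singular_dist_ge) (use A in auto)
    have D: "0 < D" "D \<le> 1" using AD A singular_dist_le_1 by (auto simp: D_def)
    \<comment> \<open>This makes the exponent independent of \<delta>; since
      \<open>singular_dist\<close> is at most 1, enlarging the exponent to \<open>r\<close> only
      weakens the bound. The comparison rests on
      \<open>4 * s \<le> (1 + s) * (1 + s)\<close>.\<close>
    have Sr: "sqrt_omega_real \<delta> * s \<le> r"
    proof -
      have T: "0 < sqrt_omega_real \<delta>" by (rule sqrt_omega_real_pos)
      have "(1 + s) / 2 * sqrt_omega_real \<delta> \<le> 1" using ss T by (simp add: field_simps)
      then have "sqrt_omega_real \<delta> \<le> 2 / (1 + s)" using s by (simp add: field_simps)
      then have "sqrt_omega_real \<delta> * s \<le> 2 / (1 + s) * s" using s by (intro mult_right_mono) auto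
      also have "\<dots> \<le> r"
      proof -
        have "0 \<le> (1 - s)\<^sup>2" by simp
        then have "4 * s \<le> (1 + s) * (1 + s)" by (simp add: power2_eq_square algebra_simps)
        then show ?thesis using s by (simp add: r_def field_simps)
      qed
      finally show ?thesis .
    qed
    have g: "norm (gamma_pair m u \<delta> y) \<le> C * e * D powr (- (2 * r))"
    proof -
      have "D powr (- (2 * (sqrt_omega_real \<delta> * s))) \<le> D powr (- (2 * r))"
        using Sr D by (intro powr_mono') auto
      then have "C * e * D powr (- (2 * (sqrt_omega_real \<delta> * s))) \<le> C * e * D powr (- (2 * r))"
        using C(1) by (intro mult_left_mono) (auto simp: e_def)
      then show ?thesis using C(2)[OF ss, of y] unfolding D_def e_def by linarith
    qed
    have 1: "norm (gamma_pair m u \<delta> y) \<le> (4 * C) * e * A powr (- (2 * r))"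
    proof -
      have "D powr (- (2 * r)) \<le> A powr (- (2 * r))" using AD A r by (intro powr_mono2') auto
      then have "C * e * D powr (- (2 * r)) \<le> (4 * C) * e * A powr (- (2 * r))"
        using C(1) by (intro mult_mono) (auto simp: e_def)
      with g show ?thesis by linarith
    qed
    have 2: "norm (gamma_pair m u \<delta> y) \<le> (4 * C) * e * (A powr (- r) * d powr (- r))"
      if d: "0 < d" "\<forall>l::int. d \<le> \<bar>y - of_int l\<bar>"
    proof -
      have "d \<le> \<bar>\<bar>y\<bar> - of_int l\<bar>" for l :: int
      proof (cases "0 \<le> y")
        case True
        then show ?thesis using d(2)[rule_format, of l] by simp
      next
        case False
        then show ?thesis using d(2)[rule_format, of "- l"] by simp
      qed
      then have "d / 4 \<le> D" unfolding D_def using d by (intro singular_dist_ge_dist) auto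
      then have "D powr (- r) \<le> (d / 4) powr (- r)" using d r by (intro powr_mono2') auto
      also have "\<dots> = d powr (- r) * 4 powr r" using d by (simp add: powr_divide powr_minus field_simps)
      also have "\<dots> \<le> d powr (- r) * 4"
        using powr_mono[of r 1 4] r by (intro mult_left_mono) auto
      finally have "D powr (- r) \<le> d powr (- r) * 4" .
      moreover have "D powr (- r) \<le> A powr (- r)" using AD A r by (intro powr_mono2') auto
      ultimately have "D powr (- r) * D powr (- r) \<le> A powr (- r) * (d powr (- r) * 4)" by (intro mult_mono) auto
      moreover have "D powr (- (2 * r)) = D powr (- r) * D powr (- r)" by (simp flip: powr_add)
      ultimately have "C * e * D powr (- (2 * r)) \<le> C * e * (A powr (- r) * (d powr (- r) * 4))"
        using C(1) by (intro mult_left_mono) (auto simp: e_def)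
      with g show ?thesis by (simp add: mult_ac)
    qed
    show ?thesis using 1 2 unfolding e_def by blast
  qed
  show ?thesis using main C(1) by (intro exI[of _ "4 * C"]) auto
qed

text \<open>The integrand of the theorem on the line \<open>z = \<i> sqrt_omega_real \<delta> y\<close>.\<close>

definition line_integrand :: "int \<Rightarrow> int \<Rightarrow> complex \<Rightarrow> real \<Rightarrow> real \<Rightarrow> real \<Rightarrow> real \<Rightarrow> real \<Rightarrow> complex" where
  "line_integrand m k u v \<rho> \<sigma> \<delta> y = exp (- (2 * of_real pi * \<i> * of_real ((of_int k + v * \<delta>) * y))) *
     gamma_pair m u \<delta> y * gamma_pair m u \<delta> (y - of_int \<lfloor>\<rho> / \<delta>\<rfloor> - \<sigma>)"

lemma I_c_eq_line_integrand:
  "I_c (omega1 \<delta>) (omega2 \<delta>) (g_param m u \<delta>) (lambda_param k v \<delta>) (x_param \<rho> \<sigma> \<delta>)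
     (\<i> * of_real (sqrt_omega_real \<delta>) * of_real y) = line_integrand m k u v \<rho> \<sigma> \<delta> y"
proof -
  define S where "S = complex_of_real (sqrt_omega_real \<delta>)"
  have S: "S \<noteq> 0" using sqrt_omega_real_pos(1)[of \<delta>] by (simp add: S_def)
  have SS: "omega1 \<delta> * omega2 \<delta> = S * S"
    unfolding omega_mult S_def sqrt_omega_real_sq[symmetric] by (simp add: power2_eq_square)
  have e: "2 * of_real pi * \<i> / (omega1 \<delta> * omega2 \<delta>) * lambda_param k v \<delta> * (\<i> * S * of_real y) =
      - (2 * of_real pi * \<i> * of_real ((of_int k + v * \<delta>) * y))"
    unfolding SS lambda_param_def sqrt_omega_eq S_def[symmetric] using S by (simp add: field_simps)
  have x: "\<i> * S * of_real y - x_param \<rho> \<sigma> \<delta> = \<i> * S * of_real (y - of_int \<lfloor>\<rho> / \<delta>\<rfloor> - \<sigma>)"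
    by (simp add: x_param_def sqrt_omega_eq S_def algebra_simps)
  have g: "(omega1 \<delta> + omega2 \<delta>) / 2 - g_param m u \<delta> = (omega1 \<delta> + omega2 \<delta>) / 2 - \<i> * S * (of_int m + u * of_real \<delta>)"
    by (simp add: g_param_def sqrt_omega_eq S_def)
  show ?thesis
    unfolding I_c_def line_integrand_def gamma_pair_def S_def[symmetric] e x g ..
qed

text \<open>The factor \<i> S produced by the substitution z = \<i> S y cancels the divisor in
  \<open>F\<close>.\<close>

lemma imag_axis_eq_line_integrand:
  fixes m k :: int and u :: complex and v \<rho> \<sigma> :: real
  defines "F \<equiv> \<lambda>(\<delta>::real) z. I_c (omega1 \<delta>) (omega2 \<delta>) (g_param m u \<delta>) (lambda_param k v \<delta>)
                  (x_param \<rho> \<sigma> \<delta>) z / (\<i> * sqrt_omega \<delta>)"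
  shows "imag_axis_integrable (F \<delta>) \<longleftrightarrow> integrable lborel (line_integrand m k u v \<rho> \<sigma> \<delta>)"
    and "imag_axis_integral (F \<delta>) = integral\<^sup>L lborel (line_integrand m k u v \<rho> \<sigma> \<delta>)"
proof -
  define T where "T = sqrt_omega_real \<delta>"
  have T: "T > 0" using sqrt_omega_real_pos(1)[of \<delta>] by (simp add: T_def)
  define H where "H = line_integrand m k u v \<rho> \<sigma> \<delta>"
  have F: "F \<delta> (\<i> * of_real t) * \<i> = (1 / T) *\<^sub>R H (0 + 1 / T * t)" for t
  proof -
    have "\<i> * of_real t = \<i> * of_real (sqrt_omega_real \<delta>) * complex_of_real (0 + 1 / T * t)"
      using T by (simp add: T_def)
    then have "F \<delta> (\<i> * of_real t) = H (0 + 1 / T * t) / (\<i> * of_real T)"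
      unfolding F_def H_def sqrt_omega_eq T_def[symmetric] by (simp only: I_c_eq_line_integrand T_def)
    then show ?thesis using T by (simp add: scaleR_conv_of_real)
  qed
  have "integrable lborel (\<lambda>t. (1 / T) *\<^sub>R H (0 + 1 / T * t)) \<longleftrightarrow> integrable lborel (\<lambda>t. H (0 + 1 / T * t))"
  proof
    assume "integrable lborel (\<lambda>t. (1 / T) *\<^sub>R H (0 + 1 / T * t))"
    then have "integrable lborel (\<lambda>t. T *\<^sub>R ((1 / T) *\<^sub>R H (0 + 1 / T * t)))"
      by - (rule integrable_scaleR_right, assumption)
    then show "integrable lborel (\<lambda>t. H (0 + 1 / T * t))" using T by simp
  qed (intro integrable_scaleR_right)
  also have "\<dots> \<longleftrightarrow> integrable lborel H"
    by (rule lborel_integrable_real_affine_iff) (use T in simp)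
  finally show "imag_axis_integrable (F \<delta>) \<longleftrightarrow> integrable lborel (line_integrand m k u v \<rho> \<sigma> \<delta>)"
    unfolding imag_axis_integrable_def F H_def .
  have "integral\<^sup>L lborel H = \<bar>1 / T\<bar> *\<^sub>R (\<integral>t. H (0 + 1 / T * t) \<partial>lborel)"
    by (rule lborel_integral_real_affine) (use T in simp)
  then show "imag_axis_integral (F \<delta>) = integral\<^sup>L lborel (line_integrand m k u v \<rho> \<sigma> \<delta>)"
    unfolding imag_axis_integral_def F H_def[symmetric] using T by simp
qed

lemma triple_peak_ge:
  assumes t: "\<bar>t\<bar> \<le> 1" and nz: "\<And>l::int. t \<noteq> of_int l"
  shows "\<exists>d>0. (\<forall>l::int. d \<le> \<bar>t - of_int l\<bar>) \<and> d powr (- r) \<le> triple_peak r t"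
proof -
  define d where "d = min \<bar>t\<bar> (min \<bar>t - 1\<bar> \<bar>t + 1\<bar>)"
  have "d > 0" using nz[of 0] nz[of 1] nz[of "- 1"] by (auto simp: d_def)
  moreover have "d \<le> \<bar>t - of_int l\<bar>" for l :: int
  proof -
    consider "l \<ge> 1" | "l = 0" | "l \<le> - 1" by linarith
    then show ?thesis
    proof cases
      case 1
      then have "\<bar>t - 1\<bar> \<le> \<bar>t - of_int l\<bar>" using t by linarith
      then show ?thesis by (simp add: d_def)
    next
      case 3
      then have "\<bar>t + 1\<bar> \<le> \<bar>t - of_int l\<bar>" using t by linarith
      then show ?thesis by (simp add: d_def)
    qed (simp add: d_def)
  qed
  moreover have "d powr (- r) \<le> triple_peak r t"
    by (auto simp: d_def min_def triple_peak_def)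
  ultimately show ?thesis by blast
qed

lemma round_diff:
  fixes \<delta> \<alpha> :: real
  assumes "0 < \<delta>"
  shows "\<bar>\<delta> * of_int \<lfloor>\<alpha> / \<delta> + 1 / 2\<rfloor> - \<alpha>\<bar> \<le> \<delta> / 2" "\<bar>\<delta> * of_int \<lfloor>\<alpha> / \<delta>\<rfloor> - \<alpha>\<bar> \<le> \<delta>"
proof -
  define z where "z = \<alpha> / \<delta>"
  have \<alpha>: "\<alpha> = \<delta> * z" using assms by (simp add: z_def)
  have scale: "\<bar>\<delta> * a - \<alpha>\<bar> \<le> \<delta> * c" if "\<bar>a - z\<bar> \<le> c" for a c
    using mult_left_mono[OF that, of \<delta>] assms by (simp add: \<alpha> abs_mult flip: right_diff_distrib)
  have "\<bar>of_int \<lfloor>z + 1 / 2\<rfloor> - z\<bar> \<le> 1 / 2"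
    using of_int_floor_le[of "z + 1 / 2"] real_of_int_floor_add_one_gt[of "z + 1 / 2"] by linarith
  from scale[OF this] show "\<bar>\<delta> * of_int \<lfloor>\<alpha> / \<delta> + 1 / 2\<rfloor> - \<alpha>\<bar> \<le> \<delta> / 2" by (simp add: z_def)
  have "\<bar>of_int \<lfloor>z\<rfloor> - z\<bar> \<le> 1"
    using of_int_floor_le[of z] real_of_int_floor_add_one_gt[of z] by linarith
  from scale[OF this] show "\<bar>\<delta> * of_int \<lfloor>\<alpha> / \<delta>\<rfloor> - \<alpha>\<bar> \<le> \<delta>" by (simp add: z_def)
qed

text \<open>Any \<alpha> is at distance at least \<open>\<bar>\<rho>\<bar> / 2\<close> from 0 or
  from \<rho>. The pair that is away from its singularity is bounded by the constant
  \<open>Q\<close>, up to the decay factor, and the other receives the product bound, whence one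
  summand for each singularity. Decay in \<alpha> is taken from the first pair alone.\<close>

lemma line_integrand_bound:
  fixes m k :: int and u :: complex and v \<rho> \<sigma> s :: real
  assumes s: "0 < s" "s < 1" and u: "Im u = - s" and \<rho>: "\<rho> \<noteq> 0" and \<sigma>: "\<bar>\<sigma>\<bar> \<le> 1 / 2"
  defines "r \<equiv> (1 + s) / 2"
  shows "\<exists>C>0. \<forall>\<delta> \<alpha> \<beta>. small_step s \<delta> \<longrightarrow> \<bar>\<beta>\<bar> \<le> 1 / 2 \<longrightarrow> \<alpha> \<noteq> 0 \<longrightarrow> \<alpha> \<noteq> \<rho> \<longrightarrow>
     (\<forall>l::int. \<beta> \<noteq> of_int l \<and> \<beta> - \<sigma> \<noteq> of_int l) \<longrightarrow>
     norm (line_integrand m k u v \<rho> \<sigma> \<delta> (of_int \<lfloor>\<alpha> / \<delta> + 1 / 2\<rfloor> + \<beta>))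
       \<le> C * (exp (- (2 * pi * s * \<bar>\<alpha>\<bar>)) * (peak r \<alpha> * triple_peak r \<beta> + peak r (\<alpha> - \<rho>) * triple_peak r (\<beta> - \<sigma>)))"
proof -
  obtain C where C: "C > 0" "\<And>\<delta> y A d. small_step s \<delta> \<Longrightarrow> 0 < A \<Longrightarrow> A \<le> 1 \<Longrightarrow> A \<le> \<delta> * (\<bar>y\<bar> + 1) \<Longrightarrow>
     norm (gamma_pair m u \<delta> y) \<le> C * exp (- (2 * pi * s * (\<delta> * \<bar>y\<bar>))) * A powr (- (2 * r)) \<and>
     (0 < d \<longrightarrow> (\<forall>l::int. d \<le> \<bar>y - of_int l\<bar>) \<longrightarrow>
       norm (gamma_pair m u \<delta> y) \<le> C * exp (- (2 * pi * s * (\<delta> * \<bar>y\<bar>))) * (A powr (- r) * d powr (- r)))"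
    using gamma_pair_bound_separated[OF s u, of m] unfolding r_def by blast
  have r: "0 < r" "r < 1" using s by (auto simp: r_def)
  define \<kappa> where "\<kappa> = min 1 (\<bar>\<rho>\<bar> / 2)"
  have \<kappa>: "0 < \<kappa>" using \<rho> by (simp add: \<kappa>_def)
  define c where "c = C * C * exp (2 * pi * s) * (3 * (\<kappa> / 3) powr (- (2 * r)))"
  have main: "norm (line_integrand m k u v \<rho> \<sigma> \<delta> (of_int \<lfloor>\<alpha> / \<delta> + 1 / 2\<rfloor> + \<beta>))
       \<le> c * (exp (- (2 * pi * s * \<bar>\<alpha>\<bar>)) * (peak r \<alpha> * triple_peak r \<beta> + peak r (\<alpha> - \<rho>) * triple_peak r (\<beta> - \<sigma>)))"
    if ss: "small_step s \<delta>" and \<beta>: "\<bar>\<beta>\<bar> \<le> 1 / 2" and \<alpha>: "\<alpha> \<noteq> 0" "\<alpha> \<noteq> \<rho>"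
      and nz: "\<And>l::int. \<beta> \<noteq> of_int l" "\<And>l::int. \<beta> - \<sigma> \<noteq> of_int l" for \<delta> \<alpha> \<beta>
  proof -
    define n where "n = \<lfloor>\<alpha> / \<delta> + 1 / 2\<rfloor>"
    define K where "K = \<lfloor>\<rho> / \<delta>\<rfloor>"
    define y where "y = of_int n + \<beta>"
    define y' where "y' = y - of_int K - \<sigma>"
    define A where "A = min 1 \<bar>\<alpha>\<bar>"
    define A' where "A' = min 1 \<bar>\<alpha> - \<rho>\<bar> / 3"
    have \<delta>: "0 < \<delta>" "\<delta> \<le> 1" using ss by auto
    have n: "\<bar>\<delta> * of_int n - \<alpha>\<bar> \<le> \<delta> / 2" and K: "\<bar>\<delta> * of_int K - \<rho>\<bar> \<le> \<delta>"
      using round_diff[OF \<delta>(1)] by (auto simp: n_def K_def)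
    have db: "\<bar>\<delta> * \<beta>\<bar> \<le> \<delta> / 2" "\<bar>\<delta> * \<sigma>\<bar> \<le> \<delta> / 2"
      using mult_left_mono[OF \<beta>, of \<delta>] mult_left_mono[OF \<sigma>, of \<delta>] \<delta> by (simp_all add: abs_mult)
    have ya: "\<bar>\<alpha>\<bar> \<le> \<delta> * \<bar>y\<bar> + \<delta>"
    proof -
      have "\<delta> * \<bar>y\<bar> = \<bar>\<delta> * of_int n + \<delta> * \<beta>\<bar>" using \<delta> by (simp add: y_def abs_mult flip: distrib_left)
      then show ?thesis using n db by linarith
    qed
    \<comment> \<open>Rounding in \<open>n\<close> and \<open>K\<close> together with the offsets
      \<beta> and \<sigma> displaces the point by at most 5/2 times \<delta>. This explains the
      factor 3 and the division by 3 in \<open>A'\<close>.\<close>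
    have y'a: "\<bar>\<alpha> - \<rho>\<bar> \<le> 3 * (\<delta> * \<bar>y'\<bar> + \<delta>)"
    proof -
      have "\<delta> * \<bar>y'\<bar> = \<bar>\<delta> * y'\<bar>" using \<delta> by (simp add: abs_mult)
      also have "\<delta> * y' = \<delta> * of_int n + \<delta> * \<beta> - \<delta> * of_int K - \<delta> * \<sigma>" by (simp add: y'_def y_def algebra_simps)
      finally have "\<bar>\<alpha> - \<rho>\<bar> \<le> \<delta> * \<bar>y'\<bar> + 3 * \<delta>" using n db K \<delta> by linarith
      moreover define q where "q = \<delta> * \<bar>y'\<bar>"
      moreover have "0 \<le> q" using \<delta> by (simp add: q_def)
      ultimately have "\<bar>\<alpha> - \<rho>\<bar> \<le> 3 * (q + \<delta>)" by simp
      then show ?thesis by (simp only: q_def)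
    qed
    have A: "0 < A" "A \<le> 1" "A \<le> \<delta> * (\<bar>y\<bar> + 1)" using \<alpha> ya by (auto simp: A_def distrib_left)
    have A': "0 < A'" "A' \<le> 1" "A' \<le> \<delta> * (\<bar>y'\<bar> + 1)" using \<alpha> y'a by (auto simp: A'_def distrib_left min_def)
    obtain d where d: "d > 0" "\<And>l::int. d \<le> \<bar>\<beta> - of_int l\<bar>" "d powr (- r) \<le> triple_peak r \<beta>"
    proof -
      have "\<bar>\<beta>\<bar> \<le> 1" using \<beta> by linarith
      from triple_peak_ge[OF this nz(1), of r] show ?thesis using that by blast
    qed
    obtain d' where d': "d' > 0" "\<And>l::int. d' \<le> \<bar>\<beta> - \<sigma> - of_int l\<bar>" "d' powr (- r) \<le> triple_peak r (\<beta> - \<sigma>)"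
    proof -
      have "\<bar>\<beta> - \<sigma>\<bar> \<le> 1" using \<beta> \<sigma> by linarith
      from triple_peak_ge[OF this nz(2), of r] show ?thesis using that by blast
    qed
    have dy: "\<forall>l::int. d \<le> \<bar>y - of_int l\<bar>"
    proof
      fix l :: int
      show "d \<le> \<bar>y - of_int l\<bar>" using d(2)[of "l - n"] by (simp add: y_def algebra_simps)
    qed
    have dy': "\<forall>l::int. d' \<le> \<bar>y' - of_int l\<bar>"
    proof
      fix l :: int
      show "d' \<le> \<bar>y' - of_int l\<bar>" using d'(2)[of "l - n + K"] by (simp add: y'_def y_def algebra_simps)
    qed
    define e where "e = exp (- (2 * pi * s * \<bar>\<alpha>\<bar>))"
    define E where "E = exp (2 * pi * s)"
    have ey: "exp (- (2 * pi * s * (\<delta> * \<bar>y\<bar>))) \<le> E * e"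
    proof -
      have "2 * pi * s * (\<bar>\<alpha>\<bar> - 1) \<le> 2 * pi * s * (\<delta> * \<bar>y\<bar>)" using ya \<delta> s by (intro mult_left_mono) auto
      then show ?thesis unfolding E_def e_def exp_add[symmetric] by (simp add: algebra_simps)
    qed
    have ey': "exp (- (2 * pi * s * (\<delta> * \<bar>y'\<bar>))) \<le> 1" using s \<delta> by simp
    note g = C(2)[OF ss A, of d]
    note g' = C(2)[OF ss A', of d']
    have up: "C * x * p \<le> C * x' * p" if "x \<le> x'" "0 \<le> p" for x x' p
      using C(1) that by (intro mult_right_mono mult_left_mono) auto
    have g1: "norm (gamma_pair m u \<delta> y) \<le> C * (E * e) * A powr (- (2 * r))"
      by (rule order_trans[OF conjunct1[OF g] up[OF ey]]) simp
    have g2: "norm (gamma_pair m u \<delta> y) \<le> C * (E * e) * (A powr (- r) * d powr (- r))"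
      by (rule order_trans[OF g[THEN conjunct2, THEN mp, OF d(1), THEN mp, OF dy] up[OF ey]]) simp
    have g1': "norm (gamma_pair m u \<delta> y') \<le> C * A' powr (- (2 * r))"
      using order_trans[OF conjunct1[OF g'] up[OF ey']] by simp
    have g2': "norm (gamma_pair m u \<delta> y') \<le> C * (A' powr (- r) * d' powr (- r))"
      using order_trans[OF g'[THEN conjunct2, THEN mp, OF d'(1), THEN mp, OF dy'] up[OF ey']] by simp
    have pk: "A powr (- r) \<le> peak r \<alpha>" unfolding A_def by (rule peak_ge) fact
    have pk': "A' powr (- r) \<le> 3 * peak r (\<alpha> - \<rho>)"
    proof -
      have "A' powr (- r) = (min 1 \<bar>\<alpha> - \<rho>\<bar>) powr (- r) * 3 powr r"
        using \<alpha> by (simp add: A'_def powr_divide powr_minus field_simps)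
      also have "\<dots> \<le> peak r (\<alpha> - \<rho>) * 3"
        using powr_mono[of r 1 3] r \<alpha> by (intro mult_mono peak_ge) (auto simp: peak_def)
      finally show ?thesis by simp
    qed
    have p0: "0 \<le> peak r x" "0 \<le> triple_peak r x" for x by (auto simp: peak_def triple_peak_def)
    define Q where "Q = (\<kappa> / 3) powr (- (2 * r))"
    have Q: "Q \<ge> 0" by (simp add: Q_def)
    have ex: "0 \<le> E * e" "0 \<le> C" using C(1) by (auto simp: E_def e_def)
    have prod: "norm (gamma_pair m u \<delta> y) * norm (gamma_pair m u \<delta> y') \<le>
        C * C * E * (3 * Q) * (e * (peak r \<alpha> * triple_peak r \<beta> + peak r (\<alpha> - \<rho>) * triple_peak r (\<beta> - \<sigma>)))"
    proof (cases "\<bar>\<alpha>\<bar> \<ge> \<bar>\<rho>\<bar> / 2")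
      case True
      then have "\<kappa> / 3 \<le> A" using \<rho> by (auto simp: A_def \<kappa>_def)
      then have "A powr (- (2 * r)) \<le> Q" unfolding Q_def using \<kappa> r by (intro powr_mono2') auto
      then have "norm (gamma_pair m u \<delta> y) \<le> C * (E * e) * Q"
        using ex by (intro order_trans[OF g1] mult_left_mono) auto
      moreover have "norm (gamma_pair m u \<delta> y') \<le> C * ((3 * peak r (\<alpha> - \<rho>)) * triple_peak r (\<beta> - \<sigma>))"
        using ex pk' d'(3) p0 by (intro order_trans[OF g2'] mult_left_mono mult_mono) auto
      ultimately have "norm (gamma_pair m u \<delta> y) * norm (gamma_pair m u \<delta> y') \<le>
          (C * (E * e) * Q) * (C * ((3 * peak r (\<alpha> - \<rho>)) * triple_peak r (\<beta> - \<sigma>)))"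
        using ex Q by (intro mult_mono) auto
      also have "\<dots> = C * C * E * (3 * Q) * (e * (0 + peak r (\<alpha> - \<rho>) * triple_peak r (\<beta> - \<sigma>)))" by (simp add: mult_ac)
      also have "\<dots> \<le> C * C * E * (3 * Q) * (e * (peak r \<alpha> * triple_peak r \<beta> + peak r (\<alpha> - \<rho>) * triple_peak r (\<beta> - \<sigma>)))"
        using ex Q p0 by (intro mult_left_mono add_right_mono) (auto simp: E_def e_def)
      finally show ?thesis .
    next
      case False
      then have "\<bar>\<rho>\<bar> / 2 \<le> \<bar>\<alpha> - \<rho>\<bar>" by linarith
      then have "\<kappa> \<le> min 1 \<bar>\<alpha> - \<rho>\<bar>" unfolding \<kappa>_def by (intro min.mono) auto
      then have "\<kappa> / 3 \<le> A'" by (simp add: A'_def)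
      then have "A' powr (- (2 * r)) \<le> Q" unfolding Q_def using \<kappa> r by (intro powr_mono2') auto
      then have "norm (gamma_pair m u \<delta> y') \<le> C * Q"
        using ex by (intro order_trans[OF g1'] mult_left_mono) auto
      moreover have "norm (gamma_pair m u \<delta> y) \<le> C * (E * e) * (peak r \<alpha> * triple_peak r \<beta>)"
        using ex pk d(3) p0 by (intro order_trans[OF g2] mult_left_mono mult_mono) auto
      ultimately have "norm (gamma_pair m u \<delta> y) * norm (gamma_pair m u \<delta> y') \<le>
          (C * (E * e) * (peak r \<alpha> * triple_peak r \<beta>)) * (C * Q)"
        using ex Q p0 by (intro mult_mono) auto
      also have "\<dots> = C * C * E * (1 * Q) * (e * (peak r \<alpha> * triple_peak r \<beta> + 0))" by (simp add: mult_ac)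
      also have "\<dots> \<le> C * C * E * (3 * Q) * (e * (peak r \<alpha> * triple_peak r \<beta> + peak r (\<alpha> - \<rho>) * triple_peak r (\<beta> - \<sigma>)))"
        using ex Q p0 by (intro mult_mono mult_left_mono mult_right_mono add_left_mono mult_nonneg_nonneg add_nonneg_nonneg)
          (auto simp: E_def e_def)
      finally show ?thesis .
    qed
    have "norm (line_integrand m k u v \<rho> \<sigma> \<delta> y) = norm (gamma_pair m u \<delta> y) * norm (gamma_pair m u \<delta> y')"
      unfolding line_integrand_def norm_mult y'_def K_def norm_exp_eq_Re by simp
    then show ?thesis using prod unfolding y_def n_def c_def E_def e_def Q_def by simp
  qed
  have "c > 0" using C(1) \<kappa> by (simp add: c_def)
  with main show ?thesis by (intro exI[of _ c]) auto
qed

text \<open>Both roundings move the coordinates by integers only, so the phases stay those of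
  \<beta> and \<open>\<beta> - \<sigma>\<close>, while after multiplication by \<delta> the rounding
  errors disappear and leave \<alpha> and \<open>\<alpha> - \<rho>\<close>.\<close>

lemma line_integrand_tendsto:
  fixes m k :: int and u :: complex and v \<rho> \<sigma> s \<alpha> \<beta> :: real
  assumes s: "0 < s" "s < 1" and u: "Im u = - s" and \<alpha>: "\<alpha> \<noteq> 0" "\<alpha> \<noteq> \<rho>"
  shows "((\<lambda>\<delta>. line_integrand m k u v \<rho> \<sigma> \<delta> (of_int \<lfloor>\<alpha> / \<delta> + 1 / 2\<rfloor> + \<beta>)) \<longlongrightarrow> J_c m k u v \<rho> \<sigma> \<alpha> \<beta>) (at_right 0)"
proof -
  define y where "y = (\<lambda>\<delta>. of_int \<lfloor>\<alpha> / \<delta> + 1 / 2\<rfloor> + \<beta>)"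
  define y' where "y' = (\<lambda>\<delta>. y \<delta> - of_int \<lfloor>\<rho> / \<delta>\<rfloor> - \<sigma>)"
  have ev: "\<forall>\<^sub>F \<delta>::real in at_right 0. 0 < \<delta>" by (simp add: eventually_at_right_less)
  have lim0: "((\<lambda>\<delta>::real. \<delta> * c) \<longlongrightarrow> 0) (at_right 0)" for c
  proof -
    have "((\<lambda>\<delta>::real. \<delta> * c) \<longlongrightarrow> 0 * c) (at_right 0)" by (intro tendsto_intros)
    then show ?thesis by simp
  qed
  have fl: "((\<lambda>\<delta>. \<delta> * of_int \<lfloor>\<alpha> / \<delta> + 1 / 2\<rfloor> - \<alpha>) \<longlongrightarrow> 0) (at_right 0)"
    by (rule Lim_null_comparison[OF _ lim0[of "1 / 2"]]) (use ev in \<open>eventually_elim, use round_diff(1) in simp\<close>)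
  have fl': "((\<lambda>\<delta>. \<delta> * of_int \<lfloor>\<rho> / \<delta>\<rfloor> - \<rho>) \<longlongrightarrow> 0) (at_right 0)"
    by (rule Lim_null_comparison[OF _ lim0[of 1]]) (use ev in \<open>eventually_elim, use round_diff(2) in simp\<close>)
  have ly: "((\<lambda>\<delta>. \<delta> * y \<delta>) \<longlongrightarrow> \<alpha>) (at_right 0)"
  proof -
    have "((\<lambda>\<delta>. (\<delta> * of_int \<lfloor>\<alpha> / \<delta> + 1 / 2\<rfloor> - \<alpha>) + \<alpha> + \<delta> * \<beta>) \<longlongrightarrow> 0 + \<alpha> + 0) (at_right 0)"
      by (intro tendsto_add fl lim0 tendsto_const)
    then show ?thesis by (simp add: y_def algebra_simps)
  qed
  have ly': "((\<lambda>\<delta>. \<delta> * y' \<delta>) \<longlongrightarrow> \<alpha> - \<rho>) (at_right 0)"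
  proof -
    have "((\<lambda>\<delta>. \<delta> * y \<delta> - ((\<delta> * of_int \<lfloor>\<rho> / \<delta>\<rfloor> - \<rho>) + \<rho>) - \<delta> * \<sigma>) \<longlongrightarrow> \<alpha> - (0 + \<rho>) - 0) (at_right 0)"
      by (intro tendsto_add tendsto_diff ly fl' lim0 tendsto_const)
    then show ?thesis by (simp add: y'_def algebra_simps)
  qed
  have per0: "exp (2 * of_real pi * \<i> * of_real (of_int j + b)) = exp (2 * of_real pi * \<i> * complex_of_real b)" for j :: int and b
    using exp_integer_2pi[of "of_int j"] by (simp add: distrib_left exp_add mult_ac)
  have per: "exp (2 * of_real pi * \<i> * of_real (y \<delta>)) = exp (2 * of_real pi * \<i> * of_real \<beta>)" for \<delta>
    unfolding y_def by (rule per0)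
  have per': "exp (2 * of_real pi * \<i> * of_real (y' \<delta>)) = exp (2 * of_real pi * \<i> * of_real (\<beta> - \<sigma>))" for \<delta>
    using per0[of "\<lfloor>\<alpha> / \<delta> + 1 / 2\<rfloor> - \<lfloor>\<rho> / \<delta>\<rfloor>" "\<beta> - \<sigma>"] by (simp add: y'_def y_def algebra_simps)
  define B where "B = (\<lambda>t b. bipow (2 * sinh (of_real pi * (complex_of_real t + \<i> * of_real b))) (- of_int m - \<i> * u) (of_int m - \<i> * u))"
  have G: "((\<lambda>\<delta>. gamma_pair m u \<delta> (y \<delta>)) \<longlongrightarrow> B \<alpha> \<beta>) (at_right 0)"
    unfolding B_def by (rule gamma_pair_tendsto[OF u s \<alpha>(1) ly per])
  have "\<alpha> - \<rho> \<noteq> 0" using \<alpha> by simp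
  then have G': "((\<lambda>\<delta>. gamma_pair m u \<delta> (y' \<delta>)) \<longlongrightarrow> B (\<alpha> - \<rho>) (\<beta> - \<sigma>)) (at_right 0)"
    unfolding B_def by (rule gamma_pair_tendsto[OF u s _ ly' per'])
  have e: "exp (- (2 * of_real pi * \<i> * of_real ((of_int k + v * \<delta>) * y \<delta>))) =
      exp (- (2 * of_real pi * \<i> * (of_real \<beta> * of_int k))) * exp (- (2 * of_real pi * \<i> * (of_real v * of_real (\<delta> * y \<delta>))))" for \<delta>
  proof -
    have "exp (of_int (- k) * (2 * of_real pi * \<i> * of_real (y \<delta>))) = exp (of_int (- k) * (2 * of_real pi * \<i> * of_real \<beta>))"
      unfolding exp_power_int[symmetric] per ..
    then have "exp (- (2 * of_real pi * \<i> * (of_real \<beta> * of_int k))) = exp (- (2 * of_real pi * \<i> * (of_real (y \<delta>) * of_int k)))"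
      by (simp add: mult_ac)
    then show ?thesis by (simp add: algebra_simps flip: exp_add)
  qed
  have lim: "((\<lambda>\<delta>. line_integrand m k u v \<rho> \<sigma> \<delta> (y \<delta>)) \<longlongrightarrow>
      exp (- (2 * of_real pi * \<i> * (of_real \<beta> * of_int k))) * exp (- (2 * of_real pi * \<i> * (of_real v * of_real \<alpha>))) *
      B \<alpha> \<beta> * B (\<alpha> - \<rho>) (\<beta> - \<sigma>)) (at_right 0)"
  proof -
    have "y \<delta> - of_int \<lfloor>\<rho> / \<delta>\<rfloor> - \<sigma> = y' \<delta>" for \<delta> by (simp add: y'_def)
    then show ?thesis unfolding line_integrand_def e by (simp only:) (intro tendsto_intros G G' ly)
  qed
  have ex: "exp (- (2 * of_real pi * \<i> * (of_real \<beta> * of_int k))) * exp (- (2 * of_real pi * \<i> * (of_real v * of_real \<alpha>))) =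
      exp (- 2 * of_real pi * \<i> * (of_real \<alpha> * of_real v + of_real \<beta> * of_int k))"
    by (simp add: algebra_simps flip: exp_add)
  have arg: "of_real \<alpha> - of_real \<rho> + \<i> * of_real \<beta> - \<i> * of_real \<sigma> = complex_of_real (\<alpha> - \<rho>) + \<i> * of_real (\<beta> - \<sigma>)"
    by (simp add: algebra_simps)
  have eq: "(- of_int m - \<i> * u) - (of_int m - \<i> * u) = of_int (- 2 * m)" by simp
  have "J_c m k u v \<rho> \<sigma> \<alpha> \<beta> = exp (- (2 * of_real pi * \<i> * (of_real \<beta> * of_int k))) *
      exp (- (2 * of_real pi * \<i> * (of_real v * of_real \<alpha>))) * B \<alpha> \<beta> * B (\<alpha> - \<rho>) (\<beta> - \<sigma>)"
    unfolding J_c_def arg bipow_mult[OF eq] B_def ex by (simp only: mult.assoc)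
  then show ?thesis using lim unfolding y_def by simp
qed

text \<open>The argument function is avoided: the power is rewritten with \<open>ln (norm w)\<close>
  and natural powers of \<open>w / norm w\<close>, and its value at \<open>w = 0\<close> is
  0.\<close>

lemma bipow_measurable:
  assumes "a - a' = of_int k"
  shows "(\<lambda>w. bipow w a a') \<in> borel_measurable borel"
proof -
  have "(\<lambda>w. bipow w a a') = (\<lambda>w. (if w = 0 then 0 else exp ((a + a') * of_real (ln (norm w)))) *
      (if k \<ge> 0 then (w / of_real (norm w)) ^ nat k else inverse (w / of_real (norm w)) ^ nat (- k)))"
    by (rule ext) (auto simp: bipow_alt[OF assms] power_int_def sgn_eq powr_def Ln_of_real)
  also have "\<dots> \<in> borel_measurable borel" by measurable
  finally show ?thesis .
qed

lemma J_c_measurable: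
  "(\<lambda>p. J_c m k u v \<rho> \<sigma> (fst p) (snd p)) \<in> borel_measurable borel"
proof -
  have eq: "(- of_int m - \<i> * u) - (of_int m - \<i> * u) = of_int (- 2 * m)" by simp
  have c: "(\<lambda>p::real \<times> real. (2 * sinh (of_real pi * (of_real (fst p) + \<i> * of_real (snd p)))) *
        (2 * sinh (of_real pi * (of_real (fst p) - of_real \<rho> + \<i> * of_real (snd p) - \<i> * complex_of_real \<sigma>)))) \<in> borel_measurable borel"
    by (intro borel_measurable_continuous_onI continuous_intros)
  have "(\<lambda>p::real \<times> real. exp (- 2 * of_real pi * \<i> * (of_real (fst p) * of_real v + of_real (snd p) * of_int k))) \<in> borel_measurable borel"
    by (intro borel_measurable_continuous_onI continuous_intros)
  then show ?thesis unfolding J_c_def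
    by (rule borel_measurable_times[OF _ measurable_compose[OF c bipow_measurable[OF eq]]])
qed

theorem theorem2:
  fixes m k :: int and u :: complex and v \<rho> \<sigma> :: real
  assumes "Im u \<in> {-1<..<0}" and "\<rho> \<noteq> 0" and "\<bar>\<sigma>\<bar> \<le> 1/2"
  defines "Deltas \<equiv> {\<delta>::real. \<delta> > 0 \<and> 1 / \<delta> \<in> \<int>}"
  defines "F \<equiv> \<lambda>(\<delta>::real) z. I_c (omega1 \<delta>) (omega2 \<delta>) (g_param m u \<delta>) (lambda_param k v \<delta>)
                  (x_param \<rho> \<sigma> \<delta>) z / (\<i> * sqrt_omega \<delta>)"
  shows "(\<forall>\<^sub>F \<delta> in at 0 within Deltas. imag_axis_integrable (F \<delta>)) \<and>
         set_integrable (lborel \<Otimes>\<^sub>M lborel) (UNIV \<times> {-1/2..1/2})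
           (\<lambda>(\<alpha>, \<beta>). J_c m k u v \<rho> \<sigma> \<alpha> \<beta>) \<and>
         ((\<lambda>\<delta>. of_real \<delta> * imag_axis_integral (F \<delta>)) \<longlongrightarrow>
            (LINT \<alpha>|lborel. (LINT \<beta>:{-1/2..1/2}|lborel. J_c m k u v \<rho> \<sigma> \<alpha> \<beta>)))
           (at 0 within Deltas)"
proof -
  define s where "s = - Im u"
  define r where "r = (1 + s) / 2"
  have s: "0 < s" "s < 1" and u: "Im u = - s" using assms(1) by (auto simp: s_def)
  have r: "r < 1" using s by (simp add: r_def)
  let ?P = "lborel \<Otimes>\<^sub>M lborel :: (real \<times> real) measure"
  define I where "I = (indicator (UNIV \<times> {-1/2..1/2}) :: real \<times> real \<Rightarrow> real)"
  define H where "H = line_integrand m k u v \<rho> \<sigma>"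
  define f where "f = (\<lambda>p. I p *\<^sub>R J_c m k u v \<rho> \<sigma> (fst p) (snd p))"
  define G where "G = (\<lambda>\<delta> p. I p *\<^sub>R H \<delta> (of_int \<lfloor>fst p / \<delta> + 1 / 2\<rfloor> + snd p))"
  \<comment> \<open>Set to 0 unless \<open>small_step s \<delta>\<close> holds, which is where
    continuity and the majorant are available. Thus measurability and domination hold for every
    \<delta>, as needed for dominated convergence.\<close>
  define G0 where "G0 = (\<lambda>\<delta> p. if small_step s \<delta> then G \<delta> p else 0)"
  have sP: "sets ?P = sets borel"
  proof -
    have "sets ?P = sets (borel \<Otimes>\<^sub>M borel :: (real \<times> real) measure)"
      by (rule sets_pair_measure_cong) simp_all
    then show ?thesis unfolding borel_prod .
  qed
  have U[measurable]: "UNIV \<times> {-1/2..1/2::real} \<in> sets ?P" by (simp add: pair_measureI)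
  have IM[measurable]: "I \<in> borel_measurable ?P" unfolding I_def by measurable
  have "(\<lambda>p. J_c m k u v \<rho> \<sigma> (fst p) (snd p)) \<in> borel_measurable ?P"
    using J_c_measurable by (simp only: measurable_cong_sets[OF sP refl])
  then have fm: "f \<in> borel_measurable ?P" unfolding f_def by measurable
  have Hm: "H \<delta> \<in> borel_measurable borel" if "small_step s \<delta>" for \<delta>
  proof -
    note c = gamma_pair_continuous[OF s u that, of m]
    have "continuous_on UNIV (H \<delta>)" unfolding H_def line_integrand_def
      by (intro continuous_intros c continuous_on_compose2[OF c]) auto
    then show ?thesis by (rule borel_measurable_continuous_onI)
  qed
  have Gm: "G \<delta> \<in> borel_measurable ?P" if "small_step s \<delta>" for \<delta>
  proof -
    have [measurable]: "H \<delta> \<in> borel_measurable borel" by (rule Hm[OF that])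
    show ?thesis unfolding G_def by measurable
  qed
  have G0m: "G0 \<delta> \<in> borel_measurable ?P" for \<delta>
  proof (cases "small_step s \<delta>")
    case True
    then have "G0 \<delta> = G \<delta>" by (auto simp: G0_def)
    then show ?thesis using Gm[OF True] by simp
  next
    case False
    then have "G0 \<delta> = (\<lambda>_. 0)" by (auto simp: G0_def)
    then show ?thesis by simp
  qed
  obtain C where C: "C > 0" "\<And>\<delta> \<alpha> \<beta>. small_step s \<delta> \<Longrightarrow> \<bar>\<beta>\<bar> \<le> 1 / 2 \<Longrightarrow> \<alpha> \<noteq> 0 \<Longrightarrow> \<alpha> \<noteq> \<rho> \<Longrightarrow>
     (\<forall>l::int. \<beta> \<noteq> of_int l \<and> \<beta> - \<sigma> \<noteq> of_int l) \<Longrightarrow>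
     norm (H \<delta> (of_int \<lfloor>\<alpha> / \<delta> + 1 / 2\<rfloor> + \<beta>))
       \<le> C * (exp (- (2 * pi * s * \<bar>\<alpha>\<bar>)) * (peak r \<alpha> * triple_peak r \<beta> + peak r (\<alpha> - \<rho>) * triple_peak r (\<beta> - \<sigma>)))"
    using line_integrand_bound[OF s u assms(2,3), of m k v] unfolding H_def r_def by blast
  define J where "J = (indicator {-1/2..1/2} :: real \<Rightarrow> real)"
  \<comment> \<open>Each summand is a function of \<alpha> times a function of \<beta>. The
    differences with 0 give both singularities the same shape, so one pair of integrability lemmas
    covers them.\<close>
  define w where "w = (\<lambda>p. C * ((exp (- (2 * pi * s * \<bar>fst p\<bar>)) * peak r (fst p - 0)) * (J (snd p) * triple_peak r (snd p - 0)) +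
      (exp (- (2 * pi * s * \<bar>fst p\<bar>)) * peak r (fst p - \<rho>)) * (J (snd p) * triple_peak r (snd p - \<sigma>))))"
  have pk: "integrable lborel (\<lambda>x. exp (- (2 * pi * s * \<bar>x\<bar>)) * peak r (x - t))" for t
    using integrable_peak[of "2 * pi * s" r t] s r by simp
  have wint: "integrable ?P w"
    unfolding w_def J_def using r assms(3)
    by (intro integrable_mult_right Bochner_Integration.integrable_add integrable_lborel_prod[OF pk] integrable_triple_peak) auto
  have wnn: "0 \<le> w p" for p
    using C(1) by (simp add: w_def J_def peak_def triple_peak_def)
  \<comment> \<open>On the excluded lines a base of \<open>powr\<close> is 0 and so, by convention,
    is the power; there the majorant need not dominate. These lines form a null set.\<close>
  define good where "good = (\<lambda>p. fst p \<noteq> 0 \<and> fst p \<noteq> \<rho> \<and> snd p \<notin> (\<int>::real set) \<and> snd p - \<sigma> \<notin> (\<int>::real set))"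
  have Zm[measurable]: "(\<int>::real set) \<in> sets borel" by (rule borel_closed[OF closed_Ints])
  have AEg: "AE p in ?P. good p"
  proof (rule lborel_pair.AE_pair_measure)
    show "{p \<in> space ?P. good p} \<in> sets ?P" unfolding good_def by measurable
    have c1: "{b. b \<in> (\<int>::real set)} \<in> null_sets lborel"
      by (rule countable_imp_null_set_lborel) (simp add: countable_int)
    have "{b. b - \<sigma> \<in> (\<int>::real set)} = (\<lambda>n. n + \<sigma>) ` \<int>" by (force simp: image_iff)
    then have "countable {b. b - \<sigma> \<in> (\<int>::real set)}" by (simp add: countable_int)
    then have c2: "{b. b - \<sigma> \<in> (\<int>::real set)} \<in> null_sets lborel" by (rule countable_imp_null_set_lborel)
    have B: "AE b in lborel. b \<notin> (\<int>::real set) \<and> b - \<sigma> \<notin> (\<int>::real set)"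
      using AE_not_in[OF c1] AE_not_in[OF c2] by eventually_elim simp
    show "AE a in lborel. AE b in lborel. good (a, b)"
      using AE_lborel_singleton[of 0] AE_lborel_singleton[of \<rho>]
    proof eventually_elim
      case (elim a)
      show ?case using B by eventually_elim (use elim in \<open>simp add: good_def\<close>)
    qed
  qed
  have G0b: "norm (G0 \<delta> p) \<le> w p" if "good p" for \<delta> p
  proof (cases "small_step s \<delta> \<and> \<bar>snd p\<bar> \<le> 1 / 2")
    case True
    then have I: "I p = 1" "J (snd p) = 1" by (auto simp: I_def J_def indicator_def mem_Times_iff abs_le_iff)
    have "\<forall>l::int. snd p \<noteq> of_int l \<and> snd p - \<sigma> \<noteq> of_int l" using that by (metis Ints_of_int good_def)
    then have "norm (H \<delta> (of_int \<lfloor>fst p / \<delta> + 1 / 2\<rfloor> + snd p)) \<le> C * (exp (- (2 * pi * s * \<bar>fst p\<bar>)) *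
        (peak r (fst p) * triple_peak r (snd p) + peak r (fst p - \<rho>) * triple_peak r (snd p - \<sigma>)))"
      using True that by (intro C(2)) (auto simp: good_def)
    then show ?thesis using True by (simp add: G0_def G_def I w_def algebra_simps)
  next
    case False
    then have "G0 \<delta> p = 0" by (auto simp: G0_def G_def I_def indicator_def mem_Times_iff abs_le_iff)
    then show ?thesis using wnn by simp
  qed
  have evs: "\<forall>\<^sub>F \<delta> in at_right 0. small_step s \<delta>" by (rule eventually_small_step[OF s(2)])
  have limG: "((\<lambda>\<delta>. G0 \<delta> p) \<longlongrightarrow> f p) (at_right 0)" if "good p" for p
  proof (rule Lim_transform_eventually)
    show "((\<lambda>\<delta>. G \<delta> p) \<longlongrightarrow> f p) (at_right 0)"
      unfolding G_def f_def H_def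
      by (intro tendsto_scaleR tendsto_const line_integrand_tendsto[OF s u]) (use that in \<open>auto simp: good_def\<close>)
    show "\<forall>\<^sub>F \<delta> in at_right 0. G \<delta> p = G0 \<delta> p" using evs by eventually_elim (simp add: G0_def)
  qed
  \<comment> \<open>The substitution \<open>\<delta> = inverse t\<close> turns the limit at 0 from
    the right into a limit at infinity, the form in which dominated convergence is applied.\<close>
  have AElim: "AE p in ?P. ((\<lambda>t. G0 (inverse t) p) \<longlongrightarrow> f p) at_top"
    using AEg by eventually_elim (use limG in \<open>simp add: filterlim_at_right_to_top\<close>)
  have AEb: "\<forall>\<^sub>F t in at_top. AE p in ?P. norm (G0 (inverse t) p) \<le> w p"
  proof (rule always_eventually, rule allI)
    fix t
    show "AE p in ?P. norm (G0 (inverse t) p) \<le> w p"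
      using AEg by eventually_elim (rule G0b)
  qed
  have fint: "integrable ?P f"
    by (rule integrable_dominated_convergence_at_top[OF fm G0m wint AElim AEb])
  have "((\<lambda>t. integral\<^sup>L ?P (G0 (inverse t))) \<longlongrightarrow> integral\<^sup>L ?P f) at_top"
    by (rule integral_dominated_convergence_at_top[OF fm G0m wint AElim AEb])
  then have lim: "((\<lambda>\<delta>. integral\<^sup>L ?P (G0 \<delta>)) \<longlongrightarrow> integral\<^sup>L ?P f) (at_right 0)"
    by (simp add: filterlim_at_right_to_top)
  have step: "imag_axis_integrable (F \<delta>) \<and> integral\<^sup>L ?P (G0 \<delta>) = of_real \<delta> * imag_axis_integral (F \<delta>)"
    if ss: "small_step s \<delta>" for \<delta>
  proof -
    have \<delta>: "0 < \<delta>" using ss by simp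
    have GG: "G0 \<delta> = G \<delta>" using ss by (simp add: G0_def)
    have "integrable ?P (G \<delta>)"
    proof (rule Bochner_Integration.integrable_bound[OF wint Gm[OF ss]])
      show "AE p in ?P. norm (G \<delta> p) \<le> norm (w p)"
        using AEg by eventually_elim (use G0b[of _ \<delta>] wnn GG in auto)
    qed
    then have "integrable lborel (H \<delta>)"
      using integral_round_shift(1)[OF Hm[OF ss] \<delta>] by (simp add: G_def I_def)
    moreover have "integral\<^sup>L ?P (G \<delta>) = of_real \<delta> * integral\<^sup>L lborel (H \<delta>)"
      using integral_round_shift(2)[OF Hm[OF ss] \<delta>] by (simp add: G_def I_def)
    ultimately show ?thesis
      unfolding F_def GG H_def by (simp add: imag_axis_eq_line_integrand)
  qed
  have le: "at 0 within Deltas \<le> at_right (0::real)" by (rule at_le) (auto simp: Deltas_def)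
  have ev: "\<forall>\<^sub>F \<delta> in at 0 within Deltas. small_step s \<delta>" using filter_leD[OF le evs] .
  have lim': "((\<lambda>\<delta>. of_real \<delta> * imag_axis_integral (F \<delta>)) \<longlongrightarrow> integral\<^sup>L ?P f) (at 0 within Deltas)"
  proof (rule Lim_transform_eventually)
    show "((\<lambda>\<delta>. integral\<^sup>L ?P (G0 \<delta>)) \<longlongrightarrow> integral\<^sup>L ?P f) (at 0 within Deltas)"
      by (rule tendsto_mono[OF le lim])
    show "\<forall>\<^sub>F \<delta> in at 0 within Deltas. integral\<^sup>L ?P (G0 \<delta>) = of_real \<delta> * imag_axis_integral (F \<delta>)"
      using ev by eventually_elim (use step in blast)
  qed
  have "integral\<^sup>L ?P f = (\<integral>\<alpha>. (\<integral>\<beta>. f (\<alpha>, \<beta>) \<partial>lborel) \<partial>lborel)"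
    by (rule lborel_pair.integral_fst'[OF fint, symmetric])
  also have "\<dots> = (LINT \<alpha>|lborel. (LINT \<beta>:{-1/2..1/2}|lborel. J_c m k u v \<rho> \<sigma> \<alpha> \<beta>))"
    by (simp add: set_lebesgue_integral_def f_def I_def indicator_times)
  finally have fub: "integral\<^sup>L ?P f = (LINT \<alpha>|lborel. (LINT \<beta>:{-1/2..1/2}|lborel. J_c m k u v \<rho> \<sigma> \<alpha> \<beta>))" .
  have "set_integrable ?P (UNIV \<times> {-1/2..1/2}) (\<lambda>(\<alpha>, \<beta>). J_c m k u v \<rho> \<sigma> \<alpha> \<beta>)"
    using fint by (simp add: set_integrable_def f_def I_def case_prod_unfold)
  moreover have "\<forall>\<^sub>F \<delta> in at 0 within Deltas. imag_axis_integrable (F \<delta>)"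
    using ev by eventually_elim (use step in blast)
  ultimately show ?thesis using lim' unfolding fub by blast
qed

end
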